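(* Let $n\ge 2$ and let $\Omega=B_0(1)=\{x\in\mathbb{R}^n:|x|<1\}$. For $m\in L^\infty_+(B_0(1))$ and $d\in(0,1/\lambda_1(m))$, let $u_{d,m}$ be the solution of $$d\,\Delta u+u(m(x)-u)=0,\quad u>0\ \text{ in }B_0(1),\qquad u=0\ \text{ on }\partial B_0(1).$$ Then $$\sup\left\{\frac{\|u_{d,m}\|_{L^1(B_0(1))}}{\|m\|_{L^1(B_0(1))}}\ :\ m\in L^\infty_+(B_0(1)),\ d\in(0,1/\lambda_1(m))\right\}=+\infty.$$
   Context: $L^\infty_+(\Omega):=\{f\in L^\infty(\Omega): f(x)\ge 0\text{ for a.e. }x\in\Omega,\ \|f\|_{L^\infty}>0\}$. For $m\in L^\infty_+(\Omega)$, $\lambda_1(m)>0$ denotes the least eigenvalue of the weighted Dirichlet eigenvalue problem $\Delta\phi+\lambda m(x)\phi=0$ in $\Omega$, $\phi=0$ on $\partial\Omega$. It is known (Cantrell–Cosner) that for every $m\in L^\infty_+(\Omega)$ and $d\in(0,1/\lambda_1(m))$ the boundary value problem has a unique solution $u_{d,m}$ in $W^{2,p}(\Omega)\cap W^{1,p}_0(\Omega)$ (any $p>1$); the equation is understood a.e. *)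

theory Defs
  imports "HOL-Analysis.Analysis" "HOL-Probability.Essential_Supremum"
begin

text \<open>
  Elements of Lebesgue and Sobolev spaces are represented by functions on the whole space, of which
  only the values almost everywhere on \<open>\<Omega>\<close> matter.
\<close>

definition Linf_norm :: "'a::euclidean_space set \<Rightarrow> ('a \<Rightarrow> real) \<Rightarrow> ereal" where
  "Linf_norm \<Omega> f = esssup (lebesgue_on \<Omega>) (\<lambda>x. ereal \<bar>f x\<bar>)"

definition Linf_space :: "'a::euclidean_space set \<Rightarrow> ('a \<Rightarrow> real) set" where
  "Linf_space \<Omega> = {f \<in> borel_measurable (lebesgue_on \<Omega>). Linf_norm \<Omega> f < \<infinity>}"

definition Linf_plus :: "'a::euclidean_space set \<Rightarrow> ('a \<Rightarrow> real) set" where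
  "Linf_plus \<Omega> = {f \<in> Linf_space \<Omega>. (AE x in lebesgue_on \<Omega>. f x \<ge> 0) \<and> Linf_norm \<Omega> f > 0}"

definition Lp_space :: "'a::euclidean_space set \<Rightarrow> real \<Rightarrow> ('a \<Rightarrow> real) set" where
  "Lp_space \<Omega> p =
     {f \<in> borel_measurable (lebesgue_on \<Omega>). integrable (lebesgue_on \<Omega>) (\<lambda>x. \<bar>f x\<bar> powr p)}"

text \<open>Only meaningful on \<^const>\<open>Lp_space\<close>: the Bochner integral of a non-integrable function is 0.\<close>

definition Lp_norm :: "'a::euclidean_space set \<Rightarrow> real \<Rightarrow> ('a \<Rightarrow> real) \<Rightarrow> real" where
  "Lp_norm \<Omega> p f = (LINT x|lebesgue_on \<Omega>. \<bar>f x\<bar> powr p) powr (1 / p)"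

definition pderiv_at :: "'a::euclidean_space \<Rightarrow> ('a \<Rightarrow> real) \<Rightarrow> 'a \<Rightarrow> real" where
  "pderiv_at b f x = frechet_derivative f (at x) b"

primrec Ck :: "nat \<Rightarrow> ('a::euclidean_space \<Rightarrow> real) \<Rightarrow> bool" where
  "Ck 0 f \<longleftrightarrow> continuous_on UNIV f"
| "Ck (Suc k) f \<longleftrightarrow> (\<forall>x. f differentiable (at x)) \<and> (\<forall>b\<in>Basis. Ck k (pderiv_at b f))"

definition test_functions :: "'a::euclidean_space set \<Rightarrow> ('a \<Rightarrow> real) set" where
  "test_functions \<Omega> =
     {\<phi>. (\<forall>k. Ck k \<phi>) \<and> compact (closure {x. \<phi> x \<noteq> 0}) \<and> closure {x. \<phi> x \<noteq> 0} \<subseteq> \<Omega>}"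

definition locally_integrable :: "'a::euclidean_space set \<Rightarrow> ('a \<Rightarrow> real) \<Rightarrow> bool" where
  "locally_integrable \<Omega> f \<longleftrightarrow> (\<forall>K. compact K \<and> K \<subseteq> \<Omega> \<longrightarrow> f absolutely_integrable_on K)"

definition weak_pderiv ::
    "'a::euclidean_space set \<Rightarrow> 'a \<Rightarrow> ('a \<Rightarrow> real) \<Rightarrow> ('a \<Rightarrow> real) \<Rightarrow> bool" where
  "weak_pderiv \<Omega> b u g \<longleftrightarrow> locally_integrable \<Omega> u \<and> locally_integrable \<Omega> g \<and>
     (\<forall>\<phi>\<in>test_functions \<Omega>.
        (LINT x|lebesgue_on \<Omega>. u x * pderiv_at b \<phi> x) = - (LINT x|lebesgue_on \<Omega>. g x * \<phi> x))"

text \<open>The space \<open>W\<^sup>k\<^sup>,\<^sup>p(\<Omega>)\<close>.\<close>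

primrec sobolev :: "'a::euclidean_space set \<Rightarrow> nat \<Rightarrow> real \<Rightarrow> ('a \<Rightarrow> real) set" where
  "sobolev \<Omega> 0 p = Lp_space \<Omega> p"
| "sobolev \<Omega> (Suc k) p =
     {u \<in> Lp_space \<Omega> p. \<forall>b\<in>Basis. \<exists>g\<in>sobolev \<Omega> k p. weak_pderiv \<Omega> b u g}"

text \<open>The space \<open>W\<^sub>0\<^sup>1\<^sup>,\<^sup>p(\<Omega>)\<close>: the closure of the test functions in \<open>W\<^sup>1\<^sup>,\<^sup>p(\<Omega>)\<close>.\<close>

definition sobolev0 :: "'a::euclidean_space set \<Rightarrow> real \<Rightarrow> ('a \<Rightarrow> real) set" where
  "sobolev0 \<Omega> p = {u \<in> sobolev \<Omega> 1 p. \<exists>\<phi>. (\<forall>j::nat. \<phi> j \<in> test_functions \<Omega>) \<and>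
     (\<lambda>j. Lp_norm \<Omega> p (\<lambda>x. \<phi> j x - u x)) \<longlonglongrightarrow> 0 \<and>
     (\<forall>b\<in>Basis. \<exists>g\<in>Lp_space \<Omega> p. weak_pderiv \<Omega> b u g \<and>
        (\<lambda>j. Lp_norm \<Omega> p (\<lambda>x. pderiv_at b (\<phi> j) x - g x)) \<longlonglongrightarrow> 0)}"

definition dirichlet_space :: "'a::euclidean_space set \<Rightarrow> ('a \<Rightarrow> real) set" where
  "dirichlet_space \<Omega> = (\<Inter>p\<in>{1<..}. sobolev \<Omega> 2 p \<inter> sobolev0 \<Omega> p)"

text \<open>A relation because the weak Laplacian \<open>w\<close> of \<open>u\<close> is determined only almost everywhere.\<close>

definition weak_laplacian :: "'a::euclidean_space set \<Rightarrow> ('a \<Rightarrow> real) \<Rightarrow> ('a \<Rightarrow> real) \<Rightarrow> bool" where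
  "weak_laplacian \<Omega> u w \<longleftrightarrow> (\<exists>G H.
     (\<forall>b\<in>Basis. weak_pderiv \<Omega> b u (G b) \<and> weak_pderiv \<Omega> b (G b) (H b)) \<and>
     w = (\<lambda>x. \<Sum>b\<in>Basis. H b x))"

definition is_eigenvalue :: "'a::euclidean_space set \<Rightarrow> ('a \<Rightarrow> real) \<Rightarrow> real \<Rightarrow> bool" where
  "is_eigenvalue \<Omega> m \<mu> \<longleftrightarrow> (\<exists>\<phi>\<in>dirichlet_space \<Omega>. \<exists>w.
     \<not> (AE x in lebesgue_on \<Omega>. \<phi> x = 0) \<and>
     weak_laplacian \<Omega> \<phi> w \<and> (AE x in lebesgue_on \<Omega>. w x + \<mu> * m x * \<phi> x = 0))"

definition lambda1 :: "'a::euclidean_space set \<Rightarrow> ('a \<Rightarrow> real) \<Rightarrow> real" where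
  "lambda1 \<Omega> m = (LEAST \<mu>. is_eigenvalue \<Omega> m \<mu>)"

text \<open>
  Members of \<open>W\<^sup>2\<^sup>,\<^sup>p(\<Omega>)\<close> with large \<open>p\<close> have a continuous representative; positivity in \<open>\<Omega>\<close> refers to
  that representative, so \<open>u\<close> is required to be it.
\<close>

definition is_logistic_solution ::
    "'a::euclidean_space set \<Rightarrow> real \<Rightarrow> ('a \<Rightarrow> real) \<Rightarrow> ('a \<Rightarrow> real) \<Rightarrow> bool" where
  "is_logistic_solution \<Omega> d m u \<longleftrightarrow> u \<in> dirichlet_space \<Omega> \<and>
     continuous_on \<Omega> u \<and> (\<forall>x\<in>\<Omega>. u x > 0) \<and>
     (\<exists>w. weak_laplacian \<Omega> u w \<and>
          (AE x in lebesgue_on \<Omega>. d * w x + u x * (m x - u x) = 0))"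

end

theory Submission
  imports Defs
begin

text \<open>
  Replacing \<open>(d, m, u)\<close> by \<open>(t d, t m, t u)\<close> changes neither the equation nor the ratio of the norms, so
  nothing is lost by taking \<open>d = 1\<close>. A positive \<open>u\<close> that vanishes on the sphere solves the equation
  with resource \<open>m = u - \<Delta>u / u\<close>; what is needed is a \<open>u\<close> with \<open>\<Delta>u < u\<^sup>2\<close>, so that \<open>m > 0\<close>, and with
  \<open>\<Delta>u\<close> so close to \<open>u\<^sup>2\<close> on most of the ball that \<open>m\<close> has much less mass than \<open>u\<close>.

  Let \<open>\<rho>\<close> be a radial bump of fixed mass supported in \<open>|x| \<le> e\<close>, let \<open>G\<close> be the solution of
  \<open>-\<Delta>G = \<rho>\<close> with \<open>G = 0\<close> on the sphere, and let \<open>\<chi>\<close> be a cutoff that is small near the origin and close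
  to \<open>1\<close> elsewhere. Put \<open>\<theta> = (1 - \<delta>)\<^sup>2\<close> and let \<open>u\<close> solve \<open>-\<Delta>u = c \<rho> - \<theta> c\<^sup>2 \<chi> G\<^sup>2\<close>. The cutoff bounds
  \<open>\<chi> G\<^sup>2\<close> independently of \<open>e\<close>, so a constant \<open>c\<close> that does not depend on \<open>e\<close> gives
  \<open>(1 - \<delta>) c G \<le> u \<le> c G\<close>. From this, \<open>0 < m \<le> 2 \<delta> u + c G (1 - \<chi>) + \<rho> / ((1 - \<delta>) G)\<close>
  (lemma \<open>logistic_profile\<close>). The integral of \<open>u\<close> is at least a constant multiple of \<open>c\<close>. The first term is a
  small part of \<open>u\<close>; the second one has small integral since the mass of \<open>G\<close> in \<open>|x| \<le> r\<close> is \<open>O(r)\<close> uniformly in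
  \<open>e\<close>; the third one has integral \<open>O(1 / log (1 / e))\<close>, because in dimension at least two \<open>G\<close> is at least a
  multiple of \<open>log (1 / e)\<close> on the support of \<open>\<rho>\<close>. Choosing first \<open>\<delta>\<close>, then \<open>\<chi>\<close>, then \<open>e\<close> makes the mass of
  \<open>m\<close> an arbitrarily small part of the mass of \<open>u\<close> (lemma \<open>exists_small_resource_profile\<close>).

  It remains to see that \<open>d = 1\<close> is admissible, that is, that \<open>m\<close> has a least eigenvalue and that it is
  smaller than \<open>1\<close>. The radial solution of \<open>\<Delta>\<phi> + \<kappa> m \<phi> = 0\<close>, \<open>\<phi>(0) = 1\<close> is a power series in \<open>\<kappa>\<close>. For the
  first \<open>\<kappa>\<close> at which it has a zero in the closed ball, it is nonnegative and strictly decreasing in \<open>|x|\<close>, so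
  that its zero is at \<open>|x| = 1\<close> and it is a positive eigenfunction. A Sturm comparison with \<open>u\<close>, which solves
  \<open>\<Delta>u + (m - u) u = 0\<close>, shows that this happens before \<open>\<kappa> = 1\<close> (lemma \<open>principal_radial_solution\<close>). Picone's
  inequality shows that no eigenvalue is smaller than one that has a positive eigenfunction (lemma
  \<open>positive_eigenfunction_le_eigenvalue\<close>).

  Radial functions are written as \<open>F(|x|\<^sup>2)\<close>: in the variable \<open>s = |x|\<^sup>2\<close> the Laplacian \<open>4 s F'' + 2 n F'\<close> has
  no singular term at the origin, and \<open>F(|x|\<^sup>2)\<close> is as smooth as \<open>F\<close>.
\<close>

section \<open>Integration by parts with compact support\<close>

text \<open>
  The difference quotients of \<open>P\<close> in direction \<open>b\<close> have integral zero by translation invariance of the Lebesgue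
  measure, and they converge boundedly to \<open>D\<close>.
\<close>
lemma integral_directional_derivative_eq_0:
  fixes P D :: "'a::euclidean_space \<Rightarrow> real"
  assumes der: "\<And>x. ((\<lambda>t. P (x + t *\<^sub>R b)) has_real_derivative D x) (at 0)"
    and contP: "continuous_on UNIV P" and contD: "continuous_on UNIV D"
    and supp: "\<And>x. R \<le> norm x \<Longrightarrow> P x = 0"
  shows "integral\<^sup>L lborel D = 0"
proof -
  define t where "t k = inverse (real (Suc k))" for k
  define I where "I k x = (P (x + t k *\<^sub>R b) - P x) / t k" for k x
  define R' where "R' = \<bar>R\<bar> + norm b"
  have tpos: "t k > 0" and tle: "t k \<le> 1" for k
    by (auto simp: t_def inverse_le_1_iff)
  have t0: "t \<longlonglongrightarrow> 0"
    unfolding t_def by (rule LIMSEQ_inverse_real_of_nat)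
  have der': "((\<lambda>t. P (x + t *\<^sub>R b)) has_real_derivative D (x + s *\<^sub>R b)) (at s)" for x s
  proof -
    have "((\<lambda>t. P ((x + s *\<^sub>R b) + (t - s) *\<^sub>R b)) has_real_derivative D (x + s *\<^sub>R b) * 1) (at s)"
      by (rule DERIV_chain2[where f="\<lambda>t. P ((x + s *\<^sub>R b) + t *\<^sub>R b)"])
         (use der[of "x + s *\<^sub>R b"] in \<open>auto intro!: derivative_eq_intros\<close>)
    then show ?thesis by (simp add: algebra_simps)
  qed
  have bd: "bounded (D ` cball 0 R')"
    by (intro compact_imp_bounded compact_continuous_image continuous_on_subset[OF contD]) auto
  then obtain C where C: "\<And>x. x \<in> cball 0 R' \<Longrightarrow> \<bar>D x\<bar> \<le> C"
    unfolding bounded_iff by (metis image_eqI real_norm_def)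
  have D0: "D x = 0" if "R' < norm x" for x
  proof -
    have "\<bar>R\<bar> < norm x" using that norm_ge_zero[of b] unfolding R'_def by linarith
    have "((\<lambda>t. P (x + t *\<^sub>R b)) has_real_derivative 0) (at 0)"
    proof (rule has_field_derivative_transform_within_open[where S="{-1<..<1}" and f="\<lambda>_. 0"])
      show "0 = P (x + s *\<^sub>R b)" if "s \<in> {-1<..<1}" for s
      proof -
        have "norm (s *\<^sub>R b) \<le> 1 * norm b"
          using that by (simp only: norm_scaleR) (intro mult_right_mono, auto)
        moreover have "norm x - norm (s *\<^sub>R b) \<le> norm (x + s *\<^sub>R b)"
          by (metis add_diff_cancel norm_triangle_ineq2 diff_minus_eq_add norm_minus_cancel)
        ultimately have "R \<le> norm (x + s *\<^sub>R b)"
          using \<open>R' < norm x\<close> unfolding R'_def by linarith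
        then show ?thesis using supp by simp
      qed
    qed auto
    then show ?thesis using der DERIV_unique by blast
  qed
  have Cnn: "0 \<le> C" using C[of 0] by (simp add: R'_def)
  have DC: "\<bar>D x\<bar> \<le> C" for x
    using C[of x] D0[of x] Cnn by (cases "norm x \<le> R'") auto
  have Pint: "integrable lborel P"
  proof -
    have "integrable lborel (\<lambda>x. indicator (cball 0 \<bar>R\<bar>) x *\<^sub>R P x)"
      by (rule borel_integrable_compact) (auto intro: continuous_on_subset[OF contP])
    also have "(\<lambda>x. indicator (cball 0 \<bar>R\<bar>) x *\<^sub>R P x) = P"
      using supp by (auto simp: fun_eq_iff indicator_def)
    finally show ?thesis .
  qed
  have shift: "integrable lborel (\<lambda>x. P (x + c))" "integral\<^sup>L lborel (\<lambda>x. P (x + c)) = integral\<^sup>L lborel P" for c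
  proof -
    have [measurable]: "P \<in> borel_measurable borel" using contP by (rule borel_measurable_continuous_onI)
    have e: "lborel = distr lborel borel ((+) c)" by (simp add: lborel_distr_plus)
    show "integrable lborel (\<lambda>x. P (x + c))"
      using Pint by (subst (asm) e) (simp add: integrable_distr_eq add.commute)
    show "integral\<^sup>L lborel (\<lambda>x. P (x + c)) = integral\<^sup>L lborel P"
      by (subst (2) e) (simp add: integral_distr add.commute)
  qed
  have I0: "integral\<^sup>L lborel (I k) = 0" for k
    unfolding I_def using shift[of "t k *\<^sub>R b"] Pint by simp
  have "(\<lambda>k. integral\<^sup>L lborel (I k)) \<longlonglongrightarrow> integral\<^sup>L lborel D"
  proof (rule integral_dominated_convergence[where w="\<lambda>x. C * indicator (cball 0 R') x"])
    show "D \<in> borel_measurable lborel" using contD by (simp add: borel_measurable_continuous_onI)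
    show "I k \<in> borel_measurable lborel" for k
      unfolding I_def using shift Pint by (auto intro!: borel_measurable_divide borel_measurable_diff borel_measurable_integrable)
    show "integrable lborel (\<lambda>x. C * indicator (cball 0 R') x)"
      by (intro integrable_mult_right integrable_real_indicator) (use emeasure_compact_finite[OF compact_cball, of 0 R'] in auto)
    show "AE x in lborel. (\<lambda>k. I k x) \<longlonglongrightarrow> D x"
    proof (rule AE_I2)
      fix x
      have "((\<lambda>h. (P (x + h *\<^sub>R b) - P x) / h) \<longlongrightarrow> D x) (at 0)"
        using der[of x] by (simp add: DERIV_def)
      moreover have "filterlim t (at 0) sequentially"
        using t0 tpos by (auto simp: filterlim_at intro!: always_eventually less_imp_neq[symmetric])
      ultimately show "(\<lambda>k. I k x) \<longlonglongrightarrow> D x"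
        unfolding I_def by (rule filterlim_compose)
    qed
    show "AE x in lborel. norm (I k x) \<le> C * indicator (cball 0 R') x" for k
    proof (rule AE_I2)
      fix x
      show "norm (I k x) \<le> C * indicator (cball 0 R') x"
      proof (cases "norm x \<le> R'")
        case True
        obtain z where "P (x + t k *\<^sub>R b) - P (x + 0 *\<^sub>R b) = (t k - 0) * D (x + z *\<^sub>R b)"
          using MVT2[OF tpos[of k] der'[of x]] by blast
        then have "\<bar>I k x\<bar> \<le> C" using DC tpos[of k] by (simp add: I_def)
        then show ?thesis using True by simp
      next
        case False
        have "norm (t k *\<^sub>R b) \<le> 1 * norm b"
          using tle[of k] tpos[of k] by (simp only: norm_scaleR) (intro mult_right_mono, auto)
        moreover have "norm x - norm (t k *\<^sub>R b) \<le> norm (x + t k *\<^sub>R b)"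
          by (metis add_diff_cancel norm_triangle_ineq2 diff_minus_eq_add norm_minus_cancel)
        ultimately have "R \<le> norm (x + t k *\<^sub>R b)" "R \<le> norm x"
          using False norm_ge_zero[of b] unfolding R'_def by linarith+
        then show ?thesis using supp False by (simp add: I_def)
      qed
    qed
  qed
  then have "(\<lambda>k. 0::real) \<longlonglongrightarrow> integral\<^sup>L lborel D" by (simp only: I0)
  then show ?thesis by (simp add: LIMSEQ_const_iff)
qed

lemma continuous_on_zero_extension:
  fixes X :: "'a::euclidean_space \<Rightarrow> real"
  assumes "open \<Omega>" "closed K" "K \<subseteq> \<Omega>" "continuous_on \<Omega> X"
    and "\<And>x. x \<in> \<Omega> \<Longrightarrow> x \<notin> K \<Longrightarrow> X x = 0"
  shows "continuous_on UNIV (\<lambda>x. if x \<in> \<Omega> then X x else 0)"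
proof -
  have "continuous_on (\<Omega> \<union> - K) (\<lambda>x. if x \<in> \<Omega> then X x else 0)"
  proof (rule continuous_on_open_Un)
    show "continuous_on \<Omega> (\<lambda>x. if x \<in> \<Omega> then X x else 0)"
      using assms(4) by (simp cong: continuous_on_cong)
    have "continuous_on (- K) (\<lambda>x. 0::real)" by simp
    then show "continuous_on (- K) (\<lambda>x. if x \<in> \<Omega> then X x else 0)"
      by (rule continuous_on_eq) (use assms in auto)
  qed (use assms in \<open>auto simp: open_Compl\<close>)
  moreover have "\<Omega> \<union> - K = UNIV" using assms by auto
  ultimately show ?thesis by simp
qed

lemma line_derivative_zero_off_support:
  fixes X :: "'a::euclidean_space \<Rightarrow> real"
  assumes "open \<Omega>" "closed K"
    and "\<And>x. x \<in> \<Omega> \<Longrightarrow> x \<notin> K \<Longrightarrow> X x = 0"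
    and "((\<lambda>t. X (x + t *\<^sub>R b)) has_real_derivative y) (at 0)" "x \<in> \<Omega>" "x \<notin> K"
  shows "y = 0"
proof -
  define S where "S = (\<lambda>t::real. x + t *\<^sub>R b) -` (\<Omega> \<inter> - K)"
  have "open S" unfolding S_def
    by (rule open_vimage) (use assms in \<open>auto intro!: continuous_intros\<close>)
  have "0 \<in> S" using assms by (simp add: S_def)
  have "((\<lambda>t. X (x + t *\<^sub>R b)) has_real_derivative 0) (at 0)"
    by (rule has_field_derivative_transform_within_open[where S=S and f="\<lambda>_. 0"])
       (use assms \<open>open S\<close> \<open>0 \<in> S\<close> in \<open>auto simp: S_def\<close>)
  then show ?thesis using assms(4) DERIV_unique by blast
qed

text \<open>
  The divergence theorem for one component, for a field on an open set that vanishes off a compact subset: the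
  extension by zero falls under the previous case.
\<close>
lemma integral_line_derivative_compact_support:
  fixes X Y :: "'a::euclidean_space \<Rightarrow> real"
  assumes \<Omega>: "open \<Omega>" and K: "compact K" "K \<subseteq> \<Omega>"
    and contX: "continuous_on \<Omega> X" and contY: "continuous_on \<Omega> Y"
    and supp: "\<And>x. x \<in> \<Omega> \<Longrightarrow> x \<notin> K \<Longrightarrow> X x = 0"
    and der: "\<And>x. x \<in> \<Omega> \<Longrightarrow> ((\<lambda>t. X (x + t *\<^sub>R b)) has_real_derivative Y x) (at 0)"
  shows "integrable (lebesgue_on \<Omega>) Y" "(LINT x|lebesgue_on \<Omega>. Y x) = 0"
proof -
  define P where "P x = (if x \<in> \<Omega> then X x else 0)" for x
  define D where "D x = (if x \<in> \<Omega> then Y x else 0)" for x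
  have clK: "closed K" using K compact_imp_closed by blast
  have Y0: "Y x = 0" if "x \<in> \<Omega>" "x \<notin> K" for x
    by (rule line_derivative_zero_off_support[OF \<Omega> clK supp der]) (use that in auto)
  have cP: "continuous_on UNIV P"
    unfolding P_def by (rule continuous_on_zero_extension[OF \<Omega> clK K(2) contX supp])
  have cD: "continuous_on UNIV D"
    unfolding D_def by (rule continuous_on_zero_extension[OF \<Omega> clK K(2) contY Y0])
  obtain R where R: "\<And>x. x \<in> K \<Longrightarrow> norm x < R"
    using compact_imp_bounded[OF K(1)] by (meson bounded_pos_less)
  have PR: "P x = 0" if "R \<le> norm x" for x
    using R[of x] supp[of x] that by (auto simp: P_def)
  have derP: "((\<lambda>t. P (x + t *\<^sub>R b)) has_real_derivative D x) (at 0)" for x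
  proof (cases "x \<in> \<Omega>")
    case True
    define S where "S = (\<lambda>t::real. x + t *\<^sub>R b) -` \<Omega>"
    have "open S" unfolding S_def
      by (rule open_vimage) (use assms in \<open>auto intro!: continuous_intros\<close>)
    then show ?thesis
      by (rule has_field_derivative_transform_within_open[OF _ _ , rotated 1, where f="\<lambda>t. X (x + t *\<^sub>R b)"])
         (use der[OF True] True in \<open>auto simp: S_def P_def D_def\<close>)
  next
    case False
    define S where "S = (\<lambda>t::real. x + t *\<^sub>R b) -` (-K)"
    have "open S" unfolding S_def
      by (rule open_vimage) (use clK in \<open>auto intro!: continuous_intros\<close>)
    then show ?thesis
      by (rule has_field_derivative_transform_within_open[OF _ _ , rotated 1, where f="\<lambda>t. 0"])
         (use False K supp in \<open>auto simp: S_def P_def D_def\<close>)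
  qed
  have "integral\<^sup>L lborel D = 0"
    by (rule integral_directional_derivative_eq_0[OF derP cP cD PR])
  moreover have Db: "D \<in> borel_measurable borel" using cD by (rule borel_measurable_continuous_onI)
  moreover have iD: "integrable lborel D"
  proof -
    have "integrable lborel (\<lambda>x. indicator K x *\<^sub>R D x)"
      by (rule borel_integrable_compact) (auto intro: continuous_on_subset[OF cD] K)
    also have "(\<lambda>x. indicator K x *\<^sub>R D x) = D"
      using Y0 by (auto simp: fun_eq_iff indicator_def D_def)
    finally show ?thesis .
  qed
  moreover have Di: "D = (\<lambda>x. indicator \<Omega> x *\<^sub>R Y x)" by (auto simp: D_def fun_eq_iff)
  moreover have mO: "\<Omega> \<in> sets lebesgue" using \<Omega> by auto
  ultimately show "integrable (lebesgue_on \<Omega>) Y" "(LINT x|lebesgue_on \<Omega>. Y x) = 0"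
    by (auto simp: integral_restrict_space integrable_restrict_space integral_completion integrable_completion Di[symmetric]
         simp del: Di)
qed

lemma absolutely_integrable_continuous_compact:
  fixes f :: "'a::euclidean_space \<Rightarrow> real"
  assumes "compact K" "continuous_on K f"
  shows "f absolutely_integrable_on K"
proof -
  have "integrable lborel (\<lambda>x. indicator K x *\<^sub>R f x)"
    by (rule borel_integrable_compact) (use assms in auto)
  then show ?thesis
    by (simp add: set_integrable_def integrable_completion borel_measurable_integrable)
qed

lemma integrable_continuous_compact_support:
  fixes h :: "'a::euclidean_space \<Rightarrow> real"
  assumes \<Omega>: "open \<Omega>" and K: "compact K" "K \<subseteq> \<Omega>"
    and h: "continuous_on \<Omega> h" "\<And>x. x \<in> \<Omega> \<Longrightarrow> x \<notin> K \<Longrightarrow> h x = 0"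
  shows "integrable (lebesgue_on \<Omega>) h"
proof -
  have "h absolutely_integrable_on K"
    by (rule absolutely_integrable_continuous_compact[OF K(1) continuous_on_subset[OF h(1) K(2)]])
  then have "integrable lebesgue (\<lambda>x. indicator K x *\<^sub>R h x)" by (simp add: set_integrable_def)
  also have "(\<lambda>x. indicator K x *\<^sub>R h x) = (\<lambda>x. indicator \<Omega> x *\<^sub>R h x)"
    using h(2) K(2) by (auto simp: fun_eq_iff indicator_def)
  finally show ?thesis using \<Omega> by (simp add: integrable_restrict_space)
qed

section \<open>Test functions\<close>

definition smooth_real :: "(real \<Rightarrow> real) \<Rightarrow> bool" where
  "smooth_real f \<longleftrightarrow> (\<exists>g. g (0::nat) = f \<and> (\<forall>k x. (g k has_real_derivative g (Suc k) x) (at x)))"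

lemma smooth_realD:
  assumes "smooth_real f"
  obtains f' where "smooth_real f'" "\<And>x. (f has_real_derivative f' x) (at x)"
proof -
  obtain g where g: "g (0::nat) = f" "\<And>k x. (g k has_real_derivative g (Suc k) x) (at x)"
    using assms by (auto simp: smooth_real_def)
  have "smooth_real (g 1)"
    unfolding smooth_real_def by (rule exI[of _ "\<lambda>k. g (Suc k)"]) (auto simp: g(2))
  then show ?thesis using that[of "g 1"] g(2)[of 0] by (simp add: g(1))
qed

lemma smooth_realI:
  assumes "smooth_real f'" "\<And>x. (f has_real_derivative f' x) (at x)"
  shows "smooth_real f"
proof -
  obtain g where g: "g (0::nat) = f'" "\<And>k x. (g k has_real_derivative g (Suc k) x) (at x)"
    using assms(1) by (auto simp: smooth_real_def)
  show ?thesis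
    unfolding smooth_real_def
    by (rule exI[of _ "\<lambda>k. case k of 0 \<Rightarrow> f | Suc k \<Rightarrow> g k"])
       (auto split: nat.split simp: g assms(2))
qed

lemma smooth_real_affine:
  assumes "smooth_real f"
  shows "smooth_real (\<lambda>x. f (a * x + b))"
proof -
  obtain g where g: "g (0::nat) = f" "\<And>k x. (g k has_real_derivative g (Suc k) x) (at x)"
    using assms(1) by (auto simp: smooth_real_def)
  have "((\<lambda>x. a ^ k * g k (a * x + b)) has_real_derivative a ^ Suc k * g (Suc k) (a * x + b)) (at x)" for k x
  proof -
    have "((\<lambda>x. g k (a * x + b)) has_real_derivative g (Suc k) (a * x + b) * a) (at x)"
      by (rule DERIV_chain2[OF g(2)]) (auto intro!: derivative_eq_intros)
    from DERIV_cmult[OF this, of "a ^ k"] show ?thesis by (simp add: algebra_simps)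
  qed
  then show ?thesis unfolding smooth_real_def
    by (intro exI[of _ "\<lambda>k x. a ^ k * g k (a * x + b)"]) (auto simp: g(1))
qed

text \<open>
  The derivative of a polynomial function is again one, so iterating a choice of derivatives gives them all.
\<close>
lemma smooth_real_polynomial:
  assumes "real_polynomial_function p"
  shows "smooth_real p"
proof -
  obtain d where d: "\<And>p::real \<Rightarrow> real. real_polynomial_function p \<Longrightarrow> real_polynomial_function (d p) \<and>
      (\<forall>x. (p has_real_derivative d p x) (at x))"
    using has_real_derivative_polynomial_function by metis
  have "real_polynomial_function ((d ^^ k) p)" for k
    by (induction k) (use assms d in auto)
  then show ?thesis unfolding smooth_real_def
    by (intro exI[of _ "\<lambda>k. (d ^^ k) p"]) (use d in auto)
qed

text \<open>
  The class of all functions \<open>p(1/t) exp(-1/t)\<close> on the positive axis, extended by zero, contains the standard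
  flat function and is closed under differentiation.
\<close>
definition flat :: "real poly \<Rightarrow> real \<Rightarrow> real" where
  "flat p t = (if t > 0 then poly p (1 / t) * exp (- 1 / t) else 0)"

lemma poly_times_exp_minus_tendsto_0: "((\<lambda>y. poly p y * exp (- y)) \<longlongrightarrow> (0::real)) at_top"
proof -
  have "((\<lambda>y. \<Sum>i\<le>degree p. coeff p i * (y ^ i / exp y)) \<longlongrightarrow> (\<Sum>i\<le>degree p. coeff p i * 0)) at_top"
    by (intro tendsto_intros tendsto_power_div_exp_0)
  then show ?thesis
    by (simp add: poly_altdef sum_distrib_right exp_minus field_simps sum_divide_distrib)
qed

lemma flat_tendsto_0: "(flat p \<longlongrightarrow> 0) (at 0)"
proof -
  have "((\<lambda>t. poly p (inverse t) * exp (- inverse t)) \<longlongrightarrow> 0) (at_right 0)"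
    by (rule filterlim_compose[OF poly_times_exp_minus_tendsto_0 filterlim_inverse_at_top_right])
  then have "(flat p \<longlongrightarrow> 0) (at_right 0)"
    by (rule Lim_transform_eventually)
       (auto simp: flat_def eventually_at_filter inverse_eq_divide intro!: always_eventually)
  moreover have "(flat p \<longlongrightarrow> 0) (at_left 0)"
    by (rule Lim_transform_eventually[OF tendsto_const])
       (auto simp: flat_def eventually_at_filter)
  ultimately show ?thesis by (simp add: filterlim_split_at)
qed

lemma DERIV_flat: "(flat p has_real_derivative flat ([:0,0,1:] * (p - pderiv p)) t) (at t)"
proof -
  consider "t > 0" | "t < 0" | "t = 0" by linarith
  then show ?thesis
  proof cases
    case 1
    have "((\<lambda>t. poly p (1 / t) * exp (- 1 / t)) has_real_derivative flat ([:0,0,1:] * (p - pderiv p)) t) (at t)"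
      using 1 by (auto intro!: derivative_eq_intros simp: flat_def) (simp add: field_simps power2_eq_square)
    then show ?thesis
      by (rule has_field_derivative_transform_within_open[where S="{0<..}"]) (use 1 in \<open>auto simp: flat_def\<close>)
  next
    case 2
    have "((\<lambda>t. 0) has_real_derivative flat ([:0,0,1:] * (p - pderiv p)) t) (at t)"
      using 2 by (simp add: flat_def)
    then show ?thesis
      by (rule has_field_derivative_transform_within_open[where S="{..<0}"]) (use 2 in \<open>auto simp: flat_def\<close>)
  next
    case 3
    have "((\<lambda>h. (flat p (0 + h) - flat p 0) / h) \<longlongrightarrow> 0) (at 0)"
      by (rule Lim_transform_eventually[OF flat_tendsto_0[of "[:0,1:] * p"]])
         (auto simp: flat_def eventually_at_filter)
    then show ?thesis using 3 by (simp add: DERIV_def flat_def)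
  qed
qed

lemma smooth_real_flat: "smooth_real (flat p)"
  unfolding smooth_real_def
  by (rule exI[of _ "\<lambda>k. flat (((\<lambda>p. [:0,0,1:] * (p - pderiv p)) ^^ k) p)"])
     (simp add: DERIV_flat del: mult_pCons_left)

text \<open>
  A class of functions that is closed under partial derivatives, which makes the condition \<^const>\<open>Ck\<close> an easy
  induction; it contains the radial test functions that are used for approximation.
\<close>
inductive coord_radial_poly :: "('a::euclidean_space \<Rightarrow> real) \<Rightarrow> bool" where
  radial: "smooth_real g \<Longrightarrow> coord_radial_poly (\<lambda>x. g (x \<bullet> x))"
| coord: "coord_radial_poly (\<lambda>x. x \<bullet> b)"
| const: "coord_radial_poly (\<lambda>x. c)"
| add: "coord_radial_poly f \<Longrightarrow> coord_radial_poly g \<Longrightarrow> coord_radial_poly (\<lambda>x. f x + g x)"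
| mult: "coord_radial_poly f \<Longrightarrow> coord_radial_poly g \<Longrightarrow> coord_radial_poly (\<lambda>x. f x * g x)"

lemma coord_radial_poly_derivative:
  assumes "coord_radial_poly f"
  shows "\<exists>f'. (\<forall>x. (f has_derivative f' x) (at x)) \<and> (\<forall>b. coord_radial_poly (\<lambda>x. f' x b))"
  using assms
proof induction
  case (radial g)
  then obtain g' where g': "smooth_real g'" "\<And>x. (g has_real_derivative g' x) (at x)"
    by (rule smooth_realD) blast
  have "((\<lambda>x. g (x \<bullet> x)) has_derivative (\<lambda>b. g' (x \<bullet> x) * (2 * (x \<bullet> b)))) (at x)" for x :: 'a
  proof -
    have 1: "(g has_derivative (*) (g' (x \<bullet> x))) (at (x \<bullet> x))"
      using g'(2) by (simp add: has_field_derivative_def)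
    have 2: "((\<lambda>x. x \<bullet> x) has_derivative (\<lambda>b. 2 * (x \<bullet> b))) (at x)"
      by (auto intro!: derivative_eq_intros simp: inner_commute)
    show ?thesis using has_derivative_compose[OF 2 1] by simp
  qed
  moreover have "coord_radial_poly (\<lambda>x. g' (x \<bullet> x) * (2 * (x \<bullet> b)))" for b :: 'a
    by (intro coord_radial_poly.intros g')
  ultimately show ?case by (intro exI[of _ "\<lambda>x b. g' (x \<bullet> x) * (2 * (x \<bullet> b))"]) auto
next
  case (coord b)
  show ?case
    by (rule exI[of _ "\<lambda>x c. c \<bullet> b"]) (auto intro!: derivative_eq_intros coord_radial_poly.const)
next
  case (const c)
  show ?case by (rule exI[of _ "\<lambda>x b. 0"]) (auto intro: coord_radial_poly.const)
next
  case (add f g)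
  then obtain f' g' where "\<And>x. (f has_derivative f' x) (at x)" "\<And>b. coord_radial_poly (\<lambda>x. f' x b)"
    "\<And>x. (g has_derivative g' x) (at x)" "\<And>b. coord_radial_poly (\<lambda>x. g' x b)" by auto
  then show ?case
    by (intro exI[of _ "\<lambda>x b. f' x b + g' x b"]) (auto intro!: has_derivative_add coord_radial_poly.add)
next
  case (mult f g)
  then obtain f' g' where "\<And>x. (f has_derivative f' x) (at x)" "\<And>b. coord_radial_poly (\<lambda>x. f' x b)"
    "\<And>x. (g has_derivative g' x) (at x)" "\<And>b. coord_radial_poly (\<lambda>x. g' x b)" by auto
  with mult.hyps show ?case
    by (intro exI[of _ "\<lambda>x b. f x * g' x b + f' x b * g x"])
       (auto intro!: has_derivative_mult coord_radial_poly.add coord_radial_poly.mult)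
qed

lemma Ck_coord_radial_poly: "coord_radial_poly f \<Longrightarrow> Ck k f"
proof (induction k arbitrary: f)
  case 0
  obtain f' where f': "\<And>x. (f has_derivative f' x) (at x)"
    using coord_radial_poly_derivative[OF 0] by auto
  show ?case
    by (auto intro!: continuous_at_imp_continuous_on has_derivative_continuous[OF f'])
next
  case (Suc k)
  obtain f' where f': "\<And>x. (f has_derivative f' x) (at x)" "\<And>b. coord_radial_poly (\<lambda>x. f' x b)"
    using coord_radial_poly_derivative[OF Suc.prems] by auto
  have "pderiv_at b f = (\<lambda>x. f' x b)" for b
    using frechet_derivative_at[OF f'(1)] by (auto simp: pderiv_at_def)
  then show ?case using Suc.IH[OF f'(2)] f'(1) by (auto simp: differentiable_def)
qed

lemma test_function_has_derivative:
  assumes "\<phi> \<in> test_functions \<Omega>"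
  shows "(\<phi> has_derivative frechet_derivative \<phi> (at x)) (at x)"
proof -
  have "Ck (Suc 0) \<phi>" using assms by (simp add: test_functions_def del: Ck.simps)
  then show ?thesis by (simp add: frechet_derivative_works[symmetric])
qed

lemma test_function_line_derivative:
  assumes "\<phi> \<in> test_functions \<Omega>"
  shows "((\<lambda>t. \<phi> (x + t *\<^sub>R b)) has_real_derivative pderiv_at b \<phi> x) (at 0)"
proof -
  have d: "(\<phi> has_derivative frechet_derivative \<phi> (at x)) (at (x + 0 *\<^sub>R b))"
    using test_function_has_derivative[OF assms, of x] by simp
  have "((\<lambda>t::real. x + t *\<^sub>R b) has_derivative (\<lambda>t. t *\<^sub>R b)) (at 0)"
    by (auto intro!: derivative_eq_intros)
  from has_derivative_compose[OF this d]
  have "((\<lambda>t. \<phi> (x + t *\<^sub>R b)) has_derivative (\<lambda>t. frechet_derivative \<phi> (at x) (t *\<^sub>R b))) (at 0)" .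
  moreover have "frechet_derivative \<phi> (at x) (t *\<^sub>R b) = pderiv_at b \<phi> x * t" for t
    using linear_cmul[OF linear_frechet_derivative, of \<phi> "at x" t b] test_function_has_derivative[OF assms, of x]
    by (simp add: pderiv_at_def differentiable_def mult.commute exI[of _ "frechet_derivative \<phi> (at x)"])
  ultimately show ?thesis by (simp add: has_field_derivative_def)
qed

lemma test_function_continuous:
  assumes "\<phi> \<in> test_functions \<Omega>"
  shows "continuous_on UNIV \<phi>"
proof -
  have "Ck 0 \<phi>" using assms unfolding test_functions_def by blast
  then show ?thesis by simp
qed

lemma pderiv_at_test_function:
  assumes "\<phi> \<in> test_functions \<Omega>" "b \<in> Basis"
  shows "pderiv_at b \<phi> \<in> test_functions \<Omega>"
proof -
  have "Ck (Suc k) \<phi>" for k using assms unfolding test_functions_def by blast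
  then have Ck: "Ck k (pderiv_at b \<phi>)" for k using assms(2) by simp
  have "pderiv_at b \<phi> x = 0" if "x \<notin> closure {x. \<phi> x \<noteq> 0}" for x
    by (rule line_derivative_zero_off_support[OF open_UNIV closed_closure[of "{x. \<phi> x \<noteq> 0}"] _ test_function_line_derivative[OF assms(1)]])
       (use that closure_subset[of "{x. \<phi> x \<noteq> 0}"] in auto)
  then have sub: "{x. pderiv_at b \<phi> x \<noteq> 0} \<subseteq> closure {x. \<phi> x \<noteq> 0}" by auto
  then have "closure {x. pderiv_at b \<phi> x \<noteq> 0} \<subseteq> closure {x. \<phi> x \<noteq> 0}"
    by (simp add: closure_minimal)
  then show ?thesis using assms(1) Ck unfolding test_functions_def
    using closed_closure[of "{x. pderiv_at b \<phi> x \<noteq> 0}"] compact_Int_closed[of "closure {x. \<phi> x \<noteq> 0}" "closure {x. pderiv_at b \<phi> x \<noteq> 0}"]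
    by (simp add: Int_absorb1 subset_trans)
qed

lemma test_functions_support:
  assumes "\<phi> \<in> test_functions \<Omega>"
  obtains K where "compact K" "K \<subseteq> \<Omega>" "\<And>x. x \<notin> K \<Longrightarrow> \<phi> x = 0"
proof (rule that)
  show "compact (closure {x. \<phi> x \<noteq> 0})" "closure {x. \<phi> x \<noteq> 0} \<subseteq> \<Omega>"
    using assms by (auto simp: test_functions_def)
  show "\<phi> x = 0" if "x \<notin> closure {x. \<phi> x \<noteq> 0}" for x
    using that closure_subset[of "{x. \<phi> x \<noteq> 0}"] by blast
qed

lemma pderiv_at_zero_off_support:
  assumes "\<phi> \<in> test_functions \<Omega>" "closed K" "\<And>x. x \<notin> K \<Longrightarrow> \<phi> x = 0" "x \<notin> K"
  shows "pderiv_at b \<phi> x = 0"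
  by (rule line_derivative_zero_off_support[OF open_UNIV assms(2) _ test_function_line_derivative[OF assms(1)]])
     (use assms in auto)

lemma integral_by_parts_test_function:
  fixes f g :: "'a::euclidean_space \<Rightarrow> real"
  assumes \<Omega>: "open \<Omega>" and \<phi>: "\<phi> \<in> test_functions \<Omega>" and b: "b \<in> Basis"
    and f: "continuous_on \<Omega> f" and g: "continuous_on \<Omega> g"
    and der: "\<And>x. x \<in> \<Omega> \<Longrightarrow> ((\<lambda>t. f (x + t *\<^sub>R b)) has_real_derivative g x) (at 0)"
  shows "(LINT x|lebesgue_on \<Omega>. f x * pderiv_at b \<phi> x) = - (LINT x|lebesgue_on \<Omega>. g x * \<phi> x)"
proof -
  obtain K where K: "compact K" "K \<subseteq> \<Omega>" "\<And>x. x \<notin> K \<Longrightarrow> \<phi> x = 0"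
    using test_functions_support[OF \<phi>] by blast
  have c\<phi>: "continuous_on \<Omega> \<phi>" "continuous_on \<Omega> (pderiv_at b \<phi>)"
    using test_function_continuous[OF \<phi>] test_function_continuous[OF pderiv_at_test_function[OF \<phi> b]]
    by (auto intro: continuous_on_subset)
  have i: "integrable (lebesgue_on \<Omega>) (\<lambda>x. h x * \<psi> x)"
    if "continuous_on \<Omega> h" "continuous_on \<Omega> \<psi>" "\<And>x. x \<in> \<Omega> \<Longrightarrow> x \<notin> K \<Longrightarrow> \<psi> x = 0" for h \<psi> :: "'a \<Rightarrow> real"
    by (rule integrable_continuous_compact_support[OF \<Omega> K(1,2)]) (use that in \<open>auto intro!: continuous_intros\<close>)
  have p0: "pderiv_at b \<phi> x = 0" if "x \<notin> K" for x
    by (rule pderiv_at_zero_off_support[OF \<phi> compact_imp_closed[OF K(1)] K(3) that])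
  have der2: "((\<lambda>t. f (x + t *\<^sub>R b) * \<phi> (x + t *\<^sub>R b)) has_real_derivative f x * pderiv_at b \<phi> x + g x * \<phi> x) (at 0)"
    if "x \<in> \<Omega>" for x
    using DERIV_mult[OF der[OF that] test_function_line_derivative[OF \<phi>, of x b]] by (simp add: algebra_simps)
  have "(LINT x|lebesgue_on \<Omega>. f x * pderiv_at b \<phi> x + g x * \<phi> x) = 0"
    by (rule integral_line_derivative_compact_support(2)[OF \<Omega> K(1,2) _ _ _ der2])
       (use f g c\<phi> K in \<open>auto intro!: continuous_intros\<close>)
  moreover have "integrable (lebesgue_on \<Omega>) (\<lambda>x. f x * pderiv_at b \<phi> x)" "integrable (lebesgue_on \<Omega>) (\<lambda>x. g x * \<phi> x)"
    using i f g c\<phi> p0 K by auto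
  ultimately show ?thesis by simp
qed

section \<open>Weak derivatives and \<open>L\<^sup>p\<close> convergence\<close>

text \<open>
  Classical derivatives on the open set suffice; nothing is assumed about boundary behaviour, because test
  functions vanish near the boundary.
\<close>
lemma weak_pderivI:
  fixes f g :: "'a::euclidean_space \<Rightarrow> real"
  assumes "open \<Omega>" "b \<in> Basis" "continuous_on \<Omega> f" "continuous_on \<Omega> g"
    and "\<And>x. x \<in> \<Omega> \<Longrightarrow> ((\<lambda>t. f (x + t *\<^sub>R b)) has_real_derivative g x) (at 0)"
  shows "weak_pderiv \<Omega> b f g"
  unfolding weak_pderiv_def locally_integrable_def
  using integral_by_parts_test_function[OF assms(1) _ assms(2-5)] assms(3,4)
  by (auto intro!: absolutely_integrable_continuous_compact intro: continuous_on_subset)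

lemma continuous_measurable_lebesgue_on:
  fixes f :: "'a::euclidean_space \<Rightarrow> real"
  assumes "open \<Omega>" "continuous_on \<Omega> f"
  shows "f \<in> borel_measurable (lebesgue_on \<Omega>)"
  using assms by (intro continuous_imp_measurable_on_sets_lebesgue) auto

lemma finite_measure_lebesgue_on_bounded:
  fixes \<Omega> :: "'a::euclidean_space set"
  assumes "open \<Omega>" "bounded \<Omega>"
  shows "finite_measure (lebesgue_on \<Omega>)"
proof
  have "emeasure lborel \<Omega> < \<infinity>" by (rule emeasure_bounded_finite[OF assms(2)])
  then show "emeasure (lebesgue_on \<Omega>) (space (lebesgue_on \<Omega>)) \<noteq> \<infinity>"
    using assms by (simp add: emeasure_restrict_space)
qed

lemma bounded_continuous_in_Lp_space:
  fixes f :: "'a::euclidean_space \<Rightarrow> real"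
  assumes "open \<Omega>" "bounded \<Omega>" "continuous_on \<Omega> f" "\<And>x. x \<in> \<Omega> \<Longrightarrow> \<bar>f x\<bar> \<le> C" "p \<ge> 0"
  shows "f \<in> Lp_space \<Omega> p"
proof -
  interpret finite_measure "lebesgue_on \<Omega>"
    by (rule finite_measure_lebesgue_on_bounded[OF assms(1,2)])
  have [measurable]: "f \<in> borel_measurable (lebesgue_on \<Omega>)"
    by (rule continuous_measurable_lebesgue_on[OF assms(1,3)])
  have "integrable (lebesgue_on \<Omega>) (\<lambda>x. \<bar>f x\<bar> powr p)"
    by (rule integrable_const_bound[where B="C powr p"])
       (use assms in \<open>auto intro!: AE_I2 powr_mono2\<close>)
  then show ?thesis by (simp add: Lp_space_def)
qed

lemma Lp_norm_tendsto_0: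
  fixes f :: "nat \<Rightarrow> 'a::euclidean_space \<Rightarrow> real"
  assumes "open \<Omega>" "bounded \<Omega>" "\<And>j. continuous_on \<Omega> (f j)" "\<And>j x. x \<in> \<Omega> \<Longrightarrow> \<bar>f j x\<bar> \<le> C"
    "\<And>x. x \<in> \<Omega> \<Longrightarrow> (\<lambda>j. f j x) \<longlonglongrightarrow> 0" "p > 0"
  shows "(\<lambda>j. Lp_norm \<Omega> p (f j)) \<longlonglongrightarrow> 0"
proof -
  interpret finite_measure "lebesgue_on \<Omega>"
    by (rule finite_measure_lebesgue_on_bounded[OF assms(1,2)])
  have [measurable]: "f j \<in> borel_measurable (lebesgue_on \<Omega>)" for j
    by (rule continuous_measurable_lebesgue_on[OF assms(1,3)])
  have "(\<lambda>j. LINT x|lebesgue_on \<Omega>. \<bar>f j x\<bar> powr p) \<longlonglongrightarrow> (LINT x|lebesgue_on \<Omega>. 0)"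
  proof (rule integral_dominated_convergence[where w="\<lambda>_. C powr p"])
    show "AE x in lebesgue_on \<Omega>. (\<lambda>j. \<bar>f j x\<bar> powr p) \<longlonglongrightarrow> 0"
    proof (rule AE_I2)
      fix x assume "x \<in> space (lebesgue_on \<Omega>)"
      then have "(\<lambda>j. \<bar>f j x\<bar>) \<longlonglongrightarrow> 0" using assms(5)[of x] by (simp add: tendsto_rabs_zero)
      then show "(\<lambda>j. \<bar>f j x\<bar> powr p) \<longlonglongrightarrow> 0"
        by (rule tendsto_zero_powrI) (use assms(6) in auto)
    qed
    show "AE x in lebesgue_on \<Omega>. norm (\<bar>f j x\<bar> powr p) \<le> C powr p" for j
      by (rule AE_I2) (use assms in \<open>auto intro!: powr_mono2\<close>)
  qed auto
  then have "(\<lambda>j. LINT x|lebesgue_on \<Omega>. \<bar>f j x\<bar> powr p) \<longlonglongrightarrow> 0" by simp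
  then show ?thesis unfolding Lp_norm_def
    by (rule tendsto_zero_powrI[where b="1 / p"]) (use assms(6) in auto)
qed

lemma inner_self_ball: "x \<in> ball (0::'a::euclidean_space) 1 \<Longrightarrow> x \<bullet> x \<in> {0..<1}"
  by (auto simp: dot_square_norm abs_square_less_1)

text \<open>
  The derivative of \<open>F\<close> is taken within \<open>[0, 1)\<close>, so that the origin, where \<open>|x|\<^sup>2 = 0\<close> is an endpoint of this interval,
  is not a special case.
\<close>
lemma radial_line_derivative:
  fixes x :: "'a::euclidean_space"
  assumes "(F has_real_derivative y) (at (x \<bullet> x) within {0..<1})" "x \<in> ball 0 1"
  shows "((\<lambda>t. F ((x + t *\<^sub>R b) \<bullet> (x + t *\<^sub>R b))) has_real_derivative 2 * (x \<bullet> b) * y) (at 0)"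
proof -
  define T where "T = (\<lambda>t::real. x + t *\<^sub>R b) -` ball 0 1"
  have T: "open T" "0 \<in> T"
    unfolding T_def using assms(2) by (simp_all add: open_vimage continuous_intros)
  define q where "q t = (x + t *\<^sub>R b) \<bullet> (x + t *\<^sub>R b)" for t
  have "q ` T \<subseteq> {0..<1}"
    using inner_self_ball by (force simp: q_def T_def simp del: mem_ball)
  then have "(F has_real_derivative y) (at (q 0) within q ` T)"
    using DERIV_subset[OF assms(1)] by (simp add: q_def)
  moreover have "(q has_real_derivative 2 * (x \<bullet> b)) (at 0 within T)"
  proof -
    have "q = (\<lambda>t. x \<bullet> x + 2 * t * (x \<bullet> b) + t\<^sup>2 * (b \<bullet> b))"
      by (simp add: q_def fun_eq_iff inner_add_left inner_add_right power2_eq_square inner_commute[of b x] distrib_left mult.assoc)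
    show ?thesis unfolding \<open>q = _\<close> by (auto intro!: derivative_eq_intros)
  qed
  ultimately have "(F \<circ> q has_real_derivative y * (2 * (x \<bullet> b))) (at 0 within T)"
    by (rule DERIV_image_chain)
  moreover have "y * (2 * (x \<bullet> b)) = 2 * (x \<bullet> b) * y" by simp
  ultimately show ?thesis unfolding at_within_open[OF T(2,1)] o_def q_def by (simp only:)
qed

lemma continuous_on_radial:
  fixes F :: "real \<Rightarrow> real"
  assumes "continuous_on {0..<1} F"
  shows "continuous_on (ball (0::'a::euclidean_space) 1) (\<lambda>x. F (x \<bullet> x))"
  by (rule continuous_on_compose2[OF assms])
     (auto intro!: continuous_intros simp: dot_square_norm abs_square_less_1)

text \<open>
  Here \<open>F1\<close> and \<open>F2\<close> are the first two derivatives of \<open>F\<close>. The second one is required on \<open>[0, 1)\<close> only: the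
  coefficient in the eigenvalue equation is continuous up to \<open>s = 1\<close>, but its derivative need not be. The last condition is the
  Dirichlet boundary condition.
\<close>
definition radial_profile :: "(real \<Rightarrow> real) \<Rightarrow> (real \<Rightarrow> real) \<Rightarrow> (real \<Rightarrow> real) \<Rightarrow> bool" where
  "radial_profile F F1 F2 \<longleftrightarrow>
     (\<forall>s\<in>{0..1}. (F has_real_derivative F1 s) (at s within {0..1})) \<and> continuous_on {0..1} F1 \<and>
     (\<forall>s\<in>{0..<1}. (F1 has_real_derivative F2 s) (at s within {0..<1})) \<and>
     continuous_on {0..<1} F2 \<and> bounded (F2 ` {0..<1}) \<and> F 1 = 0"

definition flat1 :: "real \<Rightarrow> real" where "flat1 = flat 1"
definition flat1' :: "real \<Rightarrow> real" where "flat1' = flat [:0,0,1:]"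

lemma DERIV_flat1: "(flat1 has_real_derivative flat1' t) (at t)"
  using DERIV_flat[of 1 t] by (simp add: flat1_def flat1'_def)

lemma flat1_bounds: "0 \<le> flat1 t" "flat1 t \<le> 1" "t \<le> 0 \<Longrightarrow> flat1 t = 0" "t \<le> 0 \<Longrightarrow> flat1' t = 0"
  by (auto simp: flat1_def flat1'_def flat_def)

lemma flat1_tendsto: "(flat1 \<longlongrightarrow> 1) at_top"
proof -
  have "((\<lambda>t::real. exp (- 1 / t)) \<longlongrightarrow> exp 0) at_top"
    by (intro tendsto_intros tendsto_divide_0[OF tendsto_const] filterlim_at_top_imp_at_infinity filterlim_ident)
  then have "((\<lambda>t::real. exp (- 1 / t)) \<longlongrightarrow> 1) at_top" by simp
  then show ?thesis
    by (rule Lim_transform_eventually) (auto simp: flat1_def flat_def intro: eventually_mono[OF eventually_gt_at_top[of 0]])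
qed

text \<open>
  With \<open>z = 1/t\<close>, the bound \<open>4\<close> for \<open>t < 1\<close> comes from \<open>z\<^sup>2 exp(-z) \<le> 2\<close>, and the decay for large \<open>t\<close> from
  \<open>t + 1 \<le> 2 t\<close>.
\<close>
lemma flat1'_bounds:
  shows "0 \<le> (t + 1) * flat1' t" "(t + 1) * flat1' t \<le> 4" "t \<ge> 1 \<Longrightarrow> (t + 1) * flat1' t \<le> 2 / t"
proof -
  have eq: "flat1' t = (1 / t)\<^sup>2 * exp (- (1 / t))" if "t > 0"
    using that by (simp add: flat1'_def flat_def power2_eq_square)
  show "0 \<le> (t + 1) * flat1' t" by (cases "t > 0") (auto simp: eq flat1_bounds)
  show A: "(t + 1) * flat1' t \<le> 2 / t" if "t \<ge> 1"
  proof -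
    have "(t + 1) * flat1' t \<le> (2 * t) * ((1 / t)\<^sup>2 * 1)"
      using that unfolding eq[OF less_le_trans[OF zero_less_one that]] by (intro mult_mono) auto
    also have "\<dots> = 2 / t" using that by (simp add: power2_eq_square)
    finally show ?thesis .
  qed
  show "(t + 1) * flat1' t \<le> 4"
  proof (cases "t \<ge> 1")
    case True
    have "2 / t \<le> 4" using True by (simp add: field_simps)
    then show ?thesis using A[OF True] by linarith
  next
    case False
    show ?thesis
    proof (cases "t > 0")
      case True
      define z where "z = 1 / t"
      have "1 + z + z\<^sup>2 / 2 \<le> exp z" by (rule exp_lower_Taylor_quadratic) (use True in \<open>simp add: z_def\<close>)
      moreover have "z > 0" using True by (simp add: z_def)
      ultimately have "z\<^sup>2 \<le> 2 * exp z" by linarith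
      then have "z\<^sup>2 * exp (- z) \<le> 2" by (simp add: exp_minus field_simps)
      then have "(t + 1) * flat1' t \<le> 2 * 2"
        using True False unfolding eq[OF True] z_def[symmetric] by (intro mult_mono) auto
      then show ?thesis by simp
    qed (auto simp: flat1_bounds)
  qed
qed

text \<open>
  Approximate the derivative by a polynomial and integrate it from \<open>1\<close>. The error in \<open>P\<close> then carries the
  factor \<open>1 - s\<close>, which compensates the large derivative of a cutoff near the boundary.
\<close>
lemma polynomial_C1_approximation:
  fixes F F1 :: "real \<Rightarrow> real"
  assumes der: "\<And>s. s \<in> {0..1} \<Longrightarrow> (F has_real_derivative F1 s) (at s within {0..1})"
    and cont: "continuous_on {0..1} F1" and F1: "F 1 = 0" and e: "e > 0"
  obtains P p where "smooth_real P" "\<And>s. (P has_real_derivative p s) (at s)" "P 1 = 0"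
    "\<And>s. s \<in> {0..1} \<Longrightarrow> \<bar>p s - F1 s\<bar> \<le> e" "\<And>s. s \<in> {0..1} \<Longrightarrow> \<bar>P s - F s\<bar> \<le> e * (1 - s)"
    "continuous_on UNIV p"
proof -
  obtain p where p: "real_polynomial_function p" "\<And>s. s \<in> {0..1} \<Longrightarrow> \<bar>F1 s - p s\<bar> < e"
    using Stone_Weierstrass_real_polynomial_function[OF compact_Icc cont e] by blast
  obtain a n where pa: "p = (\<lambda>x. \<Sum>i\<le>n. a i * x ^ i)"
    using p(1) by (auto simp: real_polynomial_function_iff_sum)
  define P where "P x = (\<Sum>i\<le>n. (a i / real (Suc i)) * (x ^ Suc i - 1))" for x
  have P2: "(P has_real_derivative p s) (at s)" for s
  proof -
    have "(P has_real_derivative (\<Sum>i\<le>n. (a i / real (Suc i)) * (real (Suc i) * s ^ i - 0))) (at s)"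
      unfolding P_def[abs_def]
      by (intro DERIV_sum DERIV_cmult DERIV_diff DERIV_const) (auto intro!: derivative_eq_intros simp del: power_Suc)
    also have "(\<Sum>i\<le>n. (a i / real (Suc i)) * (real (Suc i) * s ^ i - 0)) = p s"
      unfolding pa by (intro sum.cong) auto
    finally show ?thesis .
  qed
  have P1: "smooth_real P" by (rule smooth_realI[OF smooth_real_polynomial[OF p(1)] P2])
  have b: "\<bar>P s - F s\<bar> \<le> e * (1 - s)" if s: "s \<in> {0..1}" for s
  proof -
    have "norm ((P s - F s) - (P 1 - F 1)) \<le> e * norm (s - 1)"
    proof (rule field_differentiable_bound[where S="{0..1}" and f'="\<lambda>s. p s - F1 s"])
      show "((\<lambda>s. P s - F s) has_field_derivative p z - F1 z) (at z within {0..1})" if "z \<in> {0..1}" for z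
        using that by (intro DERIV_diff der has_field_derivative_at_within[OF P2])
      show "norm (p z - F1 z) \<le> e" if "z \<in> {0..1}" for z using p(2)[OF that] by simp
    qed (use s in auto)
    then show ?thesis using s F1 by (simp add: P_def)
  qed
  have "continuous_on UNIV p" unfolding pa by (intro continuous_intros)
  then show ?thesis
    using that[OF P1 P2 _ _ b] p(2) by (fastforce simp: P_def abs_minus_commute less_imp_le)
qed

section \<open>Radial functions in the Sobolev spaces\<close>

lemma radial_profile_bounded:
  assumes "radial_profile F F1 F2"
  obtains C where "C \<ge> 0" "\<And>s. s \<in> {0..1} \<Longrightarrow> \<bar>F s\<bar> \<le> C" "\<And>s. s \<in> {0..1} \<Longrightarrow> \<bar>F1 s\<bar> \<le> C"
    "\<And>s. s \<in> {0..<1} \<Longrightarrow> \<bar>F2 s\<bar> \<le> C"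
proof -
  have cF: "continuous_on {0..1} F" and cF1: "continuous_on {0..1} F1"
    using assms unfolding radial_profile_def by (auto intro: DERIV_continuous_on)
  have "bounded (F ` {0..1})" "bounded (F1 ` {0..1})"
    using cF cF1 by (auto intro!: compact_imp_bounded compact_continuous_image)
  moreover have "bounded (F2 ` {0..<1})" using assms by (auto simp: radial_profile_def)
  ultimately have "bounded (F ` {0..1} \<union> F1 ` {0..1} \<union> F2 ` {0..<1})" by simp
  then obtain C where "\<forall>y\<in>F ` {0..1} \<union> F1 ` {0..1} \<union> F2 ` {0..<1}. norm y \<le> C"
    unfolding bounded_iff by blast
  then show ?thesis
    by (intro that[of "max C 0"]) (auto simp: le_max_iff_disj)
qed

lemma radial_laplacian_sum:
  fixes x :: "'a::euclidean_space"
  shows "(\<Sum>b\<in>(Basis::'a set). 2 * (b \<bullet> b) * p + 4 * (x \<bullet> b) * (x \<bullet> b) * q) = 2 * real DIM('a) * p + 4 * (x \<bullet> x) * q"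
proof -
  have "(\<Sum>b\<in>Basis. 4 * (x \<bullet> b) * (x \<bullet> b) * q) = (\<Sum>b\<in>Basis. 4 * q * ((x \<bullet> b) * (x \<bullet> b)))"
    by (intro sum.cong) auto
  also have "\<dots> = 4 * q * (x \<bullet> x)"
    by (simp only: sum_distrib_left[symmetric] euclidean_inner[symmetric])
  finally have e1: "(\<Sum>b\<in>Basis. 4 * (x \<bullet> b) * (x \<bullet> b) * q) = 4 * (x \<bullet> x) * q"
    by (simp only: mult.commute mult.left_commute)
  have "(\<Sum>b\<in>(Basis::'a set). 2 * (b \<bullet> b) * p) = (\<Sum>b\<in>(Basis::'a set). 2 * p)"
    by (intro sum.cong) (auto simp: inner_Basis)
  then have e2: "(\<Sum>b\<in>(Basis::'a set). 2 * (b \<bullet> b) * p) = 2 * real DIM('a) * p"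
    by (simp only: sum_constant mult.assoc mult.left_commute)
  show ?thesis by (simp only: sum.distrib e1 e2)
qed

context
  fixes F F1 F2 :: "real \<Rightarrow> real"
  assumes prof: "radial_profile F F1 F2"
begin

lemma radial_profile_deriv1:
  "s \<in> {0..<1} \<Longrightarrow> (F has_real_derivative F1 s) (at s within {0..<1})"
  using prof by (auto simp: radial_profile_def intro: DERIV_subset[where s="{0..1}"])

lemma radial_profile_cont:
  "continuous_on {0..<1} F" "continuous_on {0..<1} F1" "continuous_on {0..<1} F2"
  using prof DERIV_continuous_on[OF radial_profile_deriv1] unfolding radial_profile_def
  by (auto intro: continuous_on_subset[of "{0..1}"])

lemma radial_gradient_line_derivative:
  fixes x b c :: "'a::euclidean_space"
  assumes "x \<in> ball 0 1"
  shows "((\<lambda>t. 2 * ((x + t *\<^sub>R c) \<bullet> b) * F1 ((x + t *\<^sub>R c) \<bullet> (x + t *\<^sub>R c))) has_real_derivative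
           2 * (c \<bullet> b) * F1 (x \<bullet> x) + 4 * (x \<bullet> b) * (x \<bullet> c) * F2 (x \<bullet> x)) (at 0)"
proof -
  have "(F1 has_real_derivative F2 (x \<bullet> x)) (at (x \<bullet> x) within {0..<1})"
    using prof inner_self_ball[OF assms] by (simp add: radial_profile_def)
  from radial_line_derivative[OF this assms, of c]
  have 1: "((\<lambda>t. F1 ((x + t *\<^sub>R c) \<bullet> (x + t *\<^sub>R c))) has_real_derivative 2 * (x \<bullet> c) * F2 (x \<bullet> x)) (at 0)" .
  have 2: "((\<lambda>t. 2 * ((x + t *\<^sub>R c) \<bullet> b)) has_real_derivative 2 * (c \<bullet> b)) (at 0)"
    unfolding inner_add_left inner_scaleR_left by (auto intro!: derivative_eq_intros)
  show ?thesis
    using DERIV_mult[OF 2 1] by (simp add: mult_ac)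
qed

lemma radial_weak_pderiv:
  assumes b: "b \<in> (Basis :: 'a::euclidean_space set)"
  shows "weak_pderiv (ball 0 1) b (\<lambda>x. F (x \<bullet> x)) (\<lambda>x. 2 * (x \<bullet> b) * F1 (x \<bullet> x))"
proof (rule weak_pderivI[OF open_ball b])
  show "((\<lambda>t. F ((x + t *\<^sub>R b) \<bullet> (x + t *\<^sub>R b))) has_real_derivative 2 * (x \<bullet> b) * F1 (x \<bullet> x)) (at 0)"
    if x: "x \<in> ball 0 1" for x
    by (rule radial_line_derivative[OF radial_profile_deriv1[OF inner_self_ball[OF x]] x])
qed (intro continuous_intros continuous_on_radial radial_profile_cont)+

lemma radial_weak_pderiv2:
  assumes b: "c \<in> (Basis :: 'a::euclidean_space set)"
  shows "weak_pderiv (ball 0 1) c (\<lambda>x. 2 * (x \<bullet> b) * F1 (x \<bullet> x))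
           (\<lambda>x. 2 * (c \<bullet> b) * F1 (x \<bullet> x) + 4 * (x \<bullet> b) * (x \<bullet> c) * F2 (x \<bullet> x))"
  by (rule weak_pderivI[OF open_ball b _ _ radial_gradient_line_derivative])
     (intro continuous_intros continuous_on_radial radial_profile_cont | assumption)+

lemma abs_inner_ball_le_1:
  "x \<in> ball (0::'a::euclidean_space) 1 \<Longrightarrow> b \<in> Basis \<Longrightarrow> \<bar>x \<bullet> b\<bar> \<le> 1"
  using Basis_le_norm[of b x] by simp

lemma radial_sobolev_2:
  assumes p: "p > 1"
  shows "(\<lambda>x. F (x \<bullet> x)) \<in> sobolev (ball (0::'a::euclidean_space) 1) 2 p" (is ?A)
    and "(\<lambda>x. F (x \<bullet> x)) \<in> sobolev (ball (0::'a::euclidean_space) 1) 1 p" (is ?B)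
    and "b \<in> Basis \<Longrightarrow> (\<lambda>x. 2 * (x \<bullet> b) * F1 (x \<bullet> x)) \<in> Lp_space (ball (0::'a) 1) p"
proof -
  obtain C where C: "C \<ge> 0" "\<And>s. s \<in> {0..1} \<Longrightarrow> \<bar>F s\<bar> \<le> C" "\<And>s. s \<in> {0..1} \<Longrightarrow> \<bar>F1 s\<bar> \<le> C"
    "\<And>s. s \<in> {0..<1} \<Longrightarrow> \<bar>F2 s\<bar> \<le> C"
    using radial_profile_bounded[OF prof] by blast
  have s: "x \<bullet> x \<in> {0..1}" if "x \<in> ball 0 1" for x :: 'a
    using inner_self_ball[OF that] by auto
  have L0: "(\<lambda>x. F (x \<bullet> x)) \<in> Lp_space (ball (0::'a) 1) p"
    by (rule bounded_continuous_in_Lp_space[where C=C])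
       (use p C(2)[OF s] in \<open>auto intro!: continuous_on_radial radial_profile_cont simp del: mem_ball\<close>)
  have L1: "(\<lambda>x. 2 * (x \<bullet> b) * F1 (x \<bullet> x)) \<in> Lp_space (ball (0::'a) 1) p" if b: "b \<in> Basis" for b
  proof (rule bounded_continuous_in_Lp_space[where C="2 * 1 * C"])
    show "\<bar>2 * (x \<bullet> b) * F1 (x \<bullet> x)\<bar> \<le> 2 * 1 * C" if x: "x \<in> ball 0 1" for x
      unfolding abs_mult using abs_inner_ball_le_1[OF x b] C(3)[OF s[OF x]] C(1)
      by (intro mult_mono) auto
  qed (use p in \<open>auto intro!: continuous_intros continuous_on_radial radial_profile_cont\<close>)
  then show "b \<in> Basis \<Longrightarrow> (\<lambda>x. 2 * (x \<bullet> b) * F1 (x \<bullet> x)) \<in> Lp_space (ball (0::'a) 1) p" .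
  have L2: "(\<lambda>x. 2 * (c \<bullet> b) * F1 (x \<bullet> x) + 4 * (x \<bullet> b) * (x \<bullet> c) * F2 (x \<bullet> x)) \<in> Lp_space (ball (0::'a) 1) p"
    if b: "b \<in> Basis" "c \<in> Basis" for b c
  proof (rule bounded_continuous_in_Lp_space[where C="2 * 1 * C + 4 * 1 * 1 * C"])
    show "\<bar>2 * (c \<bullet> b) * F1 (x \<bullet> x) + 4 * (x \<bullet> b) * (x \<bullet> c) * F2 (x \<bullet> x)\<bar> \<le> 2 * 1 * C + 4 * 1 * 1 * C"
      if x: "x \<in> ball 0 1" for x
    proof -
      have "\<bar>2 * (c \<bullet> b) * F1 (x \<bullet> x)\<bar> \<le> 2 * 1 * C"
        unfolding abs_mult using b C(3)[OF s[OF x]] C(1)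
        by (intro mult_mono) (auto simp: inner_Basis)
      moreover have "\<bar>4 * (x \<bullet> b) * (x \<bullet> c) * F2 (x \<bullet> x)\<bar> \<le> 4 * 1 * 1 * C"
        unfolding abs_mult using abs_inner_ball_le_1[OF x] b C(4)[OF inner_self_ball[OF x]] C(1)
        by (intro mult_mono) auto
      ultimately show ?thesis by linarith
    qed
  qed (use p in \<open>auto intro!: continuous_intros continuous_on_radial radial_profile_cont\<close>)
  have S1: "(\<lambda>x. 2 * (x \<bullet> b) * F1 (x \<bullet> x)) \<in> sobolev (ball (0::'a) 1) (Suc 0) p" if "b \<in> Basis" for b
    using L1[OF that] L2[OF that] radial_weak_pderiv2 by fastforce
  show ?A unfolding numeral_2_eq_2 sobolev.simps(2)[of _ "Suc 0"]
    using L0 S1 radial_weak_pderiv by blast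
  show ?B unfolding One_nat_def sobolev.simps
    using L0 L1 radial_weak_pderiv by blast
qed

lemma radial_weak_laplacian:
  "weak_laplacian (ball (0::'a::euclidean_space) 1) (\<lambda>x. F (x \<bullet> x))
     (\<lambda>x. 2 * DIM('a) * F1 (x \<bullet> x) + 4 * (x \<bullet> x) * F2 (x \<bullet> x))"
  unfolding weak_laplacian_def
proof (intro exI conjI ballI)
  fix b :: 'a assume b: "b \<in> Basis"
  show "weak_pderiv (ball 0 1) b (\<lambda>x. F (x \<bullet> x)) ((\<lambda>b x. 2 * (x \<bullet> b) * F1 (x \<bullet> x)) b)"
    using radial_weak_pderiv[OF b] .
  show "weak_pderiv (ball 0 1) b ((\<lambda>b x. 2 * (x \<bullet> b) * F1 (x \<bullet> x)) b)
     ((\<lambda>b x. 2 * (b \<bullet> b) * F1 (x \<bullet> x) + 4 * (x \<bullet> b) * (x \<bullet> b) * F2 (x \<bullet> x)) b)"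
    using radial_weak_pderiv2[OF b, of b] .
next
  show "(\<lambda>x. 2 * DIM('a) * F1 (x \<bullet> x) + 4 * (x \<bullet> x) * F2 (x \<bullet> x)) =
    (\<lambda>x::'a. \<Sum>b\<in>Basis. (\<lambda>b x. 2 * (b \<bullet> b) * F1 (x \<bullet> x) + 4 * (x \<bullet> b) * (x \<bullet> b) * F2 (x \<bullet> x)) b x)"
    by (simp only: radial_laplacian_sum of_nat_mult of_nat_numeral)
qed

text \<open>
  The approximants are \<open>\<phi>\<^sub>j = E(a\<^sub>j (1 - s) - 1) P\<^sub>j(s)\<close> with \<open>s = |x|\<^sup>2\<close>, \<open>a\<^sub>j = j + 1\<close>, the flat function \<open>E(t) = exp(-1/t)\<close>, and
  polynomials \<open>P\<^sub>j\<close> that approximate \<open>F\<close> in \<open>C\<^sup>1\<close> and vanish at \<open>1\<close>. They are smooth and vanish for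
  \<open>s \<ge> 1 - 1/a\<^sub>j\<close>. Since \<open>|P\<^sub>j(s)| \<le> (C + 1) (1 - s)\<close>, the term that contains the derivative of the cutoff stays bounded and
  tends to zero pointwise, so that dominated convergence gives the limits in every \<open>L\<^sup>p\<close>.
\<close>
lemma radial_sobolev0:
  assumes p: "p > 1"
  shows "(\<lambda>x. F (x \<bullet> x)) \<in> sobolev0 (ball (0::'a::euclidean_space) 1) p"
proof -
  obtain C where C: "C \<ge> 0" "\<And>s. s \<in> {0..1} \<Longrightarrow> \<bar>F s\<bar> \<le> C" "\<And>s. s \<in> {0..1} \<Longrightarrow> \<bar>F1 s\<bar> \<le> C"
    "\<And>s. s \<in> {0..<1} \<Longrightarrow> \<bar>F2 s\<bar> \<le> C"
    using radial_profile_bounded[OF prof] by blast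
  have F: "\<And>s. s \<in> {0..1} \<Longrightarrow> (F has_real_derivative F1 s) (at s within {0..1})" "continuous_on {0..1} F1" "F 1 = 0"
    using prof by (auto simp: radial_profile_def)
  define a where "a j = real (Suc j)" for j
  have a: "a j \<ge> 1" "a j > 0" for j by (auto simp: a_def)
  have a_top: "filterlim a at_top sequentially"
    unfolding a_def by (rule filterlim_compose[OF filterlim_real_sequentially filterlim_Suc])
  have "\<exists>P p. smooth_real P \<and> (\<forall>s. (P has_real_derivative p s) (at s)) \<and> P 1 = 0 \<and>
      (\<forall>s\<in>{0..1}. \<bar>p s - F1 s\<bar> \<le> 1 / a j \<and> \<bar>P s - F s\<bar> \<le> 1 / a j * (1 - s)) \<and> continuous_on UNIV p" for j
    using polynomial_C1_approximation[OF F, of "1 / a j"] a(2)[of j] by (metis zero_less_divide_1_iff)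
  then obtain P P' where P: "\<And>j. smooth_real (P j)" "\<And>j s. (P j has_real_derivative P' j s) (at s)" "\<And>j. P j 1 = 0"
      "\<And>j s. s \<in> {0..1} \<Longrightarrow> \<bar>P' j s - F1 s\<bar> \<le> 1 / a j"
      "\<And>j s. s \<in> {0..1} \<Longrightarrow> \<bar>P j s - F s\<bar> \<le> 1 / a j * (1 - s)"
      "\<And>j. continuous_on UNIV (P' j)" by metis
  define \<eta> where "\<eta> j s = flat1 (- a j * s + (a j - 1))" for j s
  define \<eta>' where "\<eta>' j s = - a j * flat1' (- a j * s + (a j - 1))" for j s
  have d\<eta>: "(\<eta> j has_real_derivative \<eta>' j s) (at s)" for j s
  proof -
    have "(\<eta> j has_real_derivative flat1' (- a j * s + (a j - 1)) * (- a j)) (at s)"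
      unfolding \<eta>_def by (rule DERIV_chain2[OF DERIV_flat1]) (auto intro!: derivative_eq_intros)
    then show ?thesis by (simp add: \<eta>'_def mult.commute)
  qed
  define u where "u j s = \<eta> j s * P j s" for j s
  define u' where "u' j s = \<eta> j s * P' j s + \<eta>' j s * P j s" for j s
  have du: "(u j has_real_derivative u' j s) (at s)" for j s
    using DERIV_mult[OF d\<eta>[of j s] P(2)[of j s]] by (simp add: u_def[abs_def] u'_def algebra_simps)
  define \<phi> where "\<phi> j x = u j (x \<bullet> x)" for j and x :: 'a
  have "coord_radial_poly (\<phi> j)" for j
    unfolding \<phi>_def u_def \<eta>_def flat1_def
    by (intro coord_radial_poly.mult coord_radial_poly.radial[where g="\<lambda>s. flat 1 (- a j * s + (a j - 1))"]
        smooth_real_affine smooth_real_flat coord_radial_poly.radial P(1))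
  then have Ck: "Ck k (\<phi> j)" for k j by (rule Ck_coord_radial_poly)
  have \<phi>_test: "\<phi> j \<in> test_functions (ball 0 1)" for j
  proof -
    define r where "r = sqrt (1 - 1 / a j)"
    have r: "0 \<le> 1 - 1 / a j" "r < 1" using a[of j] by (auto simp: r_def)
    have "\<phi> j x = 0" if "x \<notin> cball 0 r" for x
    proof -
      have "r < norm x" using that by simp
      then have "r\<^sup>2 < (norm x)\<^sup>2" using r by (intro power_strict_mono) (auto simp: r_def)
      then have "1 - 1 / a j < x \<bullet> x" using r by (simp add: r_def dot_square_norm)
      then have "a j * (1 - 1 / a j) \<le> a j * (x \<bullet> x)" using a(2)[of j] by (intro mult_left_mono) auto
      then have "- a j * (x \<bullet> x) + (a j - 1) \<le> 0" using a(2)[of j] by (simp add: right_diff_distrib)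
      then show ?thesis by (simp add: \<phi>_def u_def \<eta>_def flat1_bounds)
    qed
    then have "closure {x. \<phi> j x \<noteq> 0} \<subseteq> cball 0 r"
      by (intro closure_minimal closed_cball) blast
    moreover from this have "compact (closure {x. \<phi> j x \<noteq> 0})"
      by (metis closed_closure compact_Int_closed compact_cball inf.absorb2)
    moreover have "cball 0 r \<subseteq> ball (0::'a) 1" using r by auto
    ultimately show ?thesis using Ck unfolding test_functions_def by blast
  qed
  have lim_y: "filterlim (\<lambda>j. - a j * s + (a j - 1)) at_top sequentially" if "s < 1" for s
  proof -
    have "filterlim (\<lambda>j. - 1 + (1 - s) * a j) at_top sequentially"
      using that by (intro filterlim_tendsto_add_at_top[OF tendsto_const] filterlim_tendsto_pos_mult_at_top[OF tendsto_const _ a_top]) auto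
    then show ?thesis by (simp add: algebra_simps)
  qed
  have inv_a: "(\<lambda>j. 1 / a j) \<longlonglongrightarrow> 0"
    by (rule tendsto_divide_0[OF tendsto_const filterlim_at_top_imp_at_infinity[OF a_top]])
  have \<eta>1: "0 \<le> \<eta> j s" "\<eta> j s \<le> 1" for j s by (auto simp: \<eta>_def flat1_bounds)
  have \<eta>lim: "(\<lambda>j. \<eta> j s) \<longlonglongrightarrow> 1" if "s < 1" for s
    unfolding \<eta>_def by (rule filterlim_compose[OF flat1_tendsto lim_y[OF that]])
  have bF: "\<bar>F s\<bar> \<le> C * (1 - s)" if s: "s \<in> {0..1}" for s
  proof -
    have "norm (F s - F 1) \<le> C * norm (s - 1)"
      by (rule field_differentiable_bound[where S="{0..1}" and f'=F1]) (use s F C in auto)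
    then show ?thesis using s F by simp
  qed
  have inv_a1: "1 / a j \<le> 1" for j using a[of j] by simp
  have bP: "\<bar>P j s\<bar> \<le> (C + 1) * (1 - s)" if s: "s \<in> {0..1}" for j s
  proof -
    have "1 / a j * (1 - s) \<le> 1 * (1 - s)" using inv_a1 s by (intro mult_right_mono) auto
    then show ?thesis using bF[OF s] P(5)[OF s, of j] by (simp add: algebra_simps)
  qed
  have bP': "\<bar>P' j s\<bar> \<le> C + 1" if s: "s \<in> {0..1}" for j s
    using P(4)[OF s, of j] C(3)[OF s] inv_a1[of j] by linarith
  have Plim: "(\<lambda>j. P j s) \<longlonglongrightarrow> F s" if s: "s \<in> {0..1}" for s
  proof (rule Lim_null[THEN iffD2], rule Lim_null_comparison)
    show "\<forall>\<^sub>F j in sequentially. norm (P j s - F s) \<le> 1 / a j * (1 - s)" using P(5)[OF s] by simp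
    show "(\<lambda>j. 1 / a j * (1 - s)) \<longlonglongrightarrow> 0" by (rule tendsto_mult_left_zero[OF inv_a])
  qed
  have P'lim: "(\<lambda>j. P' j s) \<longlonglongrightarrow> F1 s" if s: "s \<in> {0..1}" for s
  proof (rule Lim_null[THEN iffD2], rule Lim_null_comparison)
    show "\<forall>\<^sub>F j in sequentially. norm (P' j s - F1 s) \<le> 1 / a j" using P(4)[OF s] by simp
  qed (rule inv_a)
  \<comment> \<open>with \<open>y = a j * (1 - s) - 1\<close> the term in which the cutoff is differentiated is at most
      \<open>(C + 1) * (y + 1) * flat1' y\<close>\<close>
  have b\<eta>': "\<bar>\<eta>' j s * P j s\<bar> \<le> (C + 1) * ((y + 1) * flat1' y)"
    if s: "s \<in> {0..1}" and y: "y = - a j * s + (a j - 1)" for j s y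
  proof -
    have f: "0 \<le> flat1' y" by (simp add: flat1'_def flat_def)
    have "\<bar>\<eta>' j s * P j s\<bar> = a j * flat1' y * \<bar>P j s\<bar>"
      using a(2)[of j] f by (simp add: \<eta>'_def y abs_mult)
    also have "\<dots> \<le> a j * flat1' y * ((C + 1) * (1 - s))"
      using bP[OF s, of j] f a(2)[of j] by (intro mult_left_mono) auto
    also have "\<dots> = (C + 1) * ((y + 1) * flat1' y)" by (simp add: y algebra_simps)
    finally show ?thesis .
  qed
  have flat1'_lim: "((\<lambda>y. (y + 1) * flat1' y) \<longlongrightarrow> 0) at_top"
  proof (rule Lim_null_comparison)
    show "\<forall>\<^sub>F y in at_top. norm ((y + 1) * flat1' y) \<le> 2 / y"
      using eventually_ge_at_top[of 1] by eventually_elim (use flat1'_bounds in \<open>auto simp: abs_of_nonneg\<close>)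
    show "((\<lambda>y::real. 2 / y) \<longlongrightarrow> 0) at_top"
      by (intro tendsto_divide_0[OF tendsto_const] filterlim_at_top_imp_at_infinity filterlim_ident)
  qed
  have \<eta>'lim: "(\<lambda>j. \<eta>' j s * P j s) \<longlonglongrightarrow> 0" if s: "s \<in> {0..<1}" for s
  proof (rule Lim_null_comparison)
    define y where "y j = - a j * s + (a j - 1)" for j
    show "\<forall>\<^sub>F j in sequentially. norm (\<eta>' j s * P j s) \<le> (C + 1) * ((y j + 1) * flat1' (y j))"
      using b\<eta>'[OF _ y_def] s by auto
    show "(\<lambda>j. (C + 1) * ((y j + 1) * flat1' (y j))) \<longlonglongrightarrow> 0"
      using s lim_y[of s] unfolding y_def
      by (intro tendsto_mult_right_zero filterlim_compose[OF flat1'_lim]) auto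
  qed
  have bu: "\<bar>u j s\<bar> \<le> C + 1" and bu': "\<bar>u' j s\<bar> \<le> 5 * (C + 1)" if s: "s \<in> {0..1}" for j s
  proof -
    have "\<bar>P j s\<bar> \<le> (C + 1) * 1" using bP[OF s, of j] s C(1) mult_left_mono[of "1 - s" 1 "C + 1"] by (auto intro: order.trans)
    then show "\<bar>u j s\<bar> \<le> C + 1"
      using \<eta>1[of j s] mult_mono[of "\<bar>\<eta> j s\<bar>" 1 "\<bar>P j s\<bar>" "C + 1"] by (simp add: u_def abs_mult)
    have "\<bar>\<eta> j s * P' j s\<bar> \<le> 1 * (C + 1)"
      unfolding abs_mult using \<eta>1[of j s] bP'[OF s, of j] by (intro mult_mono) auto
    moreover have "\<bar>\<eta>' j s * P j s\<bar> \<le> (C + 1) * 4"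
      using C(1) by (intro order.trans[OF b\<eta>'[OF s refl]] mult_left_mono flat1'_bounds) auto
    ultimately show "\<bar>u' j s\<bar> \<le> 5 * (C + 1)" unfolding u'_def by linarith
  qed
  have ulim: "(\<lambda>j. u j s) \<longlonglongrightarrow> F s" and u'lim: "(\<lambda>j. u' j s) \<longlonglongrightarrow> F1 s" if s: "s \<in> {0..<1}" for s
  proof -
    have "s \<in> {0..1}" "s < 1" using s by auto
    then show "(\<lambda>j. u j s) \<longlonglongrightarrow> F s" "(\<lambda>j. u' j s) \<longlonglongrightarrow> F1 s"
      unfolding u_def u'_def
      using tendsto_mult[OF \<eta>lim Plim] tendsto_add[OF tendsto_mult[OF \<eta>lim P'lim] \<eta>'lim[OF s]] by fastforce+
  qed
  have cu: "continuous_on UNIV (u j)" for j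
    by (rule continuous_at_imp_continuous_on) (use du DERIV_isCont in blast)
  have cflat1': "continuous_on UNIV flat1'"
    unfolding flat1'_def by (rule continuous_at_imp_continuous_on) (use DERIV_flat DERIV_isCont in blast)
  have cu': "continuous_on UNIV (u' j)" for j
    unfolding u'_def \<eta>'_def
    by (intro continuous_intros P continuous_on_compose2[OF cflat1'] continuous_at_imp_continuous_on)
       (use d\<eta> P(2) DERIV_isCont in \<open>blast+\<close>)
  have grad: "pderiv_at b (\<phi> j) x = 2 * (x \<bullet> b) * u' j (x \<bullet> x)" if x: "x \<in> ball 0 1" for b j x
  proof -
    have "((\<lambda>t. \<phi> j (x + t *\<^sub>R b)) has_real_derivative 2 * (x \<bullet> b) * u' j (x \<bullet> x)) (at 0)"
      unfolding \<phi>_def by (rule radial_line_derivative[OF has_field_derivative_at_within[OF du] x])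
    then show ?thesis using test_function_line_derivative[OF \<phi>_test] DERIV_unique by blast
  qed
  have s: "x \<bullet> x \<in> {0..1}" if "x \<in> ball 0 1" for x :: 'a
    using inner_self_ball[OF that] by auto
  have L1: "(\<lambda>j. Lp_norm (ball 0 1) p (\<lambda>x. \<phi> j x - F (x \<bullet> x))) \<longlonglongrightarrow> 0"
  proof (rule Lp_norm_tendsto_0[where C="(C + 1) + C"])
    fix j :: nat and x :: 'a assume x: "x \<in> ball 0 1"
    show "\<bar>\<phi> j x - F (x \<bullet> x)\<bar> \<le> (C + 1) + C"
      using bu[OF s[OF x], of j] C(2)[OF s[OF x]] unfolding \<phi>_def by linarith
    show "(\<lambda>j. \<phi> j x - F (x \<bullet> x)) \<longlonglongrightarrow> 0"
      unfolding \<phi>_def by (rule Lim_null[THEN iffD1, OF ulim[OF inner_self_ball[OF x]]])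
  qed (use p cu in \<open>auto simp: \<phi>_def intro!: continuous_intros continuous_on_radial radial_profile_cont intro: continuous_on_subset\<close>)
  have L2: "(\<lambda>j. Lp_norm (ball 0 1) p (\<lambda>x. pderiv_at b (\<phi> j) x - 2 * (x \<bullet> b) * F1 (x \<bullet> x))) \<longlonglongrightarrow> 0"
    if b: "b \<in> Basis" for b
  proof (rule Lp_norm_tendsto_0[where C="2 * 1 * (5 * (C + 1)) + 2 * 1 * C"])
    fix j :: nat and x :: 'a assume x: "x \<in> ball 0 1"
    have "\<bar>2 * (x \<bullet> b) * u' j (x \<bullet> x)\<bar> \<le> 2 * 1 * (5 * (C + 1))"
      unfolding abs_mult using abs_inner_ball_le_1[OF x b] bu'[OF s[OF x]] C(1) by (intro mult_mono) auto
    moreover have "\<bar>2 * (x \<bullet> b) * F1 (x \<bullet> x)\<bar> \<le> 2 * 1 * C"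
      unfolding abs_mult using abs_inner_ball_le_1[OF x b] C(3)[OF s[OF x]] C(1) by (intro mult_mono) auto
    ultimately show "\<bar>pderiv_at b (\<phi> j) x - 2 * (x \<bullet> b) * F1 (x \<bullet> x)\<bar> \<le> 2 * 1 * (5 * (C + 1)) + 2 * 1 * C"
      unfolding grad[OF x] by linarith
    have "(\<lambda>j. 2 * (x \<bullet> b) * u' j (x \<bullet> x)) \<longlonglongrightarrow> 2 * (x \<bullet> b) * F1 (x \<bullet> x)"
      by (intro tendsto_mult_left u'lim inner_self_ball x)
    then show "(\<lambda>j. pderiv_at b (\<phi> j) x - 2 * (x \<bullet> b) * F1 (x \<bullet> x)) \<longlonglongrightarrow> 0"
      unfolding grad[OF x] by (rule Lim_null[THEN iffD1])
  next
    fix j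
    have "continuous_on (ball 0 1) (\<lambda>x. 2 * (x \<bullet> b) * u' j (x \<bullet> x) - 2 * (x \<bullet> b) * F1 (x \<bullet> x))"
      by (intro continuous_intros continuous_on_radial radial_profile_cont continuous_on_subset[OF cu']) auto
    then show "continuous_on (ball 0 1) (\<lambda>x. pderiv_at b (\<phi> j) x - 2 * (x \<bullet> b) * F1 (x \<bullet> x))"
      by (rule continuous_on_eq) (simp add: grad del: mem_ball)
  qed (use p in auto)
  show ?thesis unfolding sobolev0_def mem_Collect_eq
  proof (intro conjI exI[of _ \<phi>] allI ballI)
    show "(\<lambda>x. F (x \<bullet> x)) \<in> sobolev (ball (0::'a) 1) 1 p" by (rule radial_sobolev_2(2)[OF p])
    show "\<exists>g\<in>Lp_space (ball 0 1) p. weak_pderiv (ball 0 1) b (\<lambda>x. F (x \<bullet> x)) g \<and>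
        (\<lambda>j. Lp_norm (ball 0 1) p (\<lambda>x. pderiv_at b (\<phi> j) x - g x)) \<longlonglongrightarrow> 0" if b: "b \<in> Basis" for b
      using radial_sobolev_2(3)[OF p b] radial_weak_pderiv[OF b] L2[OF b] by blast
  qed (use \<phi>_test L1 in auto)
qed

lemma radial_dirichlet_space:
  "(\<lambda>x. F (x \<bullet> x)) \<in> dirichlet_space (ball (0::'a::euclidean_space) 1)"
  unfolding dirichlet_space_def using radial_sobolev0 radial_sobolev_2(1) by auto

end

section \<open>A positive eigenfunction belongs to the least eigenvalue\<close>

lemma square_integrable_mult:
  fixes f g :: "'a \<Rightarrow> real"
  assumes "f \<in> borel_measurable M" "g \<in> borel_measurable M"
    and "integrable M (\<lambda>x. (f x)\<^sup>2)" "integrable M (\<lambda>x. (g x)\<^sup>2)"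
  shows "integrable M (\<lambda>x. f x * g x)"
proof (rule Bochner_Integration.integrable_bound)
  show "integrable M (\<lambda>x. (f x)\<^sup>2 + (g x)\<^sup>2)" using assms by simp
  show "AE x in M. norm (f x * g x) \<le> norm ((f x)\<^sup>2 + (g x)\<^sup>2)"
  proof (rule AE_I2)
    fix x
    have "0 \<le> (\<bar>f x\<bar> - \<bar>g x\<bar>)\<^sup>2" by simp
    then have "2 * (\<bar>f x\<bar> * \<bar>g x\<bar>) \<le> (f x)\<^sup>2 + (g x)\<^sup>2" by (simp add: power2_diff)
    moreover have "0 \<le> \<bar>f x\<bar> * \<bar>g x\<bar>" by simp
    ultimately show "norm (f x * g x) \<le> norm ((f x)\<^sup>2 + (g x)\<^sup>2)" unfolding abs_mult real_norm_def by linarith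
  qed
qed (use assms in auto)

lemma square_integrable_add:
  fixes f g :: "'a \<Rightarrow> real"
  assumes "f \<in> borel_measurable M" "g \<in> borel_measurable M"
    and "integrable M (\<lambda>x. (f x)\<^sup>2)" "integrable M (\<lambda>x. (g x)\<^sup>2)"
  shows "integrable M (\<lambda>x. (f x + g x)\<^sup>2)" "integrable M (\<lambda>x. (f x - g x)\<^sup>2)"
  using assms square_integrable_mult[OF assms] by (auto simp: power2_sum power2_diff mult.assoc)

text \<open>
  By \<open>2 |a d| \<le> t a\<^sup>2 + d\<^sup>2 / t\<close> with a suitable constant \<open>t\<close>, in place of the Cauchy--Schwarz inequality.
\<close>
lemma L2_weak_limit:
  fixes a :: "'a \<Rightarrow> real" and d :: "nat \<Rightarrow> 'a \<Rightarrow> real"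
  assumes a: "a \<in> borel_measurable M" "integrable M (\<lambda>x. (a x)\<^sup>2)"
    and d: "\<And>j. d j \<in> borel_measurable M" "\<And>j. integrable M (\<lambda>x. (d j x)\<^sup>2)"
    and lim: "(\<lambda>j. LINT x|M. (d j x)\<^sup>2) \<longlonglongrightarrow> 0"
  shows "(\<lambda>j. LINT x|M. a x * d j x) \<longlonglongrightarrow> 0"
proof (rule LIMSEQ_I)
  fix r :: real assume r: "r > 0"
  define e where "e = r / 2"
  define A where "A = (LINT x|M. (a x)\<^sup>2)"
  have A: "A \<ge> 0" by (simp add: A_def)
  define t where "t = e / (A + 1)"
  have e: "e > 0" "t > 0" using r A by (auto simp: e_def t_def)
  obtain N where N: "\<And>j. j \<ge> N \<Longrightarrow> norm (LINT x|M. (d j x)\<^sup>2) < e * t"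
    using LIMSEQ_D[OF lim, of "e * t"] e by auto
  show "\<exists>N. \<forall>j\<ge>N. norm ((LINT x|M. a x * d j x) - 0) < r"
  proof (intro exI[of _ N] allI impI)
    fix j assume "j \<ge> N"
    have ad: "integrable M (\<lambda>x. a x * d j x)" using square_integrable_mult a d by blast
    have "\<bar>LINT x|M. a x * d j x\<bar> \<le> (LINT x|M. \<bar>a x * d j x\<bar>)" by (rule integral_abs_bound)
    also have "\<dots> \<le> (LINT x|M. (t * (a x)\<^sup>2 + (d j x)\<^sup>2 / t) / 2)"
    proof (rule integral_mono)
      show "\<bar>a x * d j x\<bar> \<le> (t * (a x)\<^sup>2 + (d j x)\<^sup>2 / t) / 2" for x
      proof -
        have "0 \<le> (t * \<bar>a x\<bar> - \<bar>d j x\<bar>)\<^sup>2 / t" using e by simp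
        also have "\<dots> = t * (a x)\<^sup>2 + (d j x)\<^sup>2 / t - 2 * \<bar>a x * d j x\<bar>"
          using e by (simp add: power2_diff power_mult_distrib abs_mult field_simps) (simp add: power2_eq_square)
        finally show ?thesis by simp
      qed
    qed (use ad a d in auto)
    also have "\<dots> = (t * A + (LINT x|M. (d j x)\<^sup>2) / t) / 2"
      using a d by (simp add: A_def)
    also have "\<dots> \<le> (e + e) / 2"
    proof -
      have "t * A \<le> e" using A e by (simp add: t_def field_simps)
      moreover have "(LINT x|M. (d j x)\<^sup>2) / t \<le> e" using N[OF \<open>j \<ge> N\<close>] e by (simp add: field_simps)
      ultimately show ?thesis by simp
    qed
    also have "\<dots> < r" using r by (simp add: e_def)
    finally show "norm ((LINT x|M. a x * d j x) - 0) < r" by simp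
  qed
qed

lemma L2_product_limit:
  fixes a b :: "'a \<Rightarrow> real" and a' b' :: "nat \<Rightarrow> 'a \<Rightarrow> real"
  assumes a: "a \<in> borel_measurable M" "integrable M (\<lambda>x. (a x)\<^sup>2)"
    and b: "b \<in> borel_measurable M" "integrable M (\<lambda>x. (b x)\<^sup>2)"
    and a': "\<And>j. a' j \<in> borel_measurable M" "\<And>j. integrable M (\<lambda>x. (a' j x)\<^sup>2)"
    and b': "\<And>j. b' j \<in> borel_measurable M" "\<And>j. integrable M (\<lambda>x. (b' j x)\<^sup>2)"
    and lim: "(\<lambda>j. LINT x|M. (a' j x - a x)\<^sup>2) \<longlonglongrightarrow> 0" "(\<lambda>j. LINT x|M. (b' j x - b x)\<^sup>2) \<longlonglongrightarrow> 0"
  shows "(\<lambda>j. LINT x|M. a' j x * b' j x) \<longlonglongrightarrow> (LINT x|M. a x * b x)"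
proof -
  define d where "d j x = a' j x - a x" for j x
  define e where "e j x = b' j x - b x" for j x
  have d: "d j \<in> borel_measurable M" "integrable M (\<lambda>x. (d j x)\<^sup>2)" for j
    unfolding d_def[abs_def] using a a' by (auto intro!: square_integrable_add(2))
  have e: "e j \<in> borel_measurable M" "integrable M (\<lambda>x. (e j x)\<^sup>2)" for j
    unfolding e_def[abs_def] using b b' by (auto intro!: square_integrable_add(2))
  have i: "integrable M (\<lambda>x. a x * b x)" "\<And>j. integrable M (\<lambda>x. a x * e j x)"
      "\<And>j. integrable M (\<lambda>x. b x * d j x)" "\<And>j. integrable M (\<lambda>x. d j x * e j x)"
    using a b d e square_integrable_mult by blast+
  have "(\<lambda>j. LINT x|M. d j x * e j x) \<longlonglongrightarrow> 0"
  proof (rule Lim_null_comparison)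
    have "norm (LINT x|M. d j x * e j x) \<le> (LINT x|M. (d j x)\<^sup>2) + (LINT x|M. (e j x)\<^sup>2)" for j
    proof -
      have "\<bar>LINT x|M. d j x * e j x\<bar> \<le> (LINT x|M. \<bar>d j x * e j x\<bar>)" by (rule integral_abs_bound)
      also have "\<dots> \<le> (LINT x|M. (d j x)\<^sup>2 + (e j x)\<^sup>2)"
      proof (rule integral_mono)
        show "\<bar>d j x * e j x\<bar> \<le> (d j x)\<^sup>2 + (e j x)\<^sup>2" for x
        proof -
          have "0 \<le> (\<bar>d j x\<bar> - \<bar>e j x\<bar>)\<^sup>2" by simp
          then have "2 * (\<bar>d j x\<bar> * \<bar>e j x\<bar>) \<le> (d j x)\<^sup>2 + (e j x)\<^sup>2" by (simp add: power2_diff)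
          moreover have "0 \<le> \<bar>d j x\<bar> * \<bar>e j x\<bar>" by simp
          ultimately show ?thesis unfolding abs_mult by linarith
        qed
      qed (use i d e in auto)
      finally show ?thesis using d e by simp
    qed
    then show "\<forall>\<^sub>F j in sequentially. norm (LINT x|M. d j x * e j x) \<le> (LINT x|M. (d j x)\<^sup>2) + (LINT x|M. (e j x)\<^sup>2)"
      by simp
    show "(\<lambda>j. (LINT x|M. (d j x)\<^sup>2) + (LINT x|M. (e j x)\<^sup>2)) \<longlonglongrightarrow> 0"
      using tendsto_add[OF lim] by (simp add: d_def e_def)
  qed
  moreover have "(\<lambda>j. LINT x|M. a x * e j x) \<longlonglongrightarrow> 0"
    by (rule L2_weak_limit[OF a e]) (use lim in \<open>simp add: e_def\<close>)
  moreover have "(\<lambda>j. LINT x|M. b x * d j x) \<longlonglongrightarrow> 0"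
    by (rule L2_weak_limit[OF b d]) (use lim in \<open>simp add: d_def\<close>)
  ultimately have "(\<lambda>j. (LINT x|M. a x * b x) + (LINT x|M. a x * e j x) + (LINT x|M. b x * d j x) + (LINT x|M. d j x * e j x))
      \<longlonglongrightarrow> (LINT x|M. a x * b x) + 0 + 0 + 0"
    by (intro tendsto_add tendsto_const)
  moreover have "(LINT x|M. a' j x * b' j x) =
      (LINT x|M. a x * b x) + (LINT x|M. a x * e j x) + (LINT x|M. b x * d j x) + (LINT x|M. d j x * e j x)" for j
  proof -
    have "(LINT x|M. a' j x * b' j x) = (LINT x|M. a x * b x + a x * e j x + b x * d j x + d j x * e j x)"
      by (rule arg_cong[where f="integral\<^sup>L M"]) (auto simp: fun_eq_iff d_def e_def algebra_simps)
    also have "\<dots> = (LINT x|M. a x * b x) + (LINT x|M. a x * e j x) + (LINT x|M. b x * d j x) + (LINT x|M. d j x * e j x)"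
      using i by simp
    finally show ?thesis .
  qed
  ultimately show ?thesis by simp
qed

lemma Lp_space_2: "f \<in> Lp_space \<Omega> 2 \<longleftrightarrow> f \<in> borel_measurable (lebesgue_on \<Omega>) \<and> integrable (lebesgue_on \<Omega>) (\<lambda>x. (f x)\<^sup>2)"
  by (simp add: Lp_space_def powr_numeral)

lemma Lp_norm_2_tendsto_0:
  assumes "(\<lambda>j. Lp_norm \<Omega> 2 (f j)) \<longlonglongrightarrow> 0"
  shows "(\<lambda>j. LINT x|lebesgue_on \<Omega>. (f j x)\<^sup>2) \<longlonglongrightarrow> 0"
proof -
  have "(Lp_norm \<Omega> 2 (f j))\<^sup>2 = (LINT x|lebesgue_on \<Omega>. (f j x)\<^sup>2)" for j
    by (simp add: Lp_norm_def powr_numeral powr_half_sqrt)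
  moreover have "(\<lambda>j. (Lp_norm \<Omega> 2 (f j))\<^sup>2) \<longlonglongrightarrow> 0\<^sup>2" using assms by (rule tendsto_power)
  ultimately show ?thesis by simp
qed

lemma integrable_locally_integrable_times_test:
  assumes \<Omega>: "open \<Omega>" and f: "locally_integrable \<Omega> f" and \<eta>: "\<eta> \<in> test_functions \<Omega>"
  shows "integrable (lebesgue_on \<Omega>) (\<lambda>x. f x * \<eta> x)"
proof -
  obtain K where K: "compact K" "K \<subseteq> \<Omega>" "\<And>x. x \<notin> K \<Longrightarrow> \<eta> x = 0"
    using test_functions_support[OF \<eta>] by blast
  have c: "continuous_on UNIV \<eta>" by (rule test_function_continuous[OF \<eta>])
  obtain C where C: "\<And>x. x \<in> K \<Longrightarrow> \<bar>\<eta> x\<bar> \<le> C"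
    using compact_imp_bounded[OF compact_continuous_image[OF continuous_on_subset[OF c] K(1)]]
    unfolding bounded_iff by (metis UNIV_I image_eqI real_norm_def subsetI)
  have i: "integrable lebesgue (\<lambda>x. indicator K x *\<^sub>R f x)"
    using f K by (auto simp: locally_integrable_def set_integrable_def)
  have "integrable lebesgue (\<lambda>x. (indicator K x *\<^sub>R f x) * \<eta> x)"
  proof (rule Bochner_Integration.integrable_bound)
    show "integrable lebesgue (\<lambda>x. C * (indicator K x *\<^sub>R f x))" using i by (rule integrable_mult_right)
    have "\<eta> \<in> borel_measurable lebesgue"
      using c by (simp add: borel_measurable_continuous_onI measurable_completion)
    then show "(\<lambda>x. (indicator K x *\<^sub>R f x) * \<eta> x) \<in> borel_measurable lebesgue"
      using borel_measurable_integrable[OF i] by (intro borel_measurable_times)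
    show "AE x in lebesgue. norm (indicator K x *\<^sub>R f x * \<eta> x) \<le> norm (C * (indicator K x *\<^sub>R f x))"
    proof (rule AE_I2)
      fix x
      have "\<bar>\<eta> x\<bar> * \<bar>f x\<bar> \<le> \<bar>C\<bar> * \<bar>f x\<bar>" if "x \<in> K"
        using C[OF that] by (intro mult_right_mono) auto
      then show "norm (indicator K x *\<^sub>R f x * \<eta> x) \<le> norm (C * (indicator K x *\<^sub>R f x))"
        by (auto simp: indicator_def abs_mult mult.commute)
    qed
  qed
  also have "(\<lambda>x. (indicator K x *\<^sub>R f x) * \<eta> x) = (\<lambda>x. indicator \<Omega> x *\<^sub>R (f x * \<eta> x))"
    using K by (auto simp: fun_eq_iff indicator_def)
  finally show ?thesis using \<Omega> by (simp add: integrable_restrict_space)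
qed

context
  fixes \<Omega> :: "'a::euclidean_space set" and \<phi> m :: "'a \<Rightarrow> real" and g h :: "'a \<Rightarrow> 'a \<Rightarrow> real" and \<kappa> :: real
  assumes \<Omega>: "open \<Omega>"
    and pos: "\<And>x. x \<in> \<Omega> \<Longrightarrow> \<phi> x > 0"
    and cont: "continuous_on \<Omega> \<phi>" "\<And>b. b \<in> Basis \<Longrightarrow> continuous_on \<Omega> (g b)" "\<And>b. b \<in> Basis \<Longrightarrow> continuous_on \<Omega> (h b)"
      "continuous_on \<Omega> m"
    and der1: "\<And>x b. x \<in> \<Omega> \<Longrightarrow> b \<in> Basis \<Longrightarrow> ((\<lambda>t. \<phi> (x + t *\<^sub>R b)) has_real_derivative g b x) (at 0)"
    and der2: "\<And>x b. x \<in> \<Omega> \<Longrightarrow> b \<in> Basis \<Longrightarrow> ((\<lambda>t. g b (x + t *\<^sub>R b)) has_real_derivative h b x) (at 0)"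
    and eq: "\<And>x. x \<in> \<Omega> \<Longrightarrow> (\<Sum>b\<in>Basis. h b x) + \<kappa> * m x * \<phi> x = 0"
begin

text \<open>
  Picone's inequality: the field \<open>(\<eta>\<^sup>2 / \<phi>) \<nabla>\<phi>\<close> has compact support, and its divergence is
  \<open>|\<nabla>\<eta>|\<^sup>2 - |\<nabla>\<eta> - (\<eta> / \<phi>) \<nabla>\<phi>|\<^sup>2 + (\<eta>\<^sup>2 / \<phi>) \<Delta>\<phi>\<close>, where \<open>\<Delta>\<phi> = - \<kappa> m \<phi>\<close>.
\<close>
lemma picone_test_function:
  assumes \<eta>: "\<eta> \<in> test_functions \<Omega>"
  shows "\<kappa> * (LINT x|lebesgue_on \<Omega>. m x * \<eta> x * \<eta> x) \<le>
     (\<Sum>b\<in>Basis. LINT x|lebesgue_on \<Omega>. pderiv_at b \<eta> x * pderiv_at b \<eta> x)"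
proof -
  obtain K where K: "compact K" "K \<subseteq> \<Omega>" "\<And>x. x \<notin> K \<Longrightarrow> \<eta> x = 0"
    using test_functions_support[OF \<eta>] by blast
  have c\<eta>: "continuous_on \<Omega> \<eta>" "\<And>b. b \<in> Basis \<Longrightarrow> continuous_on \<Omega> (pderiv_at b \<eta>)"
    using test_function_continuous[OF \<eta>] test_function_continuous[OF pderiv_at_test_function[OF \<eta>]]
    by (auto intro: continuous_on_subset)
  have p0: "pderiv_at b \<eta> x = 0" if "x \<notin> K" for x b
    by (rule pderiv_at_zero_off_support[OF \<eta> compact_imp_closed[OF K(1)] K(3) that])
  define Y where "Y b x = (2 * \<eta> x * pderiv_at b \<eta> x * g b x + (\<eta> x)\<^sup>2 * h b x) / \<phi> x - (\<eta> x * g b x / \<phi> x)\<^sup>2" for b x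
  have ne: "\<phi> x \<noteq> 0" if "x \<in> \<Omega>" for x using pos[OF that] by simp
  have Y: "integrable (lebesgue_on \<Omega>) (Y b)" "(LINT x|lebesgue_on \<Omega>. Y b x) = 0" if b: "b \<in> Basis" for b
  proof -
    have d: "((\<lambda>t. (\<eta> (x + t *\<^sub>R b))\<^sup>2 * g b (x + t *\<^sub>R b) / \<phi> (x + t *\<^sub>R b)) has_real_derivative Y b x) (at 0)"
      if x: "x \<in> \<Omega>" for x
      using ne[OF x]
      by (auto intro!: derivative_eq_intros test_function_line_derivative[OF \<eta>] der1[OF x b] der2[OF x b]
          simp: Y_def field_simps power2_eq_square)
    have cX: "continuous_on \<Omega> (\<lambda>x. (\<eta> x)\<^sup>2 * g b x / \<phi> x)"
      using ne by (intro continuous_intros cont c\<eta> b) auto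
    have cY: "continuous_on \<Omega> (Y b)"
      unfolding Y_def using ne by (intro continuous_intros cont c\<eta> b) auto
    have z: "(\<eta> x)\<^sup>2 * g b x / \<phi> x = 0" if "x \<in> \<Omega>" "x \<notin> K" for x
      using K(3) that by simp
    show "integrable (lebesgue_on \<Omega>) (Y b)" "(LINT x|lebesgue_on \<Omega>. Y b x) = 0"
      using integral_line_derivative_compact_support[OF \<Omega> K(1,2) cX cY z d] by blast+
  qed
  have im: "integrable (lebesgue_on \<Omega>) (\<lambda>x. m x * \<eta> x * \<eta> x)"
    by (rule integrable_continuous_compact_support[OF \<Omega> K(1,2)])
       (use K(3) in \<open>auto intro!: continuous_intros cont c\<eta>\<close>)
  have ip: "integrable (lebesgue_on \<Omega>) (\<lambda>x. pderiv_at b \<eta> x * pderiv_at b \<eta> x)" if b: "b \<in> Basis" for b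
    by (rule integrable_continuous_compact_support[OF \<Omega> K(1,2)])
       (use p0 in \<open>auto intro!: continuous_intros cont c\<eta> b\<close>)
  have "0 = (LINT x|lebesgue_on \<Omega>. (\<Sum>b\<in>Basis. Y b x))"
    using Y by simp
  also have "\<dots> \<le> (LINT x|lebesgue_on \<Omega>. (\<Sum>b\<in>Basis. pderiv_at b \<eta> x * pderiv_at b \<eta> x) - \<kappa> * (m x * \<eta> x * \<eta> x))"
  proof (rule integral_mono)
    fix x assume "x \<in> space (lebesgue_on \<Omega>)"
    then have x: "x \<in> \<Omega>" by simp
    have "Y b x \<le> pderiv_at b \<eta> x * pderiv_at b \<eta> x + (\<eta> x)\<^sup>2 / \<phi> x * h b x" for b
    proof -
      have "0 \<le> (pderiv_at b \<eta> x - \<eta> x * g b x / \<phi> x)\<^sup>2" by simp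
      also have "\<dots> = pderiv_at b \<eta> x * pderiv_at b \<eta> x + (\<eta> x)\<^sup>2 / \<phi> x * h b x - Y b x"
        by (simp add: Y_def power2_diff add_divide_distrib) (simp add: power2_eq_square)
      finally show ?thesis by simp
    qed
    then have "(\<Sum>b\<in>Basis. Y b x) \<le> (\<Sum>b\<in>Basis. pderiv_at b \<eta> x * pderiv_at b \<eta> x + (\<eta> x)\<^sup>2 / \<phi> x * h b x)"
      by (rule sum_mono)
    also have "\<dots> = (\<Sum>b\<in>Basis. pderiv_at b \<eta> x * pderiv_at b \<eta> x) + (\<eta> x)\<^sup>2 / \<phi> x * (\<Sum>b\<in>Basis. h b x)"
      by (simp add: sum.distrib sum_distrib_left)
    also have "(\<Sum>b\<in>Basis. h b x) = - \<kappa> * m x * \<phi> x" using eq[OF x] by simp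
    also have "(\<eta> x)\<^sup>2 / \<phi> x * (- \<kappa> * m x * \<phi> x) = - \<kappa> * (m x * \<eta> x * \<eta> x)"
      using ne[OF x] by (simp add: power2_eq_square)
    finally show "(\<Sum>b\<in>Basis. Y b x) \<le> (\<Sum>b\<in>Basis. pderiv_at b \<eta> x * pderiv_at b \<eta> x) - \<kappa> * (m x * \<eta> x * \<eta> x)" by simp
  qed (use Y im ip in auto)
  also have "\<dots> = (\<Sum>b\<in>Basis. LINT x|lebesgue_on \<Omega>. pderiv_at b \<eta> x * pderiv_at b \<eta> x) - \<kappa> * (LINT x|lebesgue_on \<Omega>. m x * \<eta> x * \<eta> x)"
    using im ip by simp
  finally show ?thesis by simp
qed

text \<open>
  Let \<open>\<psi>\<close> be an eigenfunction for \<open>\<mu>\<close> and let the test functions \<open>\<eta>\<^sub>j\<close> approximate it in \<open>W\<^sup>1\<^sup>,\<^sup>2\<close>. Picone's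
  inequality in the limit gives \<open>\<kappa> \<integral> m \<psi>\<^sup>2 \<le> \<integral> |\<nabla>\<psi>|\<^sup>2\<close>, and testing the eigenvalue equation with \<open>\<eta>\<^sub>j\<close> gives
  \<open>\<integral> |\<nabla>\<psi>|\<^sup>2 = \<mu> \<integral> m \<psi>\<^sup>2\<close>. As \<open>m > 0\<close> and \<open>\<psi>\<close> is not zero almost everywhere, \<open>\<kappa> \<le> \<mu>\<close>.
\<close>
lemma positive_eigenfunction_le_eigenvalue:
  assumes m: "\<And>x. x \<in> \<Omega> \<Longrightarrow> 0 < m x" "\<And>x. x \<in> \<Omega> \<Longrightarrow> m x \<le> C"
    and eig: "is_eigenvalue \<Omega> m \<mu>"
  shows "\<kappa> \<le> \<mu>"
proof (rule ccontr)
  assume "\<not> \<kappa> \<le> \<mu>"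
  then have less: "\<mu> < \<kappa>" by simp
  let ?M = "lebesgue_on \<Omega>"
  obtain \<psi> w where \<psi>: "\<psi> \<in> dirichlet_space \<Omega>" "\<not> (AE x in ?M. \<psi> x = 0)" "weak_laplacian \<Omega> \<psi> w"
      "AE x in ?M. w x + \<mu> * m x * \<psi> x = 0"
    using eig by (auto simp: is_eigenvalue_def)
  obtain G H where GH: "\<And>b. b \<in> Basis \<Longrightarrow> weak_pderiv \<Omega> b \<psi> (G b)" "\<And>b. b \<in> Basis \<Longrightarrow> weak_pderiv \<Omega> b (G b) (H b)"
      "w = (\<lambda>x. \<Sum>b\<in>Basis. H b x)"
    using \<psi>(3) by (auto simp: weak_laplacian_def)
  have "(2::real) \<in> {1<..}" by simp
  then have s0: "\<psi> \<in> sobolev0 \<Omega> 2" "\<psi> \<in> sobolev \<Omega> 2 2" using \<psi>(1) unfolding dirichlet_space_def by blast+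
  then have L\<psi>: "\<psi> \<in> Lp_space \<Omega> 2" by (simp add: numeral_2_eq_2)
  obtain \<eta> where \<eta>: "\<And>j. \<eta> j \<in> test_functions \<Omega>" "(\<lambda>j. Lp_norm \<Omega> 2 (\<lambda>x. \<eta> j x - \<psi> x)) \<longlonglongrightarrow> 0"
     "\<And>b. b \<in> Basis \<Longrightarrow> \<exists>g\<in>Lp_space \<Omega> 2. weak_pderiv \<Omega> b \<psi> g \<and>
        (\<lambda>j. Lp_norm \<Omega> 2 (\<lambda>x. pderiv_at b (\<eta> j) x - g x)) \<longlonglongrightarrow> 0"
    using s0(1) unfolding sobolev0_def by blast
  have "\<exists>q. \<forall>b\<in>Basis. q b \<in> Lp_space \<Omega> 2 \<and> weak_pderiv \<Omega> b \<psi> (q b) \<and>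
        (\<lambda>j. Lp_norm \<Omega> 2 (\<lambda>x. pderiv_at b (\<eta> j) x - q b x)) \<longlonglongrightarrow> 0"
    by (rule bchoice) (use \<eta>(3) in blast)
  then obtain q where q: "\<And>b. b \<in> Basis \<Longrightarrow> q b \<in> Lp_space \<Omega> 2" "\<And>b. b \<in> Basis \<Longrightarrow> weak_pderiv \<Omega> b \<psi> (q b)"
     "\<And>b. b \<in> Basis \<Longrightarrow> (\<lambda>j. Lp_norm \<Omega> 2 (\<lambda>x. pderiv_at b (\<eta> j) x - q b x)) \<longlonglongrightarrow> 0"
    by blast
  have test2: "\<theta> \<in> borel_measurable ?M" "integrable ?M (\<lambda>x. (\<theta> x)\<^sup>2)" if \<theta>: "\<theta> \<in> test_functions \<Omega>" for \<theta>
  proof -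
    have c: "continuous_on \<Omega> \<theta>" using test_function_continuous[OF \<theta>] by (rule continuous_on_subset) simp
    then show "\<theta> \<in> borel_measurable ?M" by (rule continuous_measurable_lebesgue_on[OF \<Omega>])
    obtain K where K: "compact K" "K \<subseteq> \<Omega>" "\<And>x. x \<notin> K \<Longrightarrow> \<theta> x = 0"
      using test_functions_support[OF \<theta>] by blast
    show "integrable ?M (\<lambda>x. (\<theta> x)\<^sup>2)"
      by (rule integrable_continuous_compact_support[OF \<Omega> K(1,2)]) (use K(3) in \<open>auto intro!: continuous_intros c\<close>)
  qed
  have m_meas: "m \<in> borel_measurable ?M" by (rule continuous_measurable_lebesgue_on[OF \<Omega> cont(4)])
  have times_m: "(\<lambda>x. m x * f x) \<in> borel_measurable ?M" "integrable ?M (\<lambda>x. (m x * f x)\<^sup>2)"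
    if f: "f \<in> borel_measurable ?M" "integrable ?M (\<lambda>x. (f x)\<^sup>2)" for f
  proof -
    show mf: "(\<lambda>x. m x * f x) \<in> borel_measurable ?M" using m_meas f by simp
    show "integrable ?M (\<lambda>x. (m x * f x)\<^sup>2)"
    proof (rule Bochner_Integration.integrable_bound)
      show "integrable ?M (\<lambda>x. C\<^sup>2 * (f x)\<^sup>2)" using f by simp
      show "AE x in ?M. norm ((m x * f x)\<^sup>2) \<le> norm (C\<^sup>2 * (f x)\<^sup>2)"
      proof (rule AE_I2)
        fix x assume "x \<in> space ?M"
        then have "x \<in> \<Omega>" by simp
        then have "(m x)\<^sup>2 \<le> C\<^sup>2" using m[of x] by (intro power_mono) auto
        then show "norm ((m x * f x)\<^sup>2) \<le> norm (C\<^sup>2 * (f x)\<^sup>2)"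
          by (simp add: power_mult_distrib mult_right_mono)
      qed
    qed (use mf in simp)
  qed
  have \<psi>2: "\<psi> \<in> borel_measurable ?M" "integrable ?M (\<lambda>x. (\<psi> x)\<^sup>2)"
    using L\<psi> by (auto simp: Lp_space_2)
  have q2: "q b \<in> borel_measurable ?M" "integrable ?M (\<lambda>x. (q b x)\<^sup>2)" if "b \<in> Basis" for b
    using q(1)[OF that] by (auto simp: Lp_space_2)
  define I where "I = (LINT x|?M. m x * \<psi> x * \<psi> x)"
  define Q where "Q = (\<Sum>b\<in>Basis. LINT x|?M. q b x * q b x)"
  have lim\<eta>: "(\<lambda>j. LINT x|?M. (\<eta> j x - \<psi> x)\<^sup>2) \<longlonglongrightarrow> 0" by (rule Lp_norm_2_tendsto_0[OF \<eta>(2)])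
  have limq: "(\<lambda>j. LINT x|?M. (pderiv_at b (\<eta> j) x - q b x)\<^sup>2) \<longlonglongrightarrow> 0" if "b \<in> Basis" for b
    by (rule Lp_norm_2_tendsto_0[OF q(3)[OF that]])
  have limm: "(\<lambda>j. LINT x|?M. (m x * \<eta> j x - m x * \<psi> x)\<^sup>2) \<longlonglongrightarrow> 0"
  proof (rule Lim_null_comparison)
    show "(\<lambda>j. C\<^sup>2 * (LINT x|?M. (\<eta> j x - \<psi> x)\<^sup>2)) \<longlonglongrightarrow> 0" by (rule tendsto_mult_right_zero[OF lim\<eta>])
    have "norm (LINT x|?M. (m x * \<eta> j x - m x * \<psi> x)\<^sup>2) \<le> C\<^sup>2 * (LINT x|?M. (\<eta> j x - \<psi> x)\<^sup>2)" for j
    proof -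
      have d: "(\<lambda>x. \<eta> j x - \<psi> x) \<in> borel_measurable ?M" "integrable ?M (\<lambda>x. (\<eta> j x - \<psi> x)\<^sup>2)"
        using test2[OF \<eta>(1)] \<psi>2 square_integrable_add(2)[OF test2(1)[OF \<eta>(1)] \<psi>2(1) test2(2)[OF \<eta>(1)] \<psi>2(2)] by auto
      have "(LINT x|?M. (m x * (\<eta> j x - \<psi> x))\<^sup>2) \<le> (LINT x|?M. C\<^sup>2 * (\<eta> j x - \<psi> x)\<^sup>2)"
      proof (rule integral_mono[OF times_m(2)[OF d]])
        fix x assume "x \<in> space ?M"
        then have "x \<in> \<Omega>" by simp
        then have "(m x)\<^sup>2 \<le> C\<^sup>2" using m[of x] by (intro power_mono) auto
        then show "(m x * (\<eta> j x - \<psi> x))\<^sup>2 \<le> C\<^sup>2 * (\<eta> j x - \<psi> x)\<^sup>2"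
          by (simp add: power_mult_distrib mult_right_mono)
      qed (use d in simp)
      then show ?thesis by (simp add: right_diff_distrib)
    qed
    then show "\<forall>\<^sub>F j in sequentially. norm (LINT x|?M. (m x * \<eta> j x - m x * \<psi> x)\<^sup>2) \<le> C\<^sup>2 * (LINT x|?M. (\<eta> j x - \<psi> x)\<^sup>2)"
      by simp
  qed
  have "(\<lambda>j. LINT x|?M. m x * \<eta> j x * \<eta> j x) \<longlonglongrightarrow> I"
    unfolding I_def
    by (rule L2_product_limit[OF times_m[OF \<psi>2] \<psi>2 times_m[OF test2[OF \<eta>(1)]] test2[OF \<eta>(1)] limm lim\<eta>])
  moreover have "(\<lambda>j. \<Sum>b\<in>Basis. LINT x|?M. pderiv_at b (\<eta> j) x * pderiv_at b (\<eta> j) x) \<longlonglongrightarrow> Q"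
    unfolding Q_def
    by (rule tendsto_sum, rule L2_product_limit)
       (use q2 limq test2 pderiv_at_test_function[OF \<eta>(1)] in auto)
  moreover have "\<kappa> * (LINT x|?M. m x * \<eta> j x * \<eta> j x) \<le> (\<Sum>b\<in>Basis. LINT x|?M. pderiv_at b (\<eta> j) x * pderiv_at b (\<eta> j) x)" for j
    by (rule picone_test_function[OF \<eta>(1)])
  ultimately have IQ: "\<kappa> * I \<le> Q"
    by (intro LIMSEQ_le[OF tendsto_mult_left]) auto
  have id: "(\<Sum>b\<in>Basis. LINT x|?M. q b x * pderiv_at b (\<eta> j) x) = \<mu> * (LINT x|?M. m x * \<psi> x * \<eta> j x)" for j
  proof -
    \<comment> \<open>The gradient \<open>q\<close> from the approximation and the gradient \<open>G\<close> from the weak Laplacian agree when tested against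
        \<open>pderiv_at b (\<eta> j)\<close>, which is itself a test function.\<close>
    have "(LINT x|?M. q b x * pderiv_at b (\<eta> j) x) = - (LINT x|?M. H b x * \<eta> j x)" if b: "b \<in> Basis" for b
    proof -
      have t: "pderiv_at b (\<eta> j) \<in> test_functions \<Omega>" by (rule pderiv_at_test_function[OF \<eta>(1) b])
      have "(LINT x|?M. q b x * pderiv_at b (\<eta> j) x) = - (LINT x|?M. \<psi> x * pderiv_at b (pderiv_at b (\<eta> j)) x)"
        using q(2)[OF b] t by (simp add: weak_pderiv_def)
      also have "\<dots> = (LINT x|?M. G b x * pderiv_at b (\<eta> j) x)"
        using GH(1)[OF b] t by (simp add: weak_pderiv_def)
      also have "\<dots> = - (LINT x|?M. H b x * \<eta> j x)"
        using GH(2)[OF b] \<eta>(1) by (simp add: weak_pderiv_def)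
      finally show ?thesis .
    qed
    then have "(\<Sum>b\<in>Basis. LINT x|?M. q b x * pderiv_at b (\<eta> j) x) = - (\<Sum>b\<in>Basis. LINT x|?M. H b x * \<eta> j x)"
      by (simp add: sum_negf)
    also have iH: "integrable ?M (\<lambda>x. H b x * \<eta> j x)" if "b \<in> Basis" for b
      using integrable_locally_integrable_times_test[OF \<Omega> _ \<eta>(1)] GH(2)[OF that] by (auto simp: weak_pderiv_def)
    then have "(\<Sum>b\<in>Basis. LINT x|?M. H b x * \<eta> j x) = (LINT x|?M. w x * \<eta> j x)"
      by (simp add: GH(3) sum_distrib_right)
    also have "\<dots> = (LINT x|?M. - \<mu> * (m x * \<psi> x * \<eta> j x))"
    proof (rule integral_cong_AE)
      have "integrable ?M (\<lambda>x. w x * \<eta> j x)" using iH by (simp add: GH(3) sum_distrib_right)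
      then show "(\<lambda>x. w x * \<eta> j x) \<in> borel_measurable ?M" by (rule borel_measurable_integrable)
      show "(\<lambda>x. - \<mu> * (m x * \<psi> x * \<eta> j x)) \<in> borel_measurable ?M"
        using m_meas \<psi>2 test2[OF \<eta>(1)] by simp
      show "AE x in ?M. w x * \<eta> j x = - \<mu> * (m x * \<psi> x * \<eta> j x)"
        using \<psi>(4)
      proof eventually_elim
        case (elim x)
        then have "w x = - \<mu> * (m x * \<psi> x)" by simp
        then show ?case by simp
      qed
    qed
    finally show ?thesis by simp
  qed
  have "(\<lambda>j. \<Sum>b\<in>Basis. LINT x|?M. q b x * pderiv_at b (\<eta> j) x) \<longlonglongrightarrow> Q"
    unfolding Q_def
    by (rule tendsto_sum, rule L2_product_limit)
       (use q2 limq test2 pderiv_at_test_function[OF \<eta>(1)] in auto)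
  moreover have "(\<lambda>j. LINT x|?M. m x * \<psi> x * \<eta> j x) \<longlonglongrightarrow> I"
    unfolding I_def
    by (rule L2_product_limit[OF times_m[OF \<psi>2] \<psi>2 times_m[OF \<psi>2] test2[OF \<eta>(1)] _ lim\<eta>]) simp
  then have "(\<lambda>j. \<mu> * (LINT x|?M. m x * \<psi> x * \<eta> j x)) \<longlonglongrightarrow> \<mu> * I" by (rule tendsto_mult_left)
  ultimately have "Q = \<mu> * I" unfolding id by (rule LIMSEQ_unique)
  with IQ have "(\<kappa> - \<mu>) * I \<le> 0" by (simp add: left_diff_distrib)
  then have "I \<le> 0" using less by (simp add: mult_le_0_iff)
  moreover have nn: "AE x in ?M. 0 \<le> m x * \<psi> x * \<psi> x"
    by (rule AE_I2) (simp add: mult.assoc m(1) less_imp_le zero_le_mult_iff)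
  ultimately have I0: "I = 0" using integral_nonneg_AE[OF nn] by (simp add: I_def)
  have "integrable ?M (\<lambda>x. m x * \<psi> x * \<psi> x)"
    by (rule square_integrable_mult[OF times_m(1)[OF \<psi>2] \<psi>2(1) times_m(2)[OF \<psi>2] \<psi>2(2)])
  then have "AE x in ?M. m x * \<psi> x * \<psi> x = 0"
    using integral_nonneg_eq_0_iff_AE[OF _ nn] I0 by (simp add: I_def)
  moreover have "AE x in ?M. 0 < m x" by (rule AE_I2) (use m(1) in auto)
  ultimately have "AE x in ?M. \<psi> x = 0" by eventually_elim auto
  then show False using \<psi>(2) by simp
qed

end

section \<open>The radial Laplacian and its inverse\<close>

text \<open>
  Substituting \<open>\<tau> = s t\<^sup>2\<close> gives \<open>s\<^sup>n\<^sup>/\<^sup>2 flux n g s = \<integral>\<^sub>0\<^sup>s \<tau>\<^sup>n\<^sup>/\<^sup>2\<^sup>-\<^sup>1 g(\<tau>) d\<tau>\<close>. Thus \<open>flux n g s\<close> is \<open>2/n\<close> times the mean of \<open>g(|x|\<^sup>2)\<close> over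
  the ball of radius \<open>sqrt s\<close> in dimension \<open>n\<close>, and a radial function \<open>F(|x|\<^sup>2)\<close> with \<open>-\<Delta> F(|x|\<^sup>2) = g(|x|\<^sup>2)\<close> has
  \<open>F' = - flux n g / 4\<close>. The chosen form has only integer powers and no singularity at \<open>s = 0\<close>.
\<close>
definition flux :: "nat \<Rightarrow> (real \<Rightarrow> real) \<Rightarrow> real \<Rightarrow> real" where
  "flux n g s = 2 * integral {0..1} (\<lambda>t. t ^ (n - 1) * g (s * t\<^sup>2))"

text \<open>
  The derivative of \<open>flux n g\<close> when \<open>g'\<close> is that of \<open>g\<close>.
\<close>
definition flux' :: "nat \<Rightarrow> (real \<Rightarrow> real) \<Rightarrow> real \<Rightarrow> real" where
  "flux' n g' s = 2 * integral {0..1} (\<lambda>t. t ^ (n - 1) * (g' (s * t\<^sup>2) * t\<^sup>2))"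

definition profile_deriv :: "(real \<Rightarrow> real) \<Rightarrow> (real \<Rightarrow> real) \<Rightarrow> bool" where
  "profile_deriv g g' \<longleftrightarrow> continuous_on {0..1} g \<and> continuous_on {0..<1} g' \<and>
     (\<forall>s\<in>{0..<1}. (g has_real_derivative g' s) (at s within {0..<1}))"

lemma mult_square_mem_unit: 
  fixes s t :: real
  shows "s \<in> {0..1} \<Longrightarrow> t \<in> {0..1} \<Longrightarrow> s * t\<^sup>2 \<in> {0..1}"
    and "s \<in> {0..<1} \<Longrightarrow> t \<in> {0..1} \<Longrightarrow> s * t\<^sup>2 \<in> {0..<1}"
proof -
  have *: "0 \<le> s * t\<^sup>2" "s * t\<^sup>2 \<le> s" if "0 \<le> s" "t \<in> {0..1}"
    using that mult_left_mono[of "t\<^sup>2" 1 s] by (auto simp: power_le_one)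
  show "s \<in> {0..1} \<Longrightarrow> t \<in> {0..1} \<Longrightarrow> s * t\<^sup>2 \<in> {0..1}"
    "s \<in> {0..<1} \<Longrightarrow> t \<in> {0..1} \<Longrightarrow> s * t\<^sup>2 \<in> {0..<1}"
    using * by fastforce+
qed

lemma flux_integrand_continuous:
  fixes g :: "real \<Rightarrow> real"
  assumes "continuous_on {0..1} g" "s \<in> {0..1}"
  shows "continuous_on {0..1} (\<lambda>t. t ^ k * g (s * t\<^sup>2))"
  by (intro continuous_intros continuous_on_compose2[OF assms(1)]) (use mult_square_mem_unit(1)[OF assms(2)] in auto)

lemma flux_integrable:
  fixes g :: "real \<Rightarrow> real"
  assumes "continuous_on {0..1} g" "s \<in> {0..1}"
  shows "(\<lambda>t. t ^ k * g (s * t\<^sup>2)) integrable_on {0..1}"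
  by (rule integrable_continuous_real[OF flux_integrand_continuous[OF assms]])

lemma flux_continuous:
  assumes "continuous_on {0..1} g"
  shows "continuous_on {0..1} (flux n g)"
proof -
  have "continuous_on ({0..1} \<times> cbox 0 1) (\<lambda>(s, t). t ^ (n - 1) * g (s * t\<^sup>2))"
    unfolding split_beta
    by (intro continuous_intros continuous_on_compose2[OF assms])
       (use mult_square_mem_unit(1) in \<open>force simp: cbox_interval\<close>)
  then have "continuous_on {0..1} (\<lambda>s. integral (cbox 0 1) (\<lambda>t. t ^ (n - 1) * g (s * t\<^sup>2)))"
    by (rule integral_continuous_on_param)
  then show ?thesis unfolding flux_def[abs_def] by (intro continuous_intros) (simp add: cbox_interval)
qed

lemma integral_power_01: "integral {0..1} (\<lambda>t::real. t ^ k) = 1 / real (Suc k)"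
proof -
  have "((\<lambda>t::real. t ^ k) has_integral (1 ^ Suc k / real (Suc k) - 0 ^ Suc k / real (Suc k))) {0..1}"
  proof (rule fundamental_theorem_of_calculus)
    show "((\<lambda>t. t ^ Suc k / real (Suc k)) has_vector_derivative x ^ k) (at x within {0..1})" for x :: real
      unfolding has_real_derivative_iff_has_vector_derivative[symmetric]
      by (auto intro!: derivative_eq_intros simp del: power_Suc)
  qed simp
  then show ?thesis by (simp add: integral_unique)
qed

lemma flux_mono:
  assumes "continuous_on {0..1} g" "continuous_on {0..1} h" "\<And>s. s \<in> {0..1} \<Longrightarrow> g s \<le> h s" "s \<in> {0..1}"
  shows "flux n g s \<le> flux n h s"
  unfolding flux_def
  using mult_square_mem_unit(1)[OF assms(4)]
  by (intro mult_left_mono integral_le flux_integrable assms) auto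

lemma flux_cmult: "flux n (\<lambda>s. c * g s) s = c * flux n g s"
  unfolding flux_def by (simp add: mult.left_commute[of _ c])

lemma flux_add:
  assumes "continuous_on {0..1} g" "continuous_on {0..1} h" "s \<in> {0..1}"
  shows "flux n (\<lambda>s. g s + h s) s = flux n g s + flux n h s"
  unfolding flux_def
  using integral_add[OF flux_integrable[OF assms(1,3), of "n - 1"] flux_integrable[OF assms(2,3), of "n - 1"]]
  by (simp add: distrib_left)

lemma flux_power:
  assumes "n \<ge> 1"
  shows "flux n (\<lambda>s. s ^ k) s = 2 / (real n + 2 * real k) * s ^ k"
proof -
  have "integral {0..1} (\<lambda>t. t ^ (n - 1) * (s * t\<^sup>2) ^ k) = integral {0..1} (\<lambda>t. s ^ k * t ^ (n - 1 + 2 * k))"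
    by (rule arg_cong[where f="integral {0..1}"]) (auto simp: power_mult_distrib power_add power_mult[symmetric])
  also have "\<dots> = s ^ k * (1 / real (Suc (n - 1 + 2 * k)))" by (simp add: integral_power_01)
  finally show ?thesis using assms by (simp add: flux_def of_nat_diff)
qed

text \<open>
  A factor \<open>2 / (n + 2 k) \<le> 1\<close> is given away.
\<close>
lemma flux_abs_le_power:
  assumes g: "continuous_on {0..1} g" and n: "n \<ge> 2" and B: "\<And>s. s \<in> {0..1} \<Longrightarrow> \<bar>g s\<bar> \<le> B * s ^ k" and s: "s \<in> {0..1}"
  shows "\<bar>flux n g s\<bar> \<le> B * s ^ k"
proof -
  have Bs: "0 \<le> B * s ^ k" using B[OF s] by (rule order.trans[OF abs_ge_zero])
  have c: "continuous_on {0..1} (\<lambda>s::real. B * s ^ k)" by (intro continuous_intros)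
  have e: "flux n (\<lambda>s. B * s ^ k) s = 2 / (real n + 2 * real k) * (B * s ^ k)"
    using n by (simp add: flux_cmult flux_power)
  have "flux n g s \<le> flux n (\<lambda>s. B * s ^ k) s"
    by (rule flux_mono[OF g c _ s]) (use B in fastforce)
  moreover have "flux n (\<lambda>s. - 1 * (B * s ^ k)) s \<le> flux n g s"
    by (rule flux_mono[OF _ g _ s]) (use B in \<open>fastforce intro!: continuous_intros\<close>)+
  ultimately have "\<bar>flux n g s\<bar> \<le> 2 / (real n + 2 * real k) * (B * s ^ k)"
    unfolding flux_cmult[of n "-1"] e by linarith
  also have "\<dots> \<le> 1 * (B * s ^ k)"
    using n Bs by (intro mult_right_mono) (auto simp: divide_simps)
  finally show ?thesis by simp
qed

lemma flux_derivative:
  assumes g: "profile_deriv g g'" and s: "s \<in> {0..<1}"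
  shows "(flux n g has_real_derivative flux' n g' s) (at s within {0..<1})"
proof -
  have cg: "continuous_on {0..1} g" and cg': "continuous_on {0..<1} g'"
    and d: "\<And>s. s \<in> {0..<1} \<Longrightarrow> (g has_real_derivative g' s) (at s within {0..<1})"
    using g by (auto simp: profile_deriv_def)
  have "((\<lambda>s. integral (cbox 0 1) (\<lambda>t. t ^ (n - 1) * g (s * t\<^sup>2))) has_real_derivative
      integral (cbox 0 1) (\<lambda>t. t ^ (n - 1) * (g' (s * t\<^sup>2) * t\<^sup>2))) (at s within {0..<1})"
  proof (rule leibniz_rule_field_derivative[OF _ _ _ s])
    show "((\<lambda>s. t ^ (n - 1) * g (s * t\<^sup>2)) has_real_derivative t ^ (n - 1) * (g' (x * t\<^sup>2) * t\<^sup>2)) (at x within {0..<1})"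
      if x: "x \<in> {0..<1}" and t: "t \<in> cbox 0 1" for x t :: real
    proof -
      have t': "t \<in> {0..1}" using t by (simp add: cbox_interval)
      have "(g has_real_derivative g' (x * t\<^sup>2)) (at (x * t\<^sup>2) within (\<lambda>s. s * t\<^sup>2) ` {0..<1})"
        by (rule DERIV_subset[OF d[OF mult_square_mem_unit(2)[OF x t']]]) (use mult_square_mem_unit(2)[OF _ t'] in auto)
      moreover have "((\<lambda>s. s * t\<^sup>2) has_real_derivative t\<^sup>2) (at x within {0..<1})"
        by (auto intro!: derivative_eq_intros)
      ultimately have "(g \<circ> (\<lambda>s. s * t\<^sup>2) has_real_derivative g' (x * t\<^sup>2) * t\<^sup>2) (at x within {0..<1})"
        by (rule DERIV_image_chain)
      then show ?thesis by (intro DERIV_cmult) (simp add: o_def)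
    qed
    show "(\<lambda>t. t ^ (n - 1) * g (x * t\<^sup>2)) integrable_on cbox 0 1" if "x \<in> {0..<1}" for x
      using flux_integrable[OF cg, of x] that by (simp add: cbox_interval)
    show "continuous_on ({0..<1} \<times> cbox 0 1) (\<lambda>(x, t). t ^ (n - 1) * (g' (x * t\<^sup>2) * t\<^sup>2))"
      unfolding split_beta
      by (intro continuous_intros continuous_on_compose2[OF cg'])
         (use mult_square_mem_unit(2) in \<open>force simp: cbox_interval\<close>)
  qed simp
  from DERIV_cmult[OF this, of 2] show ?thesis
    by (simp add: flux_def[abs_def] flux'_def cbox_interval)
qed

lemma flux'_continuous:
  assumes "continuous_on {0..<1} g'"
  shows "continuous_on {0..<1} (flux' n g')"
proof -
  have "continuous_on ({0..<1} \<times> cbox 0 1) (\<lambda>(s, t). t ^ (n - 1) * (g' (s * t\<^sup>2) * t\<^sup>2))"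
    unfolding split_beta
    by (intro continuous_intros continuous_on_compose2[OF assms])
       (use mult_square_mem_unit(2) in \<open>force simp: cbox_interval\<close>)
  then have "continuous_on {0..<1} (\<lambda>s. integral (cbox 0 1) (\<lambda>t. t ^ (n - 1) * (g' (s * t\<^sup>2) * t\<^sup>2)))"
    by (rule integral_continuous_on_param)
  then show ?thesis unfolding flux'_def[abs_def] by (intro continuous_intros) (simp add: cbox_interval)
qed

text \<open>
  Integrate the derivative of \<open>t\<^sup>n g(s t\<^sup>2)\<close> with respect to \<open>t\<close> over \<open>[0, 1]\<close>.
\<close>
lemma flux_ode:
  assumes g: "profile_deriv g g'" and s: "s \<in> {0..<1}" and n: "n \<ge> 1"
  shows "s * flux' n g' s + real n / 2 * flux n g s = g s"
proof -
  have cg: "continuous_on {0..1} g" and cg': "continuous_on {0..<1} g'"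
    and d: "\<And>s. s \<in> {0..<1} \<Longrightarrow> (g has_real_derivative g' s) (at s within {0..<1})"
    using g by (auto simp: profile_deriv_def)
  define D where "D t = real n * (t ^ (n - 1) * g (s * t\<^sup>2)) + 2 * s * (t ^ (n - 1) * (g' (s * t\<^sup>2) * t\<^sup>2))" for t
  have i2: "(\<lambda>t. t ^ (n - 1) * (g' (s * t\<^sup>2) * t\<^sup>2)) integrable_on {0..1}"
    by (intro integrable_continuous_real continuous_intros continuous_on_compose2[OF cg'])
       (use mult_square_mem_unit(2)[OF s] in auto)
  have i1: "(\<lambda>t. t ^ (n - 1) * g (s * t\<^sup>2)) integrable_on {0..1}" using s by (intro flux_integrable cg) auto
  have "(D has_integral (1 ^ n * g (s * 1\<^sup>2) - 0 ^ n * g (s * 0\<^sup>2))) {0..1}"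
  proof (rule fundamental_theorem_of_calculus)
    fix t :: real assume t: "t \<in> {0..1}"
    have "(g has_real_derivative g' (s * t\<^sup>2)) (at (s * t\<^sup>2) within (\<lambda>t. s * t\<^sup>2) ` {0..1})"
      by (rule DERIV_subset[OF d[OF mult_square_mem_unit(2)[OF s t]]]) (use mult_square_mem_unit(2)[OF s] in auto)
    moreover have "((\<lambda>t. s * t\<^sup>2) has_real_derivative 2 * s * t) (at t within {0..1})"
      by (auto intro!: derivative_eq_intros)
    ultimately have "(g \<circ> (\<lambda>t. s * t\<^sup>2) has_real_derivative g' (s * t\<^sup>2) * (2 * s * t)) (at t within {0..1})"
      by (rule DERIV_image_chain)
    then have 1: "((\<lambda>t. g (s * t\<^sup>2)) has_real_derivative g' (s * t\<^sup>2) * (2 * s * t)) (at t within {0..1})"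
      by (simp add: o_def)
    have 2: "((\<lambda>t. t ^ n) has_real_derivative real n * t ^ (n - 1)) (at t within {0..1})"
      by (auto intro!: derivative_eq_intros)
    have "t ^ n = t ^ (n - 1) * t" using n by (metis One_nat_def Suc_le_D diff_Suc_1 power_Suc2)
    then have "real n * t ^ (n - 1) * g (s * t\<^sup>2) + g' (s * t\<^sup>2) * (2 * s * t) * t ^ n = D t"
      by (simp add: D_def power2_eq_square)
    with DERIV_mult[OF 2 1] have "((\<lambda>t. t ^ n * g (s * t\<^sup>2)) has_real_derivative D t) (at t within {0..1})" by simp
    then show "((\<lambda>t. t ^ n * g (s * t\<^sup>2)) has_vector_derivative D t) (at t within {0..1})"
      by (simp add: has_real_derivative_iff_has_vector_derivative)
  qed simp
  then have "integral {0..1} D = g s" using n by (simp add: integral_unique zero_power)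
  moreover have "integral {0..1} D = real n * integral {0..1} (\<lambda>t. t ^ (n - 1) * g (s * t\<^sup>2)) +
      2 * s * integral {0..1} (\<lambda>t. t ^ (n - 1) * (g' (s * t\<^sup>2) * t\<^sup>2))"
    unfolding D_def[abs_def]
    using integral_add[OF integrable_on_mult_right[OF i1] integrable_on_mult_right[OF i2], of "real n" "2 * s"] by simp
  ultimately show ?thesis by (simp add: flux_def flux'_def)
qed

text \<open>
  Near \<open>s = 1\<close> the derivative of \<open>g\<close> may be unbounded, but the identity \<open>s flux' + n/2 flux = g\<close> expresses the
  derivative of the flux by \<open>g\<close> itself.
\<close>
lemma flux'_bounded:
  assumes g: "profile_deriv g g'" and n: "n \<ge> 1"
  shows "bounded (flux' n g' ` {0..<1})"
proof -
  have cg: "continuous_on {0..1} g" and cg': "continuous_on {0..<1} g'" using g by (auto simp: profile_deriv_def)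
  have "bounded (flux' n g' ` {0..1/2})"
    by (intro compact_imp_bounded compact_continuous_image continuous_on_subset[OF flux'_continuous[OF cg']]) auto
  moreover have "bounded (flux' n g' ` {1/2..<1})"
  proof -
    have "continuous_on {1/2..1} (\<lambda>s. (g s - real n / 2 * flux n g s) / s)"
      by (intro continuous_intros continuous_on_subset[OF cg] continuous_on_subset[OF flux_continuous[OF cg]]) auto
    then have "bounded ((\<lambda>s. (g s - real n / 2 * flux n g s) / s) ` {1/2..1})"
      by (intro compact_imp_bounded compact_continuous_image) auto
    moreover have "flux' n g' ` {1/2..<1} \<subseteq> (\<lambda>s. (g s - real n / 2 * flux n g s) / s) ` {1/2..1}"
    proof (rule image_subsetI)
      fix s :: real assume s: "s \<in> {1/2..<1}"
      then have "s \<in> {0..<1}" by simp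
      from flux_ode[OF g this n] have "flux' n g' s * s = g s - real n / 2 * flux n g s"
        by (simp add: mult.commute)
      then have "flux' n g' s = (g s - real n / 2 * flux n g s) / s"
        using s by (intro eq_divide_imp) auto
      then show "flux' n g' s \<in> (\<lambda>s. (g s - real n / 2 * flux n g s) / s) ` {1/2..1}"
        by (rule image_eqI) (use s in simp)
    qed
    ultimately show ?thesis by (rule bounded_subset)
  qed
  ultimately have "bounded (flux' n g' ` ({0..1/2} \<union> {1/2..<1}))" by (simp add: image_Un)
  moreover have "{0..1/2} \<union> {1/2..<1} = {0..<1::real}" by auto
  ultimately show ?thesis by simp
qed

text \<open>
  In the radius \<open>r\<close> the function \<open>r\<^sup>n flux n g (r\<^sup>2)\<close> is, up to a constant factor, the mass of \<open>g(|x|\<^sup>2)\<close> in the ball of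
  radius \<open>r\<close>.
\<close>
lemma DERIV_power_flux:
  assumes g: "profile_deriv g g'" and n: "n \<ge> 1" and r: "0 < r" "r < 1"
  shows "((\<lambda>r. r ^ n * flux n g (r\<^sup>2)) has_real_derivative 2 * r ^ (n - 1) * g (r\<^sup>2)) (at r)"
proof -
  have r2: "r\<^sup>2 \<in> {0<..<1}" using r by (auto simp: abs_square_less_1)
  have "(flux n g has_real_derivative flux' n g' (r\<^sup>2)) (at (r\<^sup>2) within {0..<1})"
    using r2 by (intro flux_derivative[OF g]) auto
  then have "(flux n g has_real_derivative flux' n g' (r\<^sup>2)) (at (r\<^sup>2) within {0<..<1})"
    by (rule DERIV_subset) auto
  then have "(flux n g has_real_derivative flux' n g' (r\<^sup>2)) (at (r\<^sup>2))"
    unfolding at_within_open[OF r2 open_greaterThanLessThan] .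
  then have "((\<lambda>r. flux n g (r\<^sup>2)) has_real_derivative flux' n g' (r\<^sup>2) * (2 * r)) (at r)"
    by (rule DERIV_chain2) (auto intro!: derivative_eq_intros)
  moreover have "((\<lambda>r. r ^ n) has_real_derivative real n * r ^ (n - 1)) (at r)"
    by (auto intro!: derivative_eq_intros)
  ultimately have "((\<lambda>r. r ^ n * flux n g (r\<^sup>2)) has_real_derivative
      real n * r ^ (n - 1) * flux n g (r\<^sup>2) + flux' n g' (r\<^sup>2) * (2 * r) * r ^ n) (at r)"
    by (rule DERIV_mult[rotated])
  moreover have "r ^ n = r ^ (n - 1) * r" using n by (metis One_nat_def Suc_le_D diff_Suc_1 power_Suc2)
  then have "real n * r ^ (n - 1) * flux n g (r\<^sup>2) + flux' n g' (r\<^sup>2) * (2 * r) * r ^ n =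
      2 * r ^ (n - 1) * (r\<^sup>2 * flux' n g' (r\<^sup>2) + real n / 2 * flux n g (r\<^sup>2))"
    by (simp add: power2_eq_square algebra_simps)
  ultimately show ?thesis using flux_ode[OF g _ n, of "r\<^sup>2"] r2 by simp
qed

definition cumflux :: "nat \<Rightarrow> (real \<Rightarrow> real) \<Rightarrow> real \<Rightarrow> real" where
  "cumflux n g s = integral {0..s} (flux n g) / 4"

text \<open>
  The solution \<open>F\<close> of \<open>-\<Delta> F(|x|\<^sup>2) = g(|x|\<^sup>2)\<close> that vanishes on the unit sphere; \<^term>\<open>cumflux n g\<close> has the opposite
  Laplacian and vanishes at the origin.
\<close>
definition potential :: "nat \<Rightarrow> (real \<Rightarrow> real) \<Rightarrow> real \<Rightarrow> real" where
  "potential n g s = integral {s..1} (flux n g) / 4"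

lemma cumflux_derivative:
  assumes "continuous_on {0..1} g" "s \<in> {0..1}"
  shows "(cumflux n g has_real_derivative flux n g s / 4) (at s within {0..1})"
  unfolding cumflux_def[abs_def]
  by (intro DERIV_cdivide integral_has_real_derivative flux_continuous assms)

lemma potential_derivative:
  assumes "continuous_on {0..1} g" "s \<in> {0..1}"
  shows "(potential n g has_real_derivative - flux n g s / 4) (at s within {0..1})"
  unfolding potential_def[abs_def]
  by (intro DERIV_cdivide integral_has_real_derivative' flux_continuous assms)

lemma potential_eq_cumflux:
  assumes "continuous_on {0..1} g" "s \<in> {0..1}"
  shows "potential n g s = cumflux n g 1 - cumflux n g s"
  using Henstock_Kurzweil_Integration.integral_combine[of 0 s 1 "flux n g"]
    integrable_continuous_real[OF flux_continuous[OF assms(1)], of n] assms(2)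
  by (simp add: potential_def cumflux_def)

lemma potential_1 [simp]: "potential n g 1 = 0" by (simp add: potential_def)

lemma cumflux_0 [simp]: "cumflux n g 0 = 0" by (simp add: cumflux_def)

lemma flux_integrable_on:
  assumes "continuous_on {0..1} g" "0 \<le> a" "b \<le> 1"
  shows "flux n g integrable_on {a..b}"
  by (intro integrable_continuous_real continuous_on_subset[OF flux_continuous[OF assms(1)]]) (use assms in auto)

lemma potential_mono:
  assumes "continuous_on {0..1} g" "continuous_on {0..1} h" "\<And>s. s \<in> {0..1} \<Longrightarrow> flux n g s \<le> flux n h s" "s \<in> {0..1}"
  shows "potential n g s \<le> potential n h s"
  unfolding potential_def using assms(4)
  by (intro divide_right_mono integral_le flux_integrable_on assms) auto

lemma potential_cmult:
  assumes "s \<in> {0..1}"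
  shows "potential n (\<lambda>s. c * g s) s = c * potential n g s"
  unfolding potential_def flux_cmult[abs_def] by simp

lemma potential_radial_profile:
  assumes g: "profile_deriv g g'" and n: "n \<ge> 1"
  shows "radial_profile (potential n g) (\<lambda>s. - flux n g s / 4) (\<lambda>s. - flux' n g' s / 4)"
    and "s \<in> {0..<1} \<Longrightarrow> 2 * real n * (- flux n g s / 4) + 4 * s * (- flux' n g' s / 4) = - g s"
proof -
  have cg: "continuous_on {0..1} g" and cg': "continuous_on {0..<1} g'" using g by (auto simp: profile_deriv_def)
  have "bounded ((\<lambda>x. (- 1 / 4) *\<^sub>R x) ` flux' n g' ` {0..<1})"
    by (rule bounded_scaling[OF flux'_bounded[OF g n]])
  then have "bounded ((\<lambda>s. - flux' n g' s / 4) ` {0..<1})" by (simp add: image_image)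
  then show "radial_profile (potential n g) (\<lambda>s. - flux n g s / 4) (\<lambda>s. - flux' n g' s / 4)"
    unfolding radial_profile_def
    by (intro conjI ballI potential_derivative[OF cg] continuous_intros flux_continuous[OF cg] flux'_continuous[OF cg']
        DERIV_cdivide DERIV_minus flux_derivative[OF g]) simp_all
  show "2 * real n * (- flux n g s / 4) + 4 * s * (- flux' n g' s / 4) = - g s" if s: "s \<in> {0..<1}"
    using flux_ode[OF g s n] by simp
qed

section \<open>The principal radial eigenfunction\<close>

lemma continuous_unit_interval_bounded:
  fixes f :: "real \<Rightarrow> real"
  assumes "continuous_on {0..1} f"
  obtains B where "B \<ge> 0" "\<And>s. s \<in> {0..1} \<Longrightarrow> \<bar>f s\<bar> \<le> B"
proof -
  have "bounded (f ` {0..1})" by (intro compact_imp_bounded compact_continuous_image assms) auto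
  then obtain B where "\<forall>y\<in>f ` {0..1}. norm y \<le> B" unfolding bounded_iff by blast
  then show ?thesis by (intro that[of "\<bar>B\<bar>"]) (auto intro: order.trans[OF _ abs_ge_self])
qed

lemma cumflux_continuous:
  assumes "continuous_on {0..1} g"
  shows "continuous_on {0..1} (cumflux n g)"
  using cumflux_derivative[OF assms] by (rule DERIV_continuous_on)

lemma cumflux_cmult: "cumflux n (\<lambda>s. c * g s) s = c * cumflux n g s"
  unfolding cumflux_def flux_cmult[abs_def] by simp

lemma cumflux_add:
  assumes "continuous_on {0..1} g" "continuous_on {0..1} h" "s \<in> {0..1}"
  shows "cumflux n (\<lambda>s. g s + h s) s = cumflux n g s + cumflux n h s"
proof -
  have "integral {0..s} (flux n (\<lambda>s. g s + h s)) = integral {0..s} (\<lambda>s. flux n g s + flux n h s)"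
    by (rule integral_cong) (use assms flux_add in auto)
  also have "\<dots> = integral {0..s} (flux n g) + integral {0..s} (flux n h)"
    by (intro integral_add flux_integrable_on) (use assms in auto)
  finally show ?thesis by (simp add: cumflux_def add_divide_distrib)
qed

lemma cumflux_sum:
  assumes "finite I" "\<And>i. i \<in> I \<Longrightarrow> continuous_on {0..1} (g i)" "s \<in> {0..1}"
  shows "cumflux n (\<lambda>s. \<Sum>i\<in>I. g i s) s = (\<Sum>i\<in>I. cumflux n (g i) s)"
  using assms(1,2)
proof (induction I)
  case empty
  then show ?case using cumflux_cmult[of n 0 "\<lambda>_. 0" s] by simp
next
  case (insert i I)
  then show ?case
    using cumflux_add[of "g i" "\<lambda>s. \<Sum>i\<in>I. g i s" s n] assms(3) by (simp add: continuous_on_sum)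
qed

lemma cumflux_abs_le_power:
  assumes g: "continuous_on {0..1} g" and n: "n \<ge> 2" and B: "\<And>s. s \<in> {0..1} \<Longrightarrow> \<bar>g s\<bar> \<le> B * s ^ k" and s: "s \<in> {0..1}"
  shows "\<bar>cumflux n g s\<bar> \<le> B * s ^ Suc k / real (Suc k)"
proof -
  have Bnn: "0 \<le> B" using B[of 1] by simp
  have i: "((\<lambda>t. B * t ^ k) has_integral (B * s ^ Suc k / real (Suc k) - B * 0 ^ Suc k / real (Suc k))) {0..s}"
  proof (rule fundamental_theorem_of_calculus)
    show "((\<lambda>t. B * t ^ Suc k / real (Suc k)) has_vector_derivative B * x ^ k) (at x within {0..s})" for x :: real
      unfolding has_real_derivative_iff_has_vector_derivative[symmetric]
      by (auto intro!: derivative_eq_intros simp del: power_Suc)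
  qed (use s in simp)
  have "norm (integral {0..s} (flux n g)) \<le> integral {0..s} (\<lambda>t. B * t ^ k)"
    using s flux_abs_le_power[OF g n B] i
    by (intro integral_norm_bound_integral flux_integrable_on g) auto
  also have "\<dots> = B * s ^ Suc k / real (Suc k)" by (simp only: integral_unique[OF i]) simp
  finally have "norm (integral {0..s} (flux n g)) / 4 \<le> B * s ^ Suc k / real (Suc k) / 4"
    by (rule divide_right_mono) simp
  then have "\<bar>cumflux n g s\<bar> \<le> B * s ^ Suc k / real (Suc k) / 4"
    by (simp only: cumflux_def abs_divide real_norm_def abs_numeral)
  also have "\<dots> \<le> B * s ^ Suc k / real (Suc k) / 1" using s Bnn by (intro divide_left_mono) auto
  finally show ?thesis by simp
qed

text \<open>
  The coefficients of the expansion in powers of \<open>-\<kappa>\<close> of the radial solution of \<open>\<Delta>\<phi> + \<kappa> m \<phi> = 0\<close>, \<open>\<phi>(0) = 1\<close>.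
\<close>
primrec series_term :: "nat \<Rightarrow> (real \<Rightarrow> real) \<Rightarrow> nat \<Rightarrow> real \<Rightarrow> real" where
  "series_term n M 0 = (\<lambda>s. 1)"
| "series_term n M (Suc k) = cumflux n (\<lambda>s. M s * series_term n M k s)"

definition series_sol :: "nat \<Rightarrow> (real \<Rightarrow> real) \<Rightarrow> real \<Rightarrow> real \<Rightarrow> real" where
  "series_sol n M \<kappa> s = (\<Sum>k. (- \<kappa>) ^ k * series_term n M k s)"

context
  fixes n :: nat and M :: "real \<Rightarrow> real"
  assumes n: "n \<ge> 2" and M: "continuous_on {0..1} M"
begin

lemma series_term_continuous: "continuous_on {0..1} (series_term n M k)"
  by (induction k) (auto intro!: cumflux_continuous continuous_intros M)

lemma series_term_bound:
  assumes B: "\<And>s. s \<in> {0..1} \<Longrightarrow> \<bar>M s\<bar> \<le> B"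
  shows "s \<in> {0..1} \<Longrightarrow> \<bar>series_term n M k s\<bar> \<le> B ^ k / fact k * s ^ k"
proof (induction k arbitrary: s)
  case (Suc k)
  have Bnn: "0 \<le> B" using B[of 0] by force
  have "\<bar>cumflux n (\<lambda>s. M s * series_term n M k s) s\<bar> \<le> (B * (B ^ k / fact k)) * s ^ Suc k / real (Suc k)"
  proof (rule cumflux_abs_le_power[OF _ n _ Suc.prems])
    show "continuous_on {0..1} (\<lambda>s. M s * series_term n M k s)"
      by (intro continuous_intros M series_term_continuous)
    show "\<bar>M s * series_term n M k s\<bar> \<le> B * (B ^ k / fact k) * s ^ k" if "s \<in> {0..1}" for s
      unfolding abs_mult mult.assoc using B Suc.IH that Bnn by (intro mult_mono) auto
  qed
  then show ?case by (simp add: field_simps)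
qed simp

lemma series_uniform_limit:
  "uniform_limit ({0..1} \<times> {0..1}) (\<lambda>N (\<kappa>, s). \<Sum>k<N. (- \<kappa>) ^ k * series_term n M k s)
     (\<lambda>(\<kappa>, s). series_sol n M \<kappa> s) sequentially"
proof -
  obtain B where Bnn: "0 \<le> B" and B: "\<And>s. s \<in> {0..1} \<Longrightarrow> \<bar>M s\<bar> \<le> B"
    using continuous_unit_interval_bounded[OF M] by blast
  have "uniform_limit ({0..1} \<times> {0..1}) (\<lambda>N x. \<Sum>k<N. (- fst x) ^ k * series_term n M k (snd x))
     (\<lambda>x. \<Sum>k. (- fst x) ^ k * series_term n M k (snd x)) sequentially"
  proof (rule Weierstrass_m_test)
    show "summable (\<lambda>k. B ^ k / fact k)" using summable_exp[of B] by (simp add: divide_inverse mult.commute)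
    show "norm ((- fst x) ^ k * series_term n M k (snd x)) \<le> B ^ k / fact k"
      if x: "x \<in> {0..1} \<times> {0..1}" for k and x :: "real \<times> real"
    proof -
      have "\<bar>series_term n M k (snd x)\<bar> \<le> B ^ k / fact k * (snd x) ^ k"
        using x by (intro series_term_bound B) auto
      also have "\<dots> \<le> B ^ k / fact k * 1"
        using x Bnn by (intro mult_left_mono power_le_one) auto
      finally have "\<bar>- fst x\<bar> ^ k * \<bar>series_term n M k (snd x)\<bar> \<le> 1 * (B ^ k / fact k)"
        using x by (intro mult_mono power_le_one) auto
      then show ?thesis by (simp add: abs_mult power_abs)
    qed
  qed
  then show ?thesis by (simp add: case_prod_unfold series_sol_def)
qed

text \<open>
  Continuity in both variables together: it is used for the compactness of the set of zeros, from which
  the first \<open>\<kappa>\<close> is taken.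
\<close>
lemma series_sol_continuous: "continuous_on ({0..1} \<times> {0..1}) (\<lambda>(\<kappa>, s). series_sol n M \<kappa> s)"
proof (rule uniform_limit_theorem[OF _ series_uniform_limit])
  show "\<forall>\<^sub>F N in sequentially. continuous_on ({0..1} \<times> {0..1}) (\<lambda>(\<kappa>, s). \<Sum>k<N. (- \<kappa>) ^ k * series_term n M k s)"
    unfolding case_prod_unfold
    by (intro always_eventually allI continuous_intros continuous_on_compose2[OF series_term_continuous]) auto
qed simp

lemma series_sol_continuous1:
  assumes "\<kappa> \<in> {0..1}"
  shows "continuous_on {0..1} (series_sol n M \<kappa>)"
proof -
  have "continuous_on {0..1} (\<lambda>s. (\<lambda>(\<kappa>, s). series_sol n M \<kappa> s) (\<kappa>, s))"
    by (rule continuous_on_compose2[OF series_sol_continuous]) (use assms in \<open>auto intro!: continuous_intros\<close>)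
  then show ?thesis by simp
qed

lemma series_sol_equation:
  assumes \<kappa>: "\<kappa> \<in> {0..1}" and s: "s \<in> {0..1}"
  shows "series_sol n M \<kappa> s = 1 - \<kappa> * cumflux n (\<lambda>s. M s * series_sol n M \<kappa> s) s"
proof -
  define S where "S N s = (\<Sum>k<N. (- \<kappa>) ^ k * series_term n M k s)" for N s
  have cS: "continuous_on {0..1} (S N)" for N
    unfolding S_def by (intro continuous_intros series_term_continuous)
  have c: "continuous_on {0..1} (series_sol n M \<kappa>)" by (rule series_sol_continuous1[OF \<kappa>])
  have lim: "(\<lambda>N. S N s) \<longlonglongrightarrow> series_sol n M \<kappa> s" if "s \<in> {0..1}" for s
    using tendsto_uniform_limitI[OF series_uniform_limit, of "(\<kappa>, s)"] that \<kappa> by (simp add: S_def)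
  have rec: "S (Suc N) s = 1 - \<kappa> * cumflux n (\<lambda>s. M s * S N s) s" for N
  proof -
    have "cumflux n (\<lambda>s. M s * S N s) s = cumflux n (\<lambda>s. \<Sum>k<N. (- \<kappa>) ^ k * (M s * series_term n M k s)) s"
      by (rule arg_cong[where f="\<lambda>g. cumflux n g s"]) (auto simp: S_def sum_distrib_left mult_ac fun_eq_iff)
    also have "\<dots> = (\<Sum>k<N. (- \<kappa>) ^ k * series_term n M (Suc k) s)"
      by (subst cumflux_sum) (use s in \<open>auto intro!: continuous_intros M series_term_continuous simp: cumflux_cmult\<close>)
    finally show ?thesis
      by (simp add: S_def sum.lessThan_Suc_shift sum_distrib_left mult.assoc sum_negf del: sum.lessThan_Suc)
  qed
  obtain B where Bnn: "0 \<le> B" and B: "\<And>s. s \<in> {0..1} \<Longrightarrow> \<bar>M s\<bar> \<le> B"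
    using continuous_unit_interval_bounded[OF M] by blast
  have "(\<lambda>N. cumflux n (\<lambda>s. M s * S N s) s) \<longlonglongrightarrow> cumflux n (\<lambda>s. M s * series_sol n M \<kappa> s) s"
  proof (rule LIMSEQ_I)
    fix e :: real assume e: "e > 0"
    define d where "d = e / (B + 1)"
    have d: "d > 0" "B * d < e" using e Bnn by (auto simp: d_def field_simps)
    have "\<forall>\<^sub>F N in sequentially. \<forall>x\<in>{0..1} \<times> {0..1}.
        dist ((\<lambda>(\<kappa>, s). \<Sum>k<N. (- \<kappa>) ^ k * series_term n M k s) x) ((\<lambda>(\<kappa>, s). series_sol n M \<kappa> s) x) < d"
      by (rule uniform_limitD[OF series_uniform_limit d(1)])
    then obtain N0 where N0: "\<And>N x. N \<ge> N0 \<Longrightarrow> x \<in> {0..1} \<times> {0..1} \<Longrightarrow>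
        dist ((\<lambda>(\<kappa>, s). \<Sum>k<N. (- \<kappa>) ^ k * series_term n M k s) x) ((\<lambda>(\<kappa>, s). series_sol n M \<kappa> s) x) < d"
      unfolding eventually_sequentially by blast
    show "\<exists>N0. \<forall>N\<ge>N0. norm (cumflux n (\<lambda>s. M s * S N s) s - cumflux n (\<lambda>s. M s * series_sol n M \<kappa> s) s) < e"
    proof (intro exI[of _ N0] allI impI)
      fix N assume N: "N \<ge> N0"
      have close: "\<bar>S N t - series_sol n M \<kappa> t\<bar> \<le> d" if "t \<in> {0..1}" for t
        using N0[OF N, of "(\<kappa>, t)"] that \<kappa> by (simp add: S_def dist_real_def)
      have "\<bar>cumflux n (\<lambda>s. M s * (S N s - series_sol n M \<kappa> s)) s\<bar> \<le> B * d * s ^ Suc 0 / real (Suc 0)"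
      proof (rule cumflux_abs_le_power[OF _ n _ s])
        show "continuous_on {0..1} (\<lambda>s. M s * (S N s - series_sol n M \<kappa> s))"
          by (intro continuous_intros M cS c)
        show "\<bar>M t * (S N t - series_sol n M \<kappa> t)\<bar> \<le> B * d * t ^ 0" if "t \<in> {0..1}" for t
          unfolding abs_mult using B[OF that] close[OF that] Bnn by (simp add: mult_mono)
      qed
      also have "\<dots> \<le> B * d * 1" using s Bnn d by (simp add: mult_left_le)
      also have "\<dots> < e" using d by simp
      also have "cumflux n (\<lambda>s. M s * (S N s - series_sol n M \<kappa> s)) s =
          cumflux n (\<lambda>s. M s * S N s + - 1 * (M s * series_sol n M \<kappa> s)) s"
        by (rule arg_cong[where f="\<lambda>g. cumflux n g s"]) (auto simp: algebra_simps)
      also have "\<dots> = cumflux n (\<lambda>s. M s * S N s) s + - 1 * cumflux n (\<lambda>s. M s * series_sol n M \<kappa> s) s"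
        by (subst cumflux_add[OF _ _ s]) (auto intro!: continuous_intros M cS c simp only: cumflux_cmult)
      finally show "norm (cumflux n (\<lambda>s. M s * S N s) s - cumflux n (\<lambda>s. M s * series_sol n M \<kappa> s) s) < e" by simp
    qed
  qed
  then have "(\<lambda>N. 1 - \<kappa> * cumflux n (\<lambda>s. M s * S N s) s) \<longlonglongrightarrow> 1 - \<kappa> * cumflux n (\<lambda>s. M s * series_sol n M \<kappa> s) s"
    by (intro tendsto_intros)
  then have "(\<lambda>N. S (Suc N) s) \<longlonglongrightarrow> 1 - \<kappa> * cumflux n (\<lambda>s. M s * series_sol n M \<kappa> s) s"
    by (simp add: rec)
  moreover have "(\<lambda>N. S (Suc N) s) \<longlonglongrightarrow> series_sol n M \<kappa> s"
    using lim[OF s] by (rule LIMSEQ_Suc)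
  ultimately show ?thesis by (rule LIMSEQ_unique[symmetric])
qed

end

text \<open>The equation \<open>F s = 1 - \<kappa> * cumflux n (M F) s\<close> in the following lemmas is the integrated form of
  \<open>\<Delta>\<phi> + \<kappa> m \<phi> = 0\<close>, \<open>\<phi>(0) = 1\<close> for the radial function \<open>\<phi>(x) = F(|x|\<^sup>2)\<close>, \<open>m(x) = M(|x|\<^sup>2)\<close>.\<close>

lemma radial_solution_derivative:
  assumes M: "continuous_on {0..1} M" and F: "continuous_on {0..1} F"
    and eq: "\<And>s. s \<in> {0..1} \<Longrightarrow> F s = 1 - \<kappa> * cumflux n (\<lambda>s. M s * F s) s" and s: "s \<in> {0..1}"
  shows "(F has_real_derivative - \<kappa> * flux n (\<lambda>s. M s * F s) s / 4) (at s within {0..1})"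
proof -
  have "continuous_on {0..1} (\<lambda>s. M s * F s)" by (intro continuous_intros M F)
  then have "((\<lambda>s. 1 - \<kappa> * cumflux n (\<lambda>s. M s * F s) s) has_real_derivative 0 - \<kappa> * (flux n (\<lambda>s. M s * F s) s / 4)) (at s within {0..1})"
    by (intro DERIV_diff DERIV_const DERIV_cmult cumflux_derivative s)
  then show ?thesis
    by (rule has_field_derivative_transform_within[OF _ zero_less_one s, THEN DERIV_cong]) (use eq in auto)
qed

lemma radial_solution_C1:
  assumes M: "profile_deriv M M'" and F: "continuous_on {0..1} F"
    and eq: "\<And>s. s \<in> {0..1} \<Longrightarrow> F s = 1 - \<kappa> * cumflux n (\<lambda>s. M s * F s) s"
  shows "profile_deriv (\<lambda>s. M s * F s) (\<lambda>s. M' s * F s + (- \<kappa> * flux n (\<lambda>s. M s * F s) s / 4) * M s)"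
proof -
  have cM: "continuous_on {0..1} M" and cM': "continuous_on {0..<1} M'"
    and dM: "\<And>s. s \<in> {0..<1} \<Longrightarrow> (M has_real_derivative M' s) (at s within {0..<1})"
    using M by (auto simp: profile_deriv_def)
  have c: "continuous_on {0..1} (\<lambda>s. M s * F s)" by (intro continuous_intros cM F)
  have sub: "{0..<1} \<subseteq> {0..1::real}" by auto
  show ?thesis unfolding profile_deriv_def
  proof (intro conjI ballI)
    show "continuous_on {0..<1} (\<lambda>s. M' s * F s + - \<kappa> * flux n (\<lambda>s. M s * F s) s / 4 * M s)"
      by (intro continuous_intros cM' continuous_on_subset[OF F sub] continuous_on_subset[OF cM sub]
          continuous_on_subset[OF flux_continuous[OF c] sub]) auto
    show "((\<lambda>s. M s * F s) has_real_derivative M' s * F s + - \<kappa> * flux n (\<lambda>s. M s * F s) s / 4 * M s) (at s within {0..<1})"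
      if s: "s \<in> {0..<1}" for s
    proof (rule DERIV_mult[OF dM[OF s]])
      show "(F has_real_derivative - \<kappa> * flux n (\<lambda>s. M s * F s) s / 4) (at s within {0..<1})"
        using radial_solution_derivative[OF cM F eq, of s] s by (auto intro: DERIV_subset)
    qed
  qed (rule c)
qed

lemma square_mem_unit: 
  fixes r :: real
  shows "r \<in> {0..1} \<Longrightarrow> r\<^sup>2 \<in> {0..1}" "r \<in> {0<..<1} \<Longrightarrow> r\<^sup>2 \<in> {0<..<1}"
  by (auto simp: power_le_one abs_square_less_1)

lemma continuous_on_square_arg:
  fixes g :: "real \<Rightarrow> real"
  assumes "continuous_on {0..1} g"
  shows "continuous_on {0..1} (\<lambda>r. g (r\<^sup>2))"
  by (rule continuous_on_compose2[OF assms]) (use square_mem_unit(1) in \<open>auto intro!: continuous_intros\<close>)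

text \<open>
  The mass of \<open>M F\<close> in a ball around the origin is positive because \<open>F(0) = 1\<close>, so \<open>F\<close> is strictly decreasing.
\<close>
lemma radial_solution_positive:
  assumes n: "n \<ge> 2" and M: "profile_deriv M M'" and Mpos: "\<And>s. s \<in> {0..<1} \<Longrightarrow> M s > 0"
    and \<kappa>: "\<kappa> > 0" and F: "continuous_on {0..1} F"
    and eq: "\<And>s. s \<in> {0..1} \<Longrightarrow> F s = 1 - \<kappa> * cumflux n (\<lambda>s. M s * F s) s"
    and nn: "\<And>s. s \<in> {0..1} \<Longrightarrow> F s \<ge> 0" and s: "s \<in> {0..<1}"
  shows "F s > 0"
proof -
  have cM: "continuous_on {0..1} M" using M by (auto simp: profile_deriv_def)
  have c: "continuous_on {0..1} (\<lambda>s. M s * F s)" by (intro continuous_intros cM F)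
  note C1 = radial_solution_C1[OF M F eq]
  have F0: "F 0 = 1" using eq[of 0] by simp
  obtain \<delta> where \<delta>: "\<delta> > 0" "\<And>s. s \<in> {0..1} \<Longrightarrow> dist s 0 < \<delta> \<Longrightarrow> dist (F s) (F 0) < 1"
    using F[unfolded continuous_on_iff, rule_format, of 0 1] by auto
  define p where "p r = r ^ n * flux n (\<lambda>s. M s * F s) (r\<^sup>2)" for r
  have cp: "continuous_on {0..1} p"
    unfolding p_def by (intro continuous_intros continuous_on_square_arg flux_continuous c)
  have dp: "(p has_real_derivative 2 * r ^ (n - 1) * (M (r\<^sup>2) * F (r\<^sup>2))) (at r)" if "0 < r" "r < 1" for r
    unfolding p_def[abs_def] using n by (intro DERIV_power_flux[OF C1] that) auto
  have ppos: "p r > 0" if r: "0 < r" "r < 1" for r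
  proof -
    define \<rho> where "\<rho> = min r \<delta>"
    have \<rho>: "0 < \<rho>" "\<rho> \<le> r" "\<rho> \<le> \<delta>" "\<rho> < 1" using r \<delta>(1) by (auto simp: \<rho>_def)
    have "p 0 < p \<rho>"
    proof (rule DERIV_pos_imp_increasing_open[OF \<rho>(1)])
      fix x assume x: "0 < x" "x < \<rho>"
      then have x1: "0 < x" "x < 1" using \<rho> by auto
      have "x\<^sup>2 \<le> x * 1" unfolding power2_eq_square using x1 by (intro mult_left_mono) auto
      then have "dist (F (x\<^sup>2)) (F 0) < 1" using x \<rho> x1 square_mem_unit(1)[of x] by (intro \<delta>(2)) auto
      then have "F (x\<^sup>2) > 0" using F0 by (simp add: dist_real_def)
      moreover have "M (x\<^sup>2) > 0" using square_mem_unit(2)[of x] x1 by (intro Mpos) auto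
      ultimately show "\<exists>y. DERIV p x :> y \<and> y > 0"
        using dp[OF x1] x1 by (intro exI[of _ "2 * x ^ (n - 1) * (M (x\<^sup>2) * F (x\<^sup>2))"] conjI) simp_all
    qed (use \<rho> r in \<open>auto intro: continuous_on_subset[OF cp]\<close>)
    moreover have "p \<rho> \<le> p r"
    proof (rule DERIV_nonneg_imp_increasing_open[OF \<rho>(2)])
      fix x assume x: "\<rho> < x" "x < r"
      then have x1: "0 < x" "x < 1" using \<rho> r by auto
      have "F (x\<^sup>2) \<ge> 0" using x1 square_mem_unit(1)[of x] by (intro nn) auto
      moreover have "M (x\<^sup>2) > 0" using square_mem_unit(2)[of x] x1 by (intro Mpos) auto
      ultimately show "\<exists>y. DERIV p x :> y \<and> y \<ge> 0"
        using dp[OF x1] x1 by (intro exI[of _ "2 * x ^ (n - 1) * (M (x\<^sup>2) * F (x\<^sup>2))"] conjI) simp_all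
    qed (use \<rho> r in \<open>auto intro: continuous_on_subset[OF cp]\<close>)
    moreover have "p 0 = 0" using n by (simp add: p_def)
    ultimately show ?thesis by simp
  qed
  have fpos: "flux n (\<lambda>s. M s * F s) t > 0" if t: "0 < t" "t < 1" for t
  proof -
    have "p (sqrt t) > 0" using t by (intro ppos) auto
    then show ?thesis using t by (simp add: p_def zero_less_mult_iff)
  qed
  have "F 1 < F s"
  proof (rule DERIV_neg_imp_decreasing_open[where f=F])
    fix x assume x: "s < x" "x < 1"
    then have x1: "0 < x" "x < 1" using s by auto
    have "(F has_real_derivative - \<kappa> * flux n (\<lambda>s. M s * F s) x / 4) (at x within {0..1})"
      using x1 by (intro radial_solution_derivative[OF cM F eq]) auto
    then have "(F has_real_derivative - \<kappa> * flux n (\<lambda>s. M s * F s) x / 4) (at x)"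
      using at_within_Icc_at[OF x1] by simp
    moreover have "- \<kappa> * flux n (\<lambda>s. M s * F s) x / 4 < 0" using fpos[OF x1] \<kappa> by simp
    ultimately show "\<exists>y. DERIV F x :> y \<and> y < 0" by blast
  qed (use s in \<open>auto intro: continuous_on_subset[OF F]\<close>)
  then show ?thesis using nn[of 1] by simp
qed

text \<open>
  Sturm comparison at \<open>\<kappa> = 1\<close>. Write \<open>V\<close> for the potential of \<open>f\<close>, which solves \<open>\<Delta>V + (M - V) V = 0\<close>. Up to
  the factor \<open>-4\<close>, the function \<open>W\<close> below is the Wronskian \<open>r\<^sup>n (F V' - V F')\<close> at \<open>r\<^sup>2\<close>. Its derivative is
  \<open>- 2 r\<^sup>n\<^sup>-\<^sup>1 F V\<^sup>2 < 0\<close>, whereas \<open>W(0) = 0\<close> and \<open>W(1) \<ge> 0\<close>.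
\<close>
lemma no_positive_radial_solution:
  assumes n: "n \<ge> 2" and M: "profile_deriv M M'" and f: "profile_deriv f f'"
    and V: "\<And>s. s \<in> {0..<1} \<Longrightarrow> potential n f s > 0"
    and fV: "\<And>s. s \<in> {0..1} \<Longrightarrow> f s = potential n f s * (M s - potential n f s)"
    and f1: "flux n f 1 \<ge> 0" and F: "continuous_on {0..1} F"
    and eq: "\<And>s. s \<in> {0..1} \<Longrightarrow> F s = 1 - cumflux n (\<lambda>s. M s * F s) s"
    and Fpos: "\<And>s. s \<in> {0..<1} \<Longrightarrow> F s > 0" and F1: "F 1 \<ge> 0"
  shows False
proof -
  have cM: "continuous_on {0..1} M" and cf: "continuous_on {0..1} f" using M f by (auto simp: profile_deriv_def)
  have c: "continuous_on {0..1} (\<lambda>s. M s * F s)" by (intro continuous_intros cM F)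
  have eq1: "F s = 1 - 1 * cumflux n (\<lambda>s. M s * F s) s" if "s \<in> {0..1}" for s using eq[OF that] by simp
  note C1 = radial_solution_C1[OF M F eq1]
  define V' where "V' = potential n f"
  have cV: "continuous_on {0..1} V'"
    unfolding V'_def by (rule DERIV_continuous_on[OF potential_derivative[OF cf]])
  define W where "W r = F (r\<^sup>2) * (r ^ n * flux n f (r\<^sup>2)) - V' (r\<^sup>2) * (r ^ n * flux n (\<lambda>s. M s * F s) (r\<^sup>2))" for r
  have "W 1 < W 0"
  proof (rule DERIV_neg_imp_decreasing_open[where f=W])
    show "continuous_on {0..1} W"
      unfolding W_def by (intro continuous_intros continuous_on_square_arg flux_continuous c cf F cV)
    fix r :: real assume r: "0 < r" "r < 1"
    have r2: "0 < r\<^sup>2" "r\<^sup>2 < 1" "r\<^sup>2 \<in> {0..1}" "r\<^sup>2 \<in> {0..<1}" using square_mem_unit(2)[of r] r by auto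
    have sq: "((\<lambda>r. r\<^sup>2) has_real_derivative 2 * r) (at r)" by (auto intro!: derivative_eq_intros)
    have dF: "((\<lambda>r. F (r\<^sup>2)) has_real_derivative (- 1 * flux n (\<lambda>s. M s * F s) (r\<^sup>2) / 4) * (2 * r)) (at r)"
      using radial_solution_derivative[OF cM F eq1 r2(3)] at_within_Icc_at[OF r2(1,2)]
      by (intro DERIV_chain2[OF _ sq]) simp
    have dV: "((\<lambda>r. V' (r\<^sup>2)) has_real_derivative (- flux n f (r\<^sup>2) / 4) * (2 * r)) (at r)"
      using potential_derivative[OF cf r2(3), of n] at_within_Icc_at[OF r2(1,2)]
      by (intro DERIV_chain2[OF _ sq]) (simp add: V'_def)
    have n1: "n \<ge> 1" using n by simp
    have "(W has_real_derivative
       ((- 1 * flux n (\<lambda>s. M s * F s) (r\<^sup>2) / 4) * (2 * r) * (r ^ n * flux n f (r\<^sup>2)) + 2 * r ^ (n - 1) * f (r\<^sup>2) * F (r\<^sup>2)) -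
       ((- flux n f (r\<^sup>2) / 4) * (2 * r) * (r ^ n * flux n (\<lambda>s. M s * F s) (r\<^sup>2)) + 2 * r ^ (n - 1) * (M (r\<^sup>2) * F (r\<^sup>2)) * V' (r\<^sup>2))) (at r)"
      unfolding W_def[abs_def]
      by (intro DERIV_diff DERIV_mult dF dV DERIV_power_flux[OF C1 n1 r] DERIV_power_flux[OF f n1 r])
    moreover have "((- 1 * flux n (\<lambda>s. M s * F s) (r\<^sup>2) / 4) * (2 * r) * (r ^ n * flux n f (r\<^sup>2)) + 2 * r ^ (n - 1) * f (r\<^sup>2) * F (r\<^sup>2)) -
       ((- flux n f (r\<^sup>2) / 4) * (2 * r) * (r ^ n * flux n (\<lambda>s. M s * F s) (r\<^sup>2)) + 2 * r ^ (n - 1) * (M (r\<^sup>2) * F (r\<^sup>2)) * V' (r\<^sup>2))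
       = - (2 * r ^ (n - 1) * (F (r\<^sup>2) * (V' (r\<^sup>2) * V' (r\<^sup>2))))"
      unfolding fV[OF r2(3)] V'_def[symmetric] by (simp add: algebra_simps)
    moreover have "0 < 2 * r ^ (n - 1) * (F (r\<^sup>2) * (V' (r\<^sup>2) * V' (r\<^sup>2)))"
      using r Fpos[OF r2(4)] V[OF r2(4)] by (simp add: V'_def)
    ultimately show "\<exists>y. DERIV W r :> y \<and> y < 0" by (intro exI conjI) (assumption, simp)
  qed simp
  moreover have "W 0 = 0" using n by (simp add: W_def)
  moreover have "W 1 \<ge> 0" using F1 f1 by (simp add: W_def V'_def)
  ultimately show False by simp
qed

text \<open>
  Take the least \<open>\<kappa>\<close> in \<open>[0, 1]\<close> for which the solution has a zero in \<open>[0, 1]\<close>. By continuity in \<open>\<kappa>\<close> the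
  solution for this \<open>\<kappa>\<close> is still nonnegative, hence positive before \<open>1\<close>, and its zero is at \<open>1\<close>. The Sturm comparison
  is used twice: a zero exists for \<open>\<kappa> = 1\<close>, and the least \<open>\<kappa>\<close> is not \<open>1\<close>.
\<close>
lemma principal_radial_solution:
  assumes n: "n \<ge> 2" and M: "profile_deriv M M'" and Mpos: "\<And>s. s \<in> {0..<1} \<Longrightarrow> M s > 0" and f: "profile_deriv f f'"
    and V: "\<And>s. s \<in> {0..<1} \<Longrightarrow> potential n f s > 0"
    and fV: "\<And>s. s \<in> {0..1} \<Longrightarrow> f s = potential n f s * (M s - potential n f s)"
    and f1: "flux n f 1 \<ge> 0"
  obtains \<kappa> F where "0 < \<kappa>" "\<kappa> < 1" "continuous_on {0..1} F" "\<And>s. s \<in> {0..<1} \<Longrightarrow> F s > 0" "F 1 = 0"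
    "\<And>s. s \<in> {0..1} \<Longrightarrow> F s = 1 - \<kappa> * cumflux n (\<lambda>s. M s * F s) s"
proof -
  have cM: "continuous_on {0..1} M" using M by (auto simp: profile_deriv_def)
  note cont = series_sol_continuous[OF n cM] and cont1 = series_sol_continuous1[OF n cM] and eq = series_sol_equation[OF n cM]
  define S where "S = series_sol n M"
  have S0: "S \<kappa> 0 = 1" if "\<kappa> \<in> {0..1}" for \<kappa> using eq[OF that, of 0] by (simp add: S_def)
  have S00: "S 0 s = 1" if "s \<in> {0..1}" for s using eq[OF _ that, of 0] by (simp add: S_def)
  have nosol: False if "\<And>s. s \<in> {0..<1} \<Longrightarrow> S 1 s > 0" "S 1 1 \<ge> 0"
    using no_positive_radial_solution[OF n M f V fV f1 cont1[of 1] _ that[unfolded S_def]] eq[of 1] by simp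
  define Z where "Z = {x \<in> {0..1} \<times> {0..1}. (\<lambda>(\<kappa>, s). S \<kappa> s) x = 0}"
  have "compact Z"
  proof -
    have "closed Z"
      unfolding Z_def by (rule continuous_closed_preimage_constant) (use cont in \<open>auto simp: S_def intro: closed_Times\<close>)
    moreover have "Z \<subseteq> {0..1} \<times> {0..1}" by (auto simp: Z_def)
    ultimately show ?thesis using compact_Times[OF compact_Icc compact_Icc]
      by (metis closed_Int_compact compact_Int_closed inf.absorb2)
  qed
  moreover have "Z \<noteq> {}"
  proof
    assume Z: "Z = {}"
    have "S 1 s > 0" if s: "s \<in> {0..1}" for s
    proof (rule ccontr)
      assume "\<not> S 1 s > 0"
      then obtain x where "0 \<le> x" "x \<le> s" "S 1 x = 0"
        using IVT2'[of "S 1" s 0 0] S0[of 1] s continuous_on_subset[OF cont1[of 1], of "{0..s}"] by (force simp: S_def)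
      then have "(1, x) \<in> Z" using s by (auto simp: Z_def)
      then show False using Z by simp
    qed
    then show False using nosol by (simp add: less_imp_le)
  qed
  ultimately have "\<exists>z\<in>Z. \<forall>y\<in>Z. fst z \<le> fst y"
    by (rule continuous_attains_inf) (intro continuous_intros)
  then obtain z where z: "z \<in> Z" "\<And>y. y \<in> Z \<Longrightarrow> fst z \<le> fst y" by blast
  define \<kappa> where "\<kappa> = fst z"
  have zs: "\<kappa> \<in> {0..1}" "snd z \<in> {0..1}" "S \<kappa> (snd z) = 0" using z(1) by (auto simp: Z_def \<kappa>_def)
  have \<kappa>0: "\<kappa> > 0"
    using zs S00[of "snd z"] by (cases "\<kappa> = 0") auto
  have nn: "S \<kappa> s \<ge> 0" if s: "s \<in> {0..1}" for s
  proof (rule ccontr)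
    assume neg: "\<not> S \<kappa> s \<ge> 0"
    have "continuous_on {0..\<kappa>} (\<lambda>k. (\<lambda>(\<kappa>, s). S \<kappa> s) (k, s))"
      by (rule continuous_on_compose2[OF cont[folded S_def]]) (use zs s in \<open>auto intro!: continuous_intros\<close>)
    then obtain k where k: "0 \<le> k" "k \<le> \<kappa>" "S k s = 0"
      using IVT2'[of "\<lambda>k. S k s" \<kappa> 0 0] neg S00[OF s] \<kappa>0 by force
    then have "(k, s) \<in> Z" using s zs by (auto simp: Z_def)
    then have "\<kappa> \<le> k" using z(2) by (force simp: \<kappa>_def)
    then show False using k neg by simp
  qed
  have eq': "S \<kappa> s = 1 - \<kappa> * cumflux n (\<lambda>s. M s * S \<kappa> s) s" if "s \<in> {0..1}" for s
    using eq[OF zs(1) that] by (simp add: S_def)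
  have c: "continuous_on {0..1} (S \<kappa>)" using cont1[OF zs(1)] by (simp add: S_def)
  have pos: "S \<kappa> s > 0" if "s \<in> {0..<1}" for s
    by (rule radial_solution_positive[OF n M Mpos \<kappa>0 c eq' nn that])
  have "snd z = 1" using pos[of "snd z"] zs by force
  then have S1: "S \<kappa> 1 = 0" using zs by simp
  have "\<kappa> \<noteq> 1" using nosol pos S1 by auto
  then have "\<kappa> < 1" using zs by simp
  show ?thesis by (rule that[OF \<kappa>0 \<open>\<kappa> < 1\<close> c pos S1 eq'])
qed

section \<open>A radial solution with a small resource\<close>

definition C1_profile :: "(real \<Rightarrow> real) \<Rightarrow> bool" where
  "C1_profile f \<longleftrightarrow> (\<exists>f'. profile_deriv f f')"

lemma C1_profile_continuous: "C1_profile f \<Longrightarrow> continuous_on {0..1} f"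
  by (auto simp: C1_profile_def profile_deriv_def)

lemma C1_profile_mult:
  assumes "C1_profile f" "C1_profile g"
  shows "C1_profile (\<lambda>s. f s * g s)"
proof -
  obtain f' g' where f: "continuous_on {0..1} f" "continuous_on {0..<1} f'" "\<And>s. s \<in> {0..<1} \<Longrightarrow> (f has_real_derivative f' s) (at s within {0..<1})"
    and g: "continuous_on {0..1} g" "continuous_on {0..<1} g'" "\<And>s. s \<in> {0..<1} \<Longrightarrow> (g has_real_derivative g' s) (at s within {0..<1})"
    using assms by (auto simp: C1_profile_def profile_deriv_def)
  have sub: "{0..<1} \<subseteq> {0..1::real}" by auto
  have "profile_deriv (\<lambda>s. f s * g s) (\<lambda>s. f' s * g s + g' s * f s)"
    unfolding profile_deriv_def using f g
    by (auto intro!: continuous_intros DERIV_mult intro: continuous_on_subset[OF _ sub])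
  then show ?thesis by (auto simp: C1_profile_def)
qed

lemma C1_profile_const: "C1_profile (\<lambda>s. c)"
  unfolding C1_profile_def profile_deriv_def by (intro exI[of _ "\<lambda>_. 0"]) auto

lemma C1_profile_cmult: "C1_profile f \<Longrightarrow> C1_profile (\<lambda>s. c * f s)"
  by (rule C1_profile_mult[OF C1_profile_const])

lemma C1_profile_add:
  assumes "C1_profile f" "C1_profile g"
  shows "C1_profile (\<lambda>s. f s + g s)"
proof -
  obtain f' g' where "profile_deriv f f'" "profile_deriv g g'" using assms by (auto simp: C1_profile_def)
  then have "profile_deriv (\<lambda>s. f s + g s) (\<lambda>s. f' s + g' s)"
    unfolding profile_deriv_def by (auto intro!: continuous_intros DERIV_add)
  then show ?thesis by (auto simp: C1_profile_def)
qed

lemma C1_profile_power: "C1_profile f \<Longrightarrow> C1_profile (\<lambda>s. f s ^ k)"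
  by (induction k) (auto intro!: C1_profile_const C1_profile_mult)

lemma C1_profile_potential:
  assumes "continuous_on {0..1} f"
  shows "C1_profile (potential n f)"
  unfolding C1_profile_def profile_deriv_def
proof (intro exI[of _ "\<lambda>s. - flux n f s / 4"] conjI ballI)
  show "continuous_on {0..1} (potential n f)"
    by (rule DERIV_continuous_on[OF potential_derivative[OF assms]])
  show "continuous_on {0..<1} (\<lambda>s. - flux n f s / 4)"
    by (intro continuous_intros continuous_on_subset[OF flux_continuous[OF assms]]) auto
  show "(potential n f has_real_derivative - flux n f s / 4) (at s within {0..<1})" if "s \<in> {0..<1}" for s
    using potential_derivative[OF assms, of s n] that by (auto intro: DERIV_subset)
qed

lemma DERIV_max0_square: "((\<lambda>y. (max 0 y)\<^sup>2) has_real_derivative 2 * max 0 y) (at (y::real))"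
proof -
  consider "y > 0" | "y < 0" | "y = 0" by linarith
  then show ?thesis
  proof cases
    case 1
    have "((\<lambda>y. y\<^sup>2) has_real_derivative 2 * max 0 y) (at y)"
      using 1 by (auto intro!: derivative_eq_intros)
    then show ?thesis
      by (rule has_field_derivative_transform_within_open[where S="{0<..}"]) (use 1 in auto)
  next
    case 2
    have "((\<lambda>y. 0) has_real_derivative 2 * max 0 y) (at y)" using 2 by simp
    then show ?thesis
      by (rule has_field_derivative_transform_within_open[where S="{..<0}"]) (use 2 in auto)
  next
    case 3
    have "((\<lambda>h. ((max 0 (0 + h))\<^sup>2 - (max 0 0)\<^sup>2) / h) \<longlongrightarrow> 0) (at (0::real))"
    proof (rule Lim_null_comparison)
      show "\<forall>\<^sub>F h in at 0. norm (((max 0 (0 + h))\<^sup>2 - (max 0 0)\<^sup>2) / h) \<le> \<bar>h::real\<bar>"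
        by (rule always_eventually) (auto simp: max_def power2_eq_square)
      show "((\<lambda>h::real. \<bar>h\<bar>) \<longlongrightarrow> 0) (at 0)" by (rule tendsto_rabs_zero) (rule tendsto_ident_at)
    qed
    then show ?thesis using 3 by (simp add: DERIV_def)
  qed
qed

text \<open>
  A function of \<open>s = |x|\<^sup>2\<close> that is supported in \<open>|x| \<le> e\<close> and has the same mass for all \<open>e\<close>. The square makes it
  continuously differentiable.
\<close>
definition bump :: "nat \<Rightarrow> real \<Rightarrow> real \<Rightarrow> real" where
  "bump n e s = (max 0 (1 - s / e\<^sup>2))\<^sup>2 / e ^ n"

text \<open>
  The value of \<open>r\<^sup>n flux n (bump n e) (r\<^sup>2)\<close> for every \<open>r \<ge> e\<close>: it is \<open>2/n - 4/(n+2) + 2/(n+4)\<close>.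
\<close>
definition bump_mass :: "nat \<Rightarrow> real" where
  "bump_mass n = 16 / (real n * (real n + 2) * (real n + 4))"

lemma bump_mass_pos: "n \<ge> 1 \<Longrightarrow> bump_mass n > 0"
  by (simp add: bump_mass_def)

lemma C1_profile_bump:
  assumes "e > 0"
  shows "C1_profile (bump n e)"
proof -
  have "profile_deriv (bump n e) (\<lambda>s. 2 * max 0 (1 - s / e\<^sup>2) * (- 1 / e\<^sup>2) / e ^ n)"
    unfolding profile_deriv_def
  proof (intro conjI ballI)
    have d: "(bump n e has_real_derivative 2 * max 0 (1 - s / e\<^sup>2) * (- 1 / e\<^sup>2) / e ^ n) (at s)" for s
      unfolding bump_def[abs_def]
    proof (intro DERIV_cdivide DERIV_chain2[OF DERIV_max0_square])
      have "((\<lambda>s. 1 - s / e\<^sup>2) has_real_derivative 0 - 1 / e\<^sup>2) (at s)"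
        by (intro DERIV_diff DERIV_const DERIV_cdivide DERIV_ident)
      then show "((\<lambda>s. 1 - s / e\<^sup>2) has_real_derivative - 1 / e\<^sup>2) (at s)" by simp
    qed
    show "(bump n e has_real_derivative 2 * max 0 (1 - s / e\<^sup>2) * (- 1 / e\<^sup>2) / e ^ n) (at s within {0..<1})" for s
      by (rule has_field_derivative_at_within[OF d])
    show "continuous_on {0..1} (bump n e)"
      by (rule continuous_at_imp_continuous_on) (use d DERIV_isCont in blast)
  qed (use assms in \<open>auto intro!: continuous_intros\<close>)
  then show ?thesis by (auto simp: C1_profile_def)
qed

context
  fixes n :: nat and e :: real
  assumes n: "n \<ge> 2" and e: "0 < e" "e < 1"
begin

abbreviation "\<rho> \<equiv> bump n e"
abbreviation "\<gamma> \<equiv> bump_mass n"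
abbreviation "G \<equiv> potential n (bump n e)"

lemma bump_nonneg: "0 \<le> \<rho> s" using e by (simp add: bump_def)

lemma bump_le: "0 \<le> s \<Longrightarrow> \<rho> s \<le> 1 / e ^ n"
  unfolding bump_def using e by (intro divide_right_mono) (auto simp: power_le_one_iff max_def)

lemma bump_outside: "e\<^sup>2 \<le> s \<Longrightarrow> \<rho> s = 0"
  using e by (simp add: bump_def field_simps)

lemma bump_continuous: "continuous_on {0..1} \<rho>"
  by (rule C1_profile_continuous[OF C1_profile_bump[OF e(1)]])

lemma flux_bump_core: "e ^ n * flux n \<rho> (e\<^sup>2) = \<gamma>"
proof -
  have c: "continuous_on {0..1} (\<lambda>s. 1 + (- 2 * s ^ 1 + s ^ 2) :: real)" "continuous_on {0..1} (\<lambda>s. - 2 * s ^ 1 :: real)"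
    "continuous_on {0..1} (\<lambda>s. s ^ 2 :: real)" "continuous_on {0..1} (\<lambda>s. - 2 * s ^ 1 + s ^ 2 :: real)" "continuous_on {0..1} (\<lambda>s. 1 :: real)"
    by (intro continuous_intros)+
  have "e ^ n * flux n \<rho> (e\<^sup>2) = flux n (\<lambda>s. 1 + (- 2 * s ^ 1 + s ^ 2)) 1"
  proof -
    have "integral {0..1} (\<lambda>t. t ^ (n - 1) * \<rho> (e\<^sup>2 * t\<^sup>2)) = integral {0..1} (\<lambda>t. t ^ (n - 1) * (1 + (- 2 * (1 * t\<^sup>2) ^ 1 + (1 * t\<^sup>2) ^ 2)) / e ^ n)"
    proof (rule integral_cong)
      fix t :: real assume "t \<in> {0..1}"
      then have "t\<^sup>2 \<le> 1" by (simp add: power_le_one)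
      then show "t ^ (n - 1) * \<rho> (e\<^sup>2 * t\<^sup>2) = t ^ (n - 1) * (1 + (- 2 * (1 * t\<^sup>2) ^ 1 + (1 * t\<^sup>2) ^ 2)) / e ^ n"
        using e by (simp add: bump_def power2_diff)
    qed
    then show ?thesis using e by (simp add: flux_def)
  qed
  also have "\<dots> = flux n (\<lambda>s. s ^ 0) 1 + (- 2 * flux n (\<lambda>s. s ^ 1) 1 + flux n (\<lambda>s. s ^ 2) 1)"
    using flux_add[OF c(5,4), of 1 n] flux_add[OF c(2,3), of 1 n] flux_cmult[of n "-2" "\<lambda>s. s ^ 1" 1] by simp
  also have "\<dots> = 2 / real n + (- 2 * (2 / (real n + 2)) + 2 / (real n + 4))"
    using n by (simp only: flux_power) simp
  also have "\<dots> = \<gamma>" using n unfolding bump_mass_def by (simp add: divide_simps) (simp add: algebra_simps)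
  finally show ?thesis .
qed

text \<open>
  The mass of the bump in the ball of radius \<open>r\<close> increases up to \<open>r = e\<close> and is constant from there on.
\<close>
lemma power_flux_bump:
  assumes r: "0 \<le> r" "r \<le> 1"
  shows "r ^ n * flux n \<rho> (r\<^sup>2) \<le> \<gamma>" and "e \<le> r \<Longrightarrow> r ^ n * flux n \<rho> (r\<^sup>2) = \<gamma>"
proof -
  obtain \<rho>' where C1: "profile_deriv \<rho> \<rho>'" using C1_profile_bump[OF e(1)] by (auto simp: C1_profile_def)
  define p where "p r = r ^ n * flux n \<rho> (r\<^sup>2)" for r
  have cp: "continuous_on {0..1} p"
    unfolding p_def by (intro continuous_intros continuous_on_square_arg flux_continuous bump_continuous)
  have dp: "(p has_real_derivative 2 * r ^ (n - 1) * \<rho> (r\<^sup>2)) (at r)" if "0 < r" "r < 1" for r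
    unfolding p_def[abs_def] using n by (intro DERIV_power_flux[OF C1] that) auto
  have pe: "p e = \<gamma>" using flux_bump_core by (simp add: p_def)
  show A: "r ^ n * flux n \<rho> (r\<^sup>2) = \<gamma>" if er: "e \<le> r"
  proof -
    have D0: "(p has_real_derivative 0) (at x)" if "e < x" "x < r" for x
    proof -
      have "e\<^sup>2 \<le> x\<^sup>2" using that e by (intro power_mono) auto
      then show ?thesis using dp[of x] that e r bump_outside[of "x\<^sup>2"] by simp
    qed
    have "p e \<le> p r"
      by (rule DERIV_nonneg_imp_increasing_open[where f=p, OF er]) (use D0 r e in \<open>auto intro: continuous_on_subset[OF cp]\<close>)
    moreover have "p r \<le> p e"
      by (rule DERIV_nonpos_imp_decreasing_open[where f=p, OF er]) (use D0 r e in \<open>auto intro: continuous_on_subset[OF cp]\<close>)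
    ultimately show ?thesis using pe by (simp add: p_def)
  qed
  show "r ^ n * flux n \<rho> (r\<^sup>2) \<le> \<gamma>"
  proof (cases "e \<le> r")
    case False
    have "p r \<le> p e"
    proof (rule DERIV_nonneg_imp_increasing_open[where f=p])
      show "\<exists>y. DERIV p x :> y \<and> y \<ge> 0" if "r < x" "x < e" for x
        using dp[of x] that r e bump_nonneg[of "x\<^sup>2"] by (intro exI[of _ "2 * x ^ (n - 1) * \<rho> (x\<^sup>2)"]) auto
    qed (use False r e in \<open>auto intro: continuous_on_subset[OF cp]\<close>)
    then show ?thesis using pe by (simp add: p_def)
  qed (use A in simp)
qed

text \<open>
  Outside the core the flux is \<open>\<gamma> / r\<^sup>n\<close>; inside it is even larger, because the bump decreases with \<open>s\<close>.
\<close>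
lemma flux_bump_ge:
  assumes s: "s \<in> {0..1}"
  shows "flux n \<rho> s \<ge> \<gamma>"
proof -
  have key: "flux n \<rho> (r\<^sup>2) \<ge> \<gamma>" if "e \<le> r" "r \<le> 1" for r
  proof -
    have r: "0 < r" using that e by linarith
    have "r ^ n * \<gamma> \<le> 1 * \<gamma>"
      using r that n bump_mass_pos[of n] by (intro mult_right_mono power_le_one) auto
    also have "\<dots> = r ^ n * flux n \<rho> (r\<^sup>2)" using power_flux_bump(2)[of r] that r by simp
    finally show ?thesis using r by simp
  qed
  show ?thesis
  proof (cases "e\<^sup>2 \<le> s")
    case True
    then have "e \<le> sqrt s" by (rule real_le_rsqrt)
    then show ?thesis using key[of "sqrt s"] s by simp
  next
    case False
    have e2: "e\<^sup>2 \<in> {0..1}" using e by (simp add: power_le_one)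
    have "integral {0..1} (\<lambda>t. t ^ (n - 1) * \<rho> (e\<^sup>2 * t\<^sup>2)) \<le> integral {0..1} (\<lambda>t. t ^ (n - 1) * \<rho> (s * t\<^sup>2))"
    proof (rule integral_le[OF flux_integrable[OF bump_continuous e2] flux_integrable[OF bump_continuous s]])
      fix t :: real assume t: "t \<in> {0..1}"
      have "\<rho> (e\<^sup>2 * t\<^sup>2) \<le> \<rho> (s * t\<^sup>2)"
      proof -
        have "s * t\<^sup>2 \<le> e\<^sup>2 * t\<^sup>2" using False by (intro mult_right_mono) auto
        then have "s * t\<^sup>2 / e\<^sup>2 \<le> e\<^sup>2 * t\<^sup>2 / e\<^sup>2" by (rule divide_right_mono) simp
        then show ?thesis unfolding bump_def using e by (intro divide_right_mono power_mono) auto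
      qed
      then show "t ^ (n - 1) * \<rho> (e\<^sup>2 * t\<^sup>2) \<le> t ^ (n - 1) * \<rho> (s * t\<^sup>2)"
        using t by (intro mult_left_mono) auto
    qed
    then have "flux n \<rho> (e\<^sup>2) \<le> flux n \<rho> s" by (simp add: flux_def)
    then show ?thesis using key[of e] e by simp
  qed
qed

lemma bump_potential_ge:
  assumes s: "s \<in> {0..1}"
  shows "G s \<ge> \<gamma> / 4 * (1 - s)"
proof -
  have "flux n (\<lambda>s. real n * \<gamma> / 2 * s ^ 0) t = \<gamma>" for t
    using n unfolding flux_cmult by (simp only: flux_power) simp
  then have fc: "flux n (\<lambda>s. real n * \<gamma> / 2 * s ^ 0) = (\<lambda>t. \<gamma>)" by auto
  have "potential n (\<lambda>s. real n * \<gamma> / 2 * s ^ 0) s \<le> G s"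
  proof (rule potential_mono[OF _ bump_continuous _ s])
    show "continuous_on {0..1} (\<lambda>s::real. real n * \<gamma> / 2 * s ^ 0)" by (intro continuous_intros)
    show "flux n (\<lambda>s. real n * \<gamma> / 2 * s ^ 0) t \<le> flux n \<rho> t" if "t \<in> {0..1}" for t
      unfolding fc using flux_bump_ge[OF that] .
  qed
  then show ?thesis using s by (simp only: potential_def fc) (simp add: mult.commute)
qed

lemma bump_potential_pos:
  assumes "s \<in> {0..<1}"
  shows "G s > 0"
proof -
  have "0 < \<gamma> / 4 * (1 - s)" using assms bump_mass_pos[of n] n by simp
  also have "\<dots> \<le> G s" using assms by (intro bump_potential_ge) auto
  finally show ?thesis .
qed

lemma bump_potential_nonneg: "s \<in> {0..1} \<Longrightarrow> G s \<ge> 0"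
  using bump_potential_pos[of s] by (cases "s = 1") auto

text \<open>
  A crude bound for \<open>G\<close>, uniform in \<open>e\<close>: the true order is \<open>r\<^sup>2\<^sup>-\<^sup>n\<close>, or a logarithm if \<open>n = 2\<close>.
\<close>
lemma bump_potential_le:
  assumes r: "0 < r" "r \<le> 1"
  shows "r ^ n * G (r\<^sup>2) \<le> \<gamma> / 4"
proof -
  have r2: "r\<^sup>2 \<in> {0..1}" "0 < r\<^sup>2" using r by (auto simp: power_le_one)
  have "integral {r\<^sup>2..1} (flux n \<rho>) \<le> integral {r\<^sup>2..1} (\<lambda>_. \<gamma> / r ^ n)"
  proof (intro integral_le flux_integrable_on bump_continuous)
    fix t assume t: "t \<in> {r\<^sup>2..1}"
    have t0: "t \<in> {0..1}" using t r2 unfolding atLeastAtMost_iff by linarith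
    define q where "q = sqrt t"
    have "q\<^sup>2 = t" using t0 by (simp add: q_def)
    moreover have "r \<le> q" using t by (simp add: q_def real_le_rsqrt)
    moreover have "q \<le> 1" using t by (simp add: q_def)
    ultimately have q: "r \<le> q" "q \<le> 1" "q\<^sup>2 = t" by auto
    have "r ^ n * flux n \<rho> t \<le> q ^ n * flux n \<rho> t"
      using q r flux_bump_ge[OF t0] bump_mass_pos[of n] n by (intro mult_right_mono power_mono) auto
    also have "\<dots> \<le> \<gamma>" using power_flux_bump(1)[of q] q r by simp
    finally show "flux n \<rho> t \<le> \<gamma> / r ^ n" using r by (simp add: field_simps)
  qed (use r2 in auto)
  also have "\<dots> = (1 - r\<^sup>2) * (\<gamma> / r ^ n)" using r2 by simp
  also have "\<dots> \<le> 1 * (\<gamma> / r ^ n)" using r bump_mass_pos[of n] n by (intro mult_right_mono) auto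
  finally show ?thesis using r by (simp add: potential_def field_simps)
qed

lemma bump_potential_square_le:
  assumes s: "s \<in> {0..1}"
  shows "(G s)\<^sup>2 * s ^ n \<le> \<gamma>\<^sup>2 / 16"
proof (cases "s = 0")
  case True
  then show ?thesis using n by (simp add: zero_power)
next
  case False
  define r where "r = sqrt s"
  have r: "0 < r" "r \<le> 1" "r\<^sup>2 = s" using s False by (auto simp: r_def)
  have "(r ^ n * G (r\<^sup>2))\<^sup>2 \<le> (\<gamma> / 4)\<^sup>2"
    using bump_potential_le[OF r(1,2)] r bump_potential_nonneg[OF s] by (intro power_mono) auto
  moreover have "(r ^ n)\<^sup>2 = s ^ n" unfolding r(3)[symmetric] by (simp add: power_mult[symmetric] mult.commute)
  ultimately show ?thesis by (simp add: power_mult_distrib r(3) power_divide mult.commute)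
qed

lemma bump_potential_radial_derivative:
  assumes "0 < r" "r < 1"
  shows "((\<lambda>r. G (r\<^sup>2)) has_real_derivative - (r * flux n \<rho> (r\<^sup>2) / 2)) (at r)"
proof -
  have r2: "0 < r\<^sup>2" "r\<^sup>2 < 1" using square_mem_unit(2)[of r] assms by auto
  have "(G has_real_derivative - flux n \<rho> (r\<^sup>2) / 4) (at (r\<^sup>2))"
    using potential_derivative[OF bump_continuous, of "r\<^sup>2"] r2 at_within_Icc_at[OF r2] by simp
  then have "((\<lambda>r. G (r\<^sup>2)) has_real_derivative - flux n \<rho> (r\<^sup>2) / 4 * (2 * r)) (at r)"
    by (rule DERIV_chain2) (auto intro!: derivative_eq_intros)
  then show ?thesis by (simp add: mult.commute)
qed

lemma bump_potential_continuous: "continuous_on {0..1} G"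
  by (rule DERIV_continuous_on[OF potential_derivative[OF bump_continuous]])

text \<open>
  Outside the core \<open>G' = - \<gamma> r\<^sup>1\<^sup>-\<^sup>n / 2 \<le> - \<gamma> / (2 r)\<close> as a function of \<open>r\<close>, by \<open>n \<ge> 2\<close>.
\<close>
lemma bump_potential_core_ge: "G (e\<^sup>2) \<ge> \<gamma> / 2 * - ln e"
proof -
  define h where "h r = G (r\<^sup>2) + \<gamma> / 2 * ln r" for r
  have "h 1 \<le> h e"
  proof (rule DERIV_nonpos_imp_decreasing_open[where f=h])
    show "\<exists>y. DERIV h r :> y \<and> y \<le> 0" if er: "e < r" "r < 1" for r
    proof (intro exI conjI)
      have r: "0 < r" using er e by linarith
      show "DERIV h r :> - (r * flux n \<rho> (r\<^sup>2) / 2) + \<gamma> / 2 * (1 / r)"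
        unfolding h_def[abs_def] using r er
        by (intro DERIV_add bump_potential_radial_derivative DERIV_cmult) (auto intro!: derivative_eq_intros)
      have "\<gamma> = r ^ n * flux n \<rho> (r\<^sup>2)" using power_flux_bump(2)[of r] er r by simp
      also have "\<dots> \<le> r ^ 2 * flux n \<rho> (r\<^sup>2)"
        using r er n flux_bump_ge[of "r\<^sup>2"] bump_mass_pos[of n] by (intro mult_right_mono power_decreasing) (auto simp: power_le_one)
      finally have "\<gamma> / r \<le> r * flux n \<rho> (r\<^sup>2)" using r by (simp add: power2_eq_square field_simps)
      then show "- (r * flux n \<rho> (r\<^sup>2) / 2) + \<gamma> / 2 * (1 / r) \<le> 0" by simp
    qed
    show "continuous_on {e..1} h"
      unfolding h_def using e
      by (intro continuous_intros continuous_on_subset[OF continuous_on_square_arg[OF bump_potential_continuous]]) auto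
  qed (use e in auto)
  then show ?thesis by (simp add: h_def)
qed

lemma bump_potential_antimono:
  assumes "0 \<le> s" "s \<le> t" "t \<le> 1"
  shows "G t \<le> G s"
proof (rule DERIV_nonpos_imp_decreasing_open[where f=G, OF assms(2)])
  fix x assume x: "s < x" "x < t"
  then have x1: "0 < x" "x < 1" using assms by auto
  have "(G has_real_derivative - flux n \<rho> x / 4) (at x)"
    using potential_derivative[OF bump_continuous, of x] x1 at_within_Icc_at[OF x1] by simp
  moreover have "flux n \<rho> x \<ge> 0" using flux_bump_ge[of x] x1 bump_mass_pos[of n] n by simp
  ultimately show "\<exists>y. DERIV G x :> y \<and> y \<le> 0" by (intro exI[of _ "- flux n \<rho> x / 4"]) auto
qed (use assms in \<open>auto intro: continuous_on_subset[OF bump_potential_continuous]\<close>)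

lemma bump_over_potential:
  assumes s: "s \<in> {0..<1}"
  shows "\<rho> s / G s \<le> (if s \<le> e\<^sup>2 then 2 / (e ^ n * \<gamma> * - ln e) else 0)"
proof (cases "s \<le> e\<^sup>2")
  case True
  have g: "\<gamma> / 2 * - ln e > 0" using e n bump_mass_pos[of n] by (simp add: mult_pos_neg)
  have "\<gamma> / 2 * - ln e \<le> G s"
    using bump_potential_core_ge bump_potential_antimono[of s "e\<^sup>2"] True s e by (simp add: power_le_one)
  then have "\<rho> s / G s \<le> (1 / e ^ n) / (\<gamma> / 2 * - ln e)"
    using g e s by (intro frac_le bump_le) auto
  then show ?thesis using True by (simp add: field_simps)
next
  case False
  then show ?thesis using bump_outside[of s] by simp
qed

text \<open>
  The potential \<open>V\<close> of \<open>f = c \<rho> - \<theta> c\<^sup>2 Q\<close> with \<open>Q = G\<^sup>2 X\<close>, \<open>X = (s / (s + \<tau>))\<^sup>n\<close>, is a perturbation of \<open>c G\<close>.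
  The power \<open>n\<close> in the cutoff \<open>X\<close> balances the bound \<open>r\<^sup>n G \<le> \<gamma> / 4\<close>, which makes \<open>Q \<le> B = \<gamma>\<^sup>2 / (16 \<tau>\<^sup>n)\<close> uniformly
  in \<open>e\<close>. Since the flux of \<open>\<rho>\<close> is at least \<open>\<gamma>\<close>, the choice \<open>c = \<delta> \<gamma> / B\<close> makes the correction at most \<open>\<delta>\<close> times the
  main term, already for the fluxes. For the resource \<open>M = V + f / V\<close> one has \<open>V M = V\<^sup>2 + c \<rho> - \<theta> c\<^sup>2 G\<^sup>2 X\<close>. It is
  positive by \<open>\<theta> c\<^sup>2 G\<^sup>2 \<le> V\<^sup>2\<close> and \<open>X < 1\<close>, and the upper bound follows from \<open>c\<^sup>2 G\<^sup>2 \<ge> V\<^sup>2\<close>.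
\<close>
lemma logistic_profile:
  fixes \<tau> \<delta> :: real
  assumes \<tau>: "\<tau> > 0" and \<delta>: "0 < \<delta>" "\<delta> \<le> 1 / 2"
  defines "c \<equiv> 16 * \<delta> * \<tau> ^ n / \<gamma>"
  obtains f M where "C1_profile f" "C1_profile M"
    "\<And>s. s \<in> {0..<1} \<Longrightarrow> M s > 0"
    "\<And>s. s \<in> {0..1} \<Longrightarrow> f s = potential n f s * (M s - potential n f s)"
    "flux n f 1 \<ge> 0" "\<And>s. s \<in> {0..<1} \<Longrightarrow> potential n f s > 0"
    "\<And>s. s \<in> {0..1} \<Longrightarrow> (1 - \<delta>) * c * G s \<le> potential n f s"
    "\<And>s. s \<in> {0..1} \<Longrightarrow> potential n f s \<le> c * G s"
    "\<And>s. s \<in> {0..<1} \<Longrightarrow> M s \<le> 2 * \<delta> * potential n f s + c * (G s * (1 - (s / (s + \<tau>)) ^ n)) + \<rho> s / G s / (1 - \<delta>)"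
proof -
  define X where "X s = (s / (s + \<tau>)) ^ n" for s
  define Q where "Q s = G s * G s * X s" for s
  define \<theta> where "\<theta> = (1 - \<delta>)\<^sup>2"
  define f where "f s = c * \<rho> s + (- (\<theta> * c\<^sup>2)) * Q s" for s
  define V where "V = potential n f"
  define M where "M s = V s + f s / V s" for s
  define B where "B = \<gamma>\<^sup>2 / (16 * \<tau> ^ n)"
  have \<gamma>: "\<gamma> > 0" using bump_mass_pos[of n] n by simp
  have c: "c > 0" using \<gamma> \<tau> \<delta> by (simp add: c_def)
  have cB: "c * B = \<delta> * \<gamma>" using \<gamma> \<tau> by (simp add: c_def B_def power2_eq_square)
  have \<theta>: "0 < \<theta>" "\<theta> \<le> 1" using \<delta> by (auto simp: \<theta>_def power_le_one)
  have X: "0 \<le> X s" "X s < 1" if "s \<in> {0..1}" for s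
  proof -
    have "0 \<le> s / (s + \<tau>)" "s / (s + \<tau>) < 1" using that \<tau> by auto
    then show "0 \<le> X s" "X s < 1"
      using n by (auto simp: X_def power_less_one_iff)
  qed
  have "C1_profile (\<lambda>s. s / (s + \<tau>))"
  proof -
    have "profile_deriv (\<lambda>s. s / (s + \<tau>)) (\<lambda>s. \<tau> / (s + \<tau>)\<^sup>2)"
      unfolding profile_deriv_def using \<tau>
      by (auto intro!: continuous_intros derivative_eq_intros simp: power2_eq_square)
    then show ?thesis by (auto simp: C1_profile_def)
  qed
  then have "C1_profile X" unfolding X_def[abs_def] by (rule C1_profile_power)
  then have C1Q: "C1_profile Q"
    unfolding Q_def[abs_def] by (intro C1_profile_mult C1_profile_potential[OF bump_continuous])
  have C1f: "C1_profile f"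
    unfolding f_def[abs_def] by (intro C1_profile_add C1_profile_cmult C1_profile_bump e C1Q)
  note cQ = C1_profile_continuous[OF C1Q] and cf = C1_profile_continuous[OF C1f]
  have Q: "0 \<le> Q s" "Q s \<le> B" if s: "s \<in> {0..1}" for s
  proof -
    show "0 \<le> Q s" using bump_potential_nonneg[OF s] X[OF s] by (simp add: Q_def)
    have "Q s = ((G s)\<^sup>2 * s ^ n) / (s + \<tau>) ^ n" by (simp add: Q_def X_def power2_eq_square power_divide)
    also have "\<dots> \<le> (\<gamma>\<^sup>2 / 16) / \<tau> ^ n"
      using s \<tau> by (intro frac_le bump_potential_square_le power_mono) auto
    finally show "Q s \<le> B" by (simp add: B_def)
  qed
  have fluxQ: "0 \<le> flux n Q s" "flux n Q s \<le> B" if s: "s \<in> {0..1}" for s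
  proof -
    have "flux n (\<lambda>s. 0 * Q s) s \<le> flux n Q s"
      by (rule flux_mono[OF _ cQ _ s]) (use Q in auto)
    then show "0 \<le> flux n Q s" unfolding flux_cmult by simp
    have "\<bar>flux n Q s\<bar> \<le> B * s ^ 0"
      by (rule flux_abs_le_power[OF cQ n _ s]) (use Q in auto)
    then show "flux n Q s \<le> B" by simp
  qed
  have flux_f: "flux n f s = c * flux n \<rho> s + (- (\<theta> * c\<^sup>2)) * flux n Q s" if "s \<in> {0..1}" for s
    unfolding f_def[abs_def]
    by (subst flux_add[OF _ _ that]) (auto intro!: continuous_intros bump_continuous cQ simp only: flux_cmult)
  have flux_lower: "(1 - \<delta>) * c * flux n \<rho> s \<le> flux n f s" if s: "s \<in> {0..1}" for s
  proof -
    have "\<theta> * c\<^sup>2 * flux n Q s \<le> 1 * c\<^sup>2 * B"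
      using \<theta> fluxQ[OF s] by (intro mult_mono) auto
    also have "\<dots> = c * (\<delta> * \<gamma>)" unfolding cB[symmetric] by (simp add: power2_eq_square)
    also have "\<dots> \<le> c * (\<delta> * flux n \<rho> s)"
      using c \<delta> flux_bump_ge[OF s] by (intro mult_left_mono) auto
    finally show ?thesis unfolding flux_f[OF s] by (simp add: algebra_simps)
  qed
  have flux_upper: "flux n f s \<le> c * flux n \<rho> s" if s: "s \<in> {0..1}" for s
    unfolding flux_f[OF s] using \<theta> fluxQ[OF s] by simp
  have V1: "(1 - \<delta>) * c * G s \<le> V s" if s: "s \<in> {0..1}" for s
  proof -
    have "potential n (\<lambda>s. (1 - \<delta>) * c * \<rho> s) s \<le> V s"
      unfolding V_def
      by (rule potential_mono[OF _ cf _ s]) (use flux_lower in \<open>auto simp: flux_cmult intro!: continuous_intros bump_continuous\<close>)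
    then show ?thesis unfolding potential_cmult[OF s] .
  qed
  have V2: "V s \<le> c * G s" if s: "s \<in> {0..1}" for s
  proof -
    have "V s \<le> potential n (\<lambda>s. c * \<rho> s) s"
      unfolding V_def
      by (rule potential_mono[OF cf _ _ s]) (use flux_upper in \<open>auto simp: flux_cmult intro!: continuous_intros bump_continuous\<close>)
    then show ?thesis unfolding potential_cmult[OF s] .
  qed
  have Vpos: "V s > 0" if s: "s \<in> {0..<1}" for s
  proof -
    have "0 < (1 - \<delta>) * c * G s" using \<delta> c bump_potential_pos[OF s] by simp
    then show ?thesis using V1[of s] s by simp
  qed
  have sub: "{0..<1} \<subseteq> {0..1::real}" by auto
  have C1V: "C1_profile V" unfolding V_def by (rule C1_profile_potential[OF cf])
  \<comment> \<open>At \<open>s = 1\<close> the quotient \<open>f / V\<close> reads \<open>0 / 0 = 0\<close>. This is also its limit, because near \<open>1\<close> it is bounded by a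
      multiple of \<open>G\<close>.\<close>
  have cM: "continuous_on {0..1} M"
    unfolding continuous_on_eq_continuous_within
  proof
    fix s :: real assume s: "s \<in> {0..1}"
    have cV: "continuous (at s within {0..1}) V" "continuous (at s within {0..1}) f"
      using C1_profile_continuous[OF C1V] cf s by (auto simp: continuous_on_eq_continuous_within)
    show "continuous (at s within {0..1}) M"
    proof (cases "s = 1")
      case False
      then have "V s \<noteq> 0" using Vpos[of s] s by simp
      then show ?thesis unfolding M_def by (intro continuous_intros cV)
    next
      case True
      have "((\<lambda>s. f s / V s) \<longlongrightarrow> 0) (at 1 within {0..1})"
      proof (rule Lim_null_comparison)
        have "e\<^sup>2 < 1" using e by (simp add: abs_square_less_1)
        then have "\<forall>\<^sub>F s in at 1 within {0..1}. e\<^sup>2 < s"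
          by (intro eventually_at_topological[THEN iffD2] exI[of _ "{e\<^sup>2<..}"]) auto
        moreover have "\<forall>\<^sub>F s in at 1 within {0..1}. s \<in> {0..1} \<and> s \<noteq> (1::real)"
          by (auto simp: eventually_at_filter)
        ultimately show "\<forall>\<^sub>F s in at 1 within {0..1}. norm (f s / V s) \<le> c / (1 - \<delta>) * G s"
        proof eventually_elim
          case (elim s)
          then have s: "s \<in> {0..<1}" "s \<in> {0..1}" by auto
          have V: "V s > 0" "(1 - \<delta>) * c * G s \<le> V s" using Vpos[OF s(1)] V1[OF s(2)] by auto
          have "\<bar>f s\<bar> = \<theta> * c\<^sup>2 * (G s * G s * X s)"
            using bump_outside[of s] elim \<theta> Q(1)[OF s(2)] by (simp add: f_def abs_mult Q_def) (simp add: abs_mult[symmetric] abs_of_nonneg X(1)[OF s(2)])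
          also have "\<dots> \<le> 1 * c\<^sup>2 * (G s * G s * 1)"
            using \<theta> X[OF s(2)] bump_potential_nonneg[OF s(2)] by (intro mult_mono) auto
          also have "\<dots> = c / (1 - \<delta>) * G s * ((1 - \<delta>) * c * G s)"
            using \<delta> by (simp add: power2_eq_square)
          also have "\<dots> \<le> c / (1 - \<delta>) * G s * V s"
            using V c \<delta> bump_potential_nonneg[OF s(2)] by (intro mult_left_mono) auto
          finally show ?case using V by (simp add: divide_le_eq)
        qed
        have "(G \<longlongrightarrow> G 1) (at 1 within {0..1})"
          using bump_potential_continuous unfolding continuous_on_def by (rule bspec) simp
        then have "((\<lambda>s. c / (1 - \<delta>) * G s) \<longlongrightarrow> c / (1 - \<delta>) * G 1) (at 1 within {0..1})"
          by (rule tendsto_mult_left)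
        then show "((\<lambda>s. c / (1 - \<delta>) * G s) \<longlongrightarrow> 0) (at 1 within {0..1})" by simp
      qed
      moreover have "(V \<longlongrightarrow> V 1) (at 1 within {0..1})" using cV(1) True by (simp add: continuous_within)
      ultimately have "((\<lambda>s. V s + f s / V s) \<longlongrightarrow> V 1 + 0) (at 1 within {0..1})" by (intro tendsto_add)
      then show ?thesis using True by (simp add: continuous_within M_def[abs_def] V_def)
    qed
  qed
  have C1M: "C1_profile M"
  proof -
    obtain f' V' where f': "profile_deriv f f'" and V': "profile_deriv V V'"
      using C1f C1V by (auto simp: C1_profile_def)
    have ne: "V s \<noteq> 0" if "s \<in> {0..<1}" for s using Vpos[OF that] by simp
    have "profile_deriv M (\<lambda>s. V' s + (f' s * V s - f s * V' s) / (V s * V s))"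
      unfolding profile_deriv_def
    proof (intro conjI ballI cM)
      have "continuous_on {0..<1} V'" "continuous_on {0..<1} f'" "continuous_on {0..<1} V" "continuous_on {0..<1} f"
        using f' V' by (auto simp: profile_deriv_def intro: continuous_on_subset[OF _ sub])
      then show "continuous_on {0..<1} (\<lambda>s. V' s + (f' s * V s - f s * V' s) / (V s * V s))"
        using ne by (intro continuous_intros) auto
      show "(M has_real_derivative V' s + (f' s * V s - f s * V' s) / (V s * V s)) (at s within {0..<1})"
        if s: "s \<in> {0..<1}" for s
        unfolding M_def[abs_def] using f' V' s ne[OF s]
        by (intro DERIV_add DERIV_divide) (auto simp: profile_deriv_def)
    qed
    then show ?thesis by (auto simp: C1_profile_def)
  qed
  have square: "V s * V s \<le> c\<^sup>2 * (G s * G s)" "\<theta> * (c\<^sup>2 * (G s * G s)) \<le> V s * V s" if s: "s \<in> {0..<1}" for s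
  proof -
    have s1: "s \<in> {0..1}" using s by auto
    have "V s * V s \<le> (c * G s) * (c * G s)"
      using V2[OF s1] Vpos[OF s] c bump_potential_pos[OF s] by (intro mult_mono) auto
    then show "V s * V s \<le> c\<^sup>2 * (G s * G s)" by (simp add: power2_eq_square mult_ac)
    have "((1 - \<delta>) * c * G s) * ((1 - \<delta>) * c * G s) \<le> V s * V s"
      using V1[OF s1] Vpos[OF s] c bump_potential_pos[OF s] \<delta> by (intro mult_mono) auto
    then show "\<theta> * (c\<^sup>2 * (G s * G s)) \<le> V s * V s" by (simp add: \<theta>_def power2_eq_square mult_ac)
  qed
  show ?thesis
  proof (rule that[OF C1f C1M])
    show "M s > 0" if s: "s \<in> {0..<1}" for s
    proof -
      have s1: "s \<in> {0..1}" using s by auto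
      have "\<theta> * (c\<^sup>2 * (G s * G s)) * X s < \<theta> * (c\<^sup>2 * (G s * G s)) * 1"
        using \<theta> c bump_potential_pos[OF s] X[OF s1] by (intro mult_strict_left_mono) auto
      also have "\<dots> \<le> V s * V s" using square(2)[OF s] by simp
      finally have "- f s < V s * V s"
        using c bump_nonneg[of s] by (simp add: f_def Q_def mult.assoc) (smt (verit) mult_nonneg_nonneg)
      then have "0 < (V s * V s + f s) / V s" using Vpos[OF s] by simp
      then show ?thesis using Vpos[OF s] by (simp add: M_def add_divide_distrib)
    qed
    show "f s = potential n f s * (M s - potential n f s)" if s: "s \<in> {0..1}" for s
    proof (cases "s = 1")
      case True
      then show ?thesis using bump_outside[of 1] e by (simp add: f_def Q_def power_le_one)
    next
      case False
      then show ?thesis using Vpos[of s] s by (simp add: M_def V_def)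
    qed
    have "0 \<le> (1 - \<delta>) * c * flux n \<rho> 1" using \<delta> c \<gamma> flux_bump_ge[of 1] by simp
    then show "flux n f 1 \<ge> 0" using flux_lower[of 1] by simp
    show "potential n f s > 0" if "s \<in> {0..<1}" for s using Vpos[OF that] by (simp add: V_def)
    show "(1 - \<delta>) * c * G s \<le> potential n f s" "potential n f s \<le> c * G s" if "s \<in> {0..1}" for s
      using V1[OF that] V2[OF that] by (auto simp: V_def)
    show "M s \<le> 2 * \<delta> * potential n f s + c * (G s * (1 - (s / (s + \<tau>)) ^ n)) + \<rho> s / G s / (1 - \<delta>)"
      if s: "s \<in> {0..<1}" for s
      unfolding V_def[symmetric] X_def[symmetric]
    proof -
      have s1: "s \<in> {0..1}" using s by auto
      have "c * \<rho> s / V s \<le> c * \<rho> s / ((1 - \<delta>) * c * G s)"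
        using V1[OF s1] c \<delta> bump_potential_pos[OF s] bump_nonneg[of s] by (intro divide_left_mono) (auto intro!: mult_pos_pos Vpos[OF s])
      also have "\<dots> = \<rho> s / G s / (1 - \<delta>)" using c by simp
      finally have 1: "c * \<rho> s / V s \<le> \<rho> s / G s / (1 - \<delta>)" .
      have "\<theta> * X s * (V s * V s) \<le> \<theta> * X s * (c\<^sup>2 * (G s * G s))"
        using \<theta> X[OF s1] square(1)[OF s] by (intro mult_left_mono) auto
      then have 2: "\<theta> * X s * V s \<le> \<theta> * c\<^sup>2 * Q s / V s"
        using Vpos[OF s] by (simp add: pos_le_divide_eq Q_def mult_ac)
      have "M s = V s + c * \<rho> s / V s - \<theta> * c\<^sup>2 * Q s / V s"
        by (simp add: M_def f_def diff_divide_distrib)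
      also have "\<dots> \<le> V s + \<rho> s / G s / (1 - \<delta>) - \<theta> * X s * V s" using 1 2 by linarith
      also have "\<dots> = (1 - \<theta>) * V s + \<theta> * (V s * (1 - X s)) + \<rho> s / G s / (1 - \<delta>)" by (simp add: algebra_simps)
      also have "\<dots> \<le> 2 * \<delta> * V s + 1 * ((c * G s) * (1 - X s)) + \<rho> s / G s / (1 - \<delta>)"
      proof (intro add_mono mult_mono order_refl)
        show "1 - \<theta> \<le> 2 * \<delta>" by (simp add: \<theta>_def power2_diff)
      qed (use \<theta> V2[OF s1] X[OF s1] Vpos[OF s] c bump_potential_pos[OF s] \<delta> in auto)
      finally show "M s \<le> 2 * \<delta> * V s + c * (G s * (1 - X s)) + \<rho> s / G s / (1 - \<delta>)" by (simp add: mult.assoc)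
    qed
  qed
qed

end

section \<open>Norms on the ball and the supremum\<close>

lemma ball_not_AE_False: "\<not> (AE x in lebesgue_on (ball (0::'a::euclidean_space) 1). False)"
proof
  assume "AE x in lebesgue_on (ball (0::'a) 1). False"
  then have "emeasure (lebesgue_on (ball (0::'a) 1)) (ball 0 1) = 0"
    by (subst (asm) AE_iff_measurable[where N="ball 0 1"]) (auto simp: sets_restrict_space)
  then have "emeasure lborel (ball (0::'a) 1) = 0"
    by (simp add: emeasure_restrict_space)
  moreover have "emeasure lborel (ball (0::'a) 1) = ennreal (unit_ball_vol DIM('a) * 1 ^ DIM('a))"
    by (rule emeasure_ball) simp
  moreover have "unit_ball_vol (real DIM('a)) > 0" by (rule unit_ball_vol_pos) simp
  ultimately show False by simp
qed

lemma positive_not_AE_0: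
  fixes f :: "'a::euclidean_space \<Rightarrow> real"
  assumes "\<And>x. x \<in> ball 0 1 \<Longrightarrow> f x > 0"
  shows "\<not> (AE x in lebesgue_on (ball 0 1). f x \<le> 0)"
proof
  assume "AE x in lebesgue_on (ball 0 1). f x \<le> 0"
  moreover have "AE x in lebesgue_on (ball 0 1). f x > 0" by (rule AE_I2) (use assms in auto)
  ultimately have "AE x in lebesgue_on (ball (0::'a) 1). False" by eventually_elim auto
  then show False using ball_not_AE_False by blast
qed

lemma ball_integral_pos:
  fixes f :: "'a::euclidean_space \<Rightarrow> real"
  assumes i: "integrable (lebesgue_on (ball 0 1)) f" and pos: "\<And>x. x \<in> ball 0 1 \<Longrightarrow> f x > 0"
  shows "0 < (LINT x|lebesgue_on (ball 0 1). f x)"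
proof -
  have nn: "AE x in lebesgue_on (ball 0 1). 0 \<le> f x" by (rule AE_I2) (use pos in \<open>auto intro: less_imp_le\<close>)
  have "(LINT x|lebesgue_on (ball 0 1). f x) \<noteq> 0"
  proof
    assume "(LINT x|lebesgue_on (ball 0 1). f x) = 0"
    then have "AE x in lebesgue_on (ball 0 1). f x = 0" using integral_nonneg_eq_0_iff_AE[OF i nn] by simp
    then have "AE x in lebesgue_on (ball 0 1). f x \<le> 0" by eventually_elim simp
    then show False using positive_not_AE_0[of f, OF pos] by blast
  qed
  then show ?thesis using integral_nonneg_AE[OF nn] by simp
qed

lemma bounded_positive_in_Linf_plus:
  fixes m :: "'a::euclidean_space \<Rightarrow> real"
  assumes c: "continuous_on (ball 0 1) m" and pos: "\<And>x. x \<in> ball 0 1 \<Longrightarrow> m x > 0"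
    and bd: "\<And>x. x \<in> ball 0 1 \<Longrightarrow> m x \<le> C"
  shows "m \<in> Linf_plus (ball 0 1)"
proof -
  let ?M = "lebesgue_on (ball (0::'a) 1)"
  have meas: "m \<in> borel_measurable ?M" by (rule continuous_measurable_lebesgue_on[OF open_ball c])
  then have meas': "(\<lambda>x. ereal \<bar>m x\<bar>) \<in> borel_measurable ?M" by simp
  have "Linf_norm (ball 0 1) m \<le> ereal C"
    unfolding Linf_norm_def by (rule esssup_I[OF meas']) (rule AE_I2, use pos bd in \<open>auto simp: abs_of_pos\<close>)
  then have 1: "Linf_norm (ball 0 1) m < \<infinity>" by (rule le_less_trans) simp
  have 2: "Linf_norm (ball 0 1) m > 0"
  proof (rule ccontr)
    assume "\<not> Linf_norm (ball 0 1) m > 0"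
    then have le: "esssup ?M (\<lambda>x. ereal \<bar>m x\<bar>) \<le> 0" by (simp add: Linf_norm_def)
    have "AE x in ?M. ereal \<bar>m x\<bar> \<le> esssup ?M (\<lambda>x. ereal \<bar>m x\<bar>)" by (rule esssup_AE)
    then have "AE x in ?M. m x \<le> 0"
    proof eventually_elim
      case (elim x)
      then have "ereal \<bar>m x\<bar> \<le> 0" using le by (rule order.trans)
      then show ?case by simp
    qed
    then show False using positive_not_AE_0[of m, OF pos] by blast
  qed
  have "AE x in ?M. m x \<ge> 0" by (rule AE_I2) (use pos in \<open>auto intro: less_imp_le\<close>)
  then show ?thesis using meas 1 2 by (simp add: Linf_plus_def Linf_space_def)
qed

text \<open>
  The radial principal solution is a positive eigenfunction, so its parameter \<open>\<kappa> < 1\<close> is the least eigenvalue.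
\<close>
lemma lambda1_radial_less_1:
  fixes M f :: "real \<Rightarrow> real"
  defines "n \<equiv> DIM('a::euclidean_space)"
  assumes n: "n \<ge> 2" and M: "C1_profile M" and Mpos: "\<And>s. s \<in> {0..<1} \<Longrightarrow> M s > 0" and f: "C1_profile f"
    and V: "\<And>s. s \<in> {0..<1} \<Longrightarrow> potential n f s > 0"
    and fV: "\<And>s. s \<in> {0..1} \<Longrightarrow> f s = potential n f s * (M s - potential n f s)"
    and f1: "flux n f 1 \<ge> 0"
  shows "0 < lambda1 (ball (0::'a) 1) (\<lambda>x. M (x \<bullet> x))" "lambda1 (ball (0::'a) 1) (\<lambda>x. M (x \<bullet> x)) < 1"
proof -
  obtain M' f' where M': "profile_deriv M M'" and f': "profile_deriv f f'" using M f by (auto simp: C1_profile_def)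
  obtain \<kappa> F where F: "0 < \<kappa>" "\<kappa> < 1" "continuous_on {0..1} F" "\<And>s. s \<in> {0..<1} \<Longrightarrow> F s > 0" "F 1 = 0"
    "\<And>s. s \<in> {0..1} \<Longrightarrow> F s = 1 - \<kappa> * cumflux n (\<lambda>s. M s * F s) s"
    using principal_radial_solution[OF n M' Mpos f' V fV f1] by blast
  have cM: "continuous_on {0..1} M" by (rule C1_profile_continuous[OF M])
  have "C1_profile (\<lambda>s. M s * F s)" using radial_solution_C1[OF M' F(3,6)] by (auto simp: C1_profile_def)
  then have "C1_profile (\<lambda>s. \<kappa> * (M s * F s))" by (rule C1_profile_cmult)
  then obtain g' where g': "profile_deriv (\<lambda>s. \<kappa> * (M s * F s)) g'" by (auto simp: C1_profile_def)
  define P where "P = potential n (\<lambda>s. \<kappa> * (M s * F s))"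
  define F1 where "F1 s = - flux n (\<lambda>s. \<kappa> * (M s * F s)) s / 4" for s
  define F2 where "F2 s = - flux' n g' s / 4" for s
  have n1: "n \<ge> 1" using n by simp
  have prof: "radial_profile P F1 F2"
    unfolding P_def F1_def[abs_def] F2_def[abs_def] by (rule potential_radial_profile(1)[OF g' n1])
  have PF: "P s = F s" if s: "s \<in> {0..1}" for s
  proof -
    have c: "continuous_on {0..1} (\<lambda>s. M s * F s)" by (intro continuous_intros cM F)
    have "P s = \<kappa> * (cumflux n (\<lambda>s. M s * F s) 1 - cumflux n (\<lambda>s. M s * F s) s)"
      unfolding P_def potential_cmult[OF s] potential_eq_cumflux[OF c s] ..
    also have "\<dots> = F s" using F(6)[of 1] F(5) F(6)[OF s] by (simp add: right_diff_distrib)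
    finally show ?thesis .
  qed
  have Lap: "2 * real n * F1 s + 4 * s * F2 s + \<kappa> * M s * P s = 0" if s: "s \<in> {0..<1}" for s
    using potential_radial_profile(2)[OF g' n1 s] PF[of s] s by (simp add: F1_def F2_def)
  define \<phi> where "\<phi> x = P (x \<bullet> x)" for x :: 'a
  let ?m = "\<lambda>x::'a. M (x \<bullet> x)"
  have \<phi>pos: "\<phi> x > 0" if "x \<in> ball 0 1" for x
    using PF[of "x \<bullet> x"] F(4)[of "x \<bullet> x"] inner_self_ball[OF that] by (simp add: \<phi>_def)
  have eig: "is_eigenvalue (ball 0 1) ?m \<kappa>"
    unfolding is_eigenvalue_def
  proof (intro bexI exI conjI)
    show "\<phi> \<in> dirichlet_space (ball 0 1)" unfolding \<phi>_def[abs_def] by (rule radial_dirichlet_space[OF prof])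
    show "\<not> (AE x in lebesgue_on (ball 0 1). \<phi> x = 0)"
    proof
      assume "AE x in lebesgue_on (ball 0 1). \<phi> x = 0"
      then have "AE x in lebesgue_on (ball 0 1). \<phi> x \<le> 0" by eventually_elim simp
      then show False using positive_not_AE_0[of \<phi>, OF \<phi>pos] by blast
    qed
    show "weak_laplacian (ball 0 1) \<phi> (\<lambda>x. 2 * DIM('a) * F1 (x \<bullet> x) + 4 * (x \<bullet> x) * F2 (x \<bullet> x))"
      unfolding \<phi>_def[abs_def] by (rule radial_weak_laplacian[OF prof])
    show "AE x in lebesgue_on (ball 0 1). 2 * DIM('a) * F1 (x \<bullet> x) + 4 * (x \<bullet> x) * F2 (x \<bullet> x) + \<kappa> * ?m x * \<phi> x = 0"
    proof (rule AE_I2)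
      fix x :: 'a assume "x \<in> space (lebesgue_on (ball 0 1))"
      then have "x \<bullet> x \<in> {0..<1}" using inner_self_ball[of x] by simp
      from Lap[OF this]
      show "2 * DIM('a) * F1 (x \<bullet> x) + 4 * (x \<bullet> x) * F2 (x \<bullet> x) + \<kappa> * ?m x * \<phi> x = 0"
        by (simp add: \<phi>_def n_def)
    qed
  qed
  obtain B where B: "B \<ge> 0" "\<And>s. s \<in> {0..1} \<Longrightarrow> \<bar>M s\<bar> \<le> B" using continuous_unit_interval_bounded[OF cM] by blast
  have least: "\<kappa> \<le> \<mu>" if "is_eigenvalue (ball 0 1) ?m \<mu>" for \<mu>
  proof (rule positive_eigenfunction_le_eigenvalue[where \<Omega>="ball 0 1" and \<phi>=\<phi> and m="?m" and C=B
        and g="\<lambda>b x. 2 * (x \<bullet> b) * F1 (x \<bullet> x)" and h="\<lambda>b x. 2 * (b \<bullet> b) * F1 (x \<bullet> x) + 4 * (x \<bullet> b) * (x \<bullet> b) * F2 (x \<bullet> x)"])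
    show "continuous_on (ball 0 1) \<phi>" unfolding \<phi>_def by (intro continuous_on_radial radial_profile_cont[OF prof])
    show "continuous_on (ball 0 1) (\<lambda>x. 2 * (x \<bullet> b) * F1 (x \<bullet> x))" for b :: 'a
      by (intro continuous_intros continuous_on_radial radial_profile_cont[OF prof])
    show "continuous_on (ball 0 1) (\<lambda>x. 2 * (b \<bullet> b) * F1 (x \<bullet> x) + 4 * (x \<bullet> b) * (x \<bullet> b) * F2 (x \<bullet> x))" for b :: 'a
      by (intro continuous_intros continuous_on_radial radial_profile_cont[OF prof])
    show "continuous_on (ball 0 1) ?m"
      by (intro continuous_on_radial continuous_on_subset[OF cM]) auto
    fix x :: 'a assume x: "x \<in> ball 0 1"
    have s: "x \<bullet> x \<in> {0..<1}" "x \<bullet> x \<in> {0..1}" using inner_self_ball[OF x] by auto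
    show "((\<lambda>t. \<phi> (x + t *\<^sub>R b)) has_real_derivative 2 * (x \<bullet> b) * F1 (x \<bullet> x)) (at 0)" for b
      unfolding \<phi>_def by (rule radial_line_derivative[OF radial_profile_deriv1[OF prof s(1)] x])
    show "((\<lambda>t. 2 * ((x + t *\<^sub>R b) \<bullet> b) * F1 ((x + t *\<^sub>R b) \<bullet> (x + t *\<^sub>R b))) has_real_derivative
        2 * (b \<bullet> b) * F1 (x \<bullet> x) + 4 * (x \<bullet> b) * (x \<bullet> b) * F2 (x \<bullet> x)) (at 0)" for b
      by (rule radial_gradient_line_derivative[OF prof x])
    show "(\<Sum>b\<in>Basis. 2 * (b \<bullet> b) * F1 (x \<bullet> x) + 4 * (x \<bullet> b) * (x \<bullet> b) * F2 (x \<bullet> x)) + \<kappa> * ?m x * \<phi> x = 0"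
      unfolding radial_laplacian_sum using Lap[OF s(1)] by (simp add: \<phi>_def n_def)
    show "0 < ?m x" by (rule Mpos[OF s(1)])
    show "?m x \<le> B" using B(2)[OF s(2)] by simp
  qed (use \<phi>pos that in auto)
  have "lambda1 (ball 0 1) ?m = \<kappa>"
    unfolding lambda1_def using eig least by (rule Least_equality)
  then show "0 < lambda1 (ball (0::'a) 1) ?m" "lambda1 (ball (0::'a) 1) ?m < 1" using F(1,2) by auto
qed

lemma radial_logistic_solution:
  fixes M f :: "real \<Rightarrow> real"
  defines "n \<equiv> DIM('a::euclidean_space)"
  assumes f: "C1_profile f"
    and V: "\<And>s. s \<in> {0..<1} \<Longrightarrow> potential n f s > 0"
    and fV: "\<And>s. s \<in> {0..1} \<Longrightarrow> f s = potential n f s * (M s - potential n f s)"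
  shows "is_logistic_solution (ball (0::'a) 1) 1 (\<lambda>x. M (x \<bullet> x)) (\<lambda>x. potential n f (x \<bullet> x))"
proof -
  obtain f' where f': "profile_deriv f f'" using f by (auto simp: C1_profile_def)
  have n1: "n \<ge> 1" by (simp add: n_def Suc_leI)
  note prof = potential_radial_profile(1)[OF f' n1]
  show ?thesis
    unfolding is_logistic_solution_def
  proof (intro conjI exI ballI)
    show "(\<lambda>x. potential n f (x \<bullet> x)) \<in> dirichlet_space (ball (0::'a) 1)" by (rule radial_dirichlet_space[OF prof])
    show "continuous_on (ball (0::'a) 1) (\<lambda>x. potential n f (x \<bullet> x))"
      by (intro continuous_on_radial radial_profile_cont[OF prof])
    show "0 < potential n f (x \<bullet> x)" if "x \<in> ball (0::'a) 1" for x by (rule V[OF inner_self_ball[OF that]])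
    show "weak_laplacian (ball (0::'a) 1) (\<lambda>x. potential n f (x \<bullet> x))
       (\<lambda>x. 2 * DIM('a) * (- flux n f (x \<bullet> x) / 4) + 4 * (x \<bullet> x) * (- flux' n f' (x \<bullet> x) / 4))"
      by (rule radial_weak_laplacian[OF prof])
    show "AE x in lebesgue_on (ball (0::'a) 1). 1 * (2 * DIM('a) * (- flux n f (x \<bullet> x) / 4) + 4 * (x \<bullet> x) * (- flux' n f' (x \<bullet> x) / 4)) +
        potential n f (x \<bullet> x) * (M (x \<bullet> x) - potential n f (x \<bullet> x)) = 0"
    proof (rule AE_I2)
      fix x :: 'a assume "x \<in> space (lebesgue_on (ball 0 1))"
      then have s: "x \<bullet> x \<in> {0..<1}" "x \<bullet> x \<in> {0..1}" using inner_self_ball[of x] by auto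
      have "1 * (2 * DIM('a) * (- flux n f (x \<bullet> x) / 4) + 4 * (x \<bullet> x) * (- flux' n f' (x \<bullet> x) / 4)) = - f (x \<bullet> x)"
        using potential_radial_profile(2)[OF f' n1 s(1)] by (simp add: n_def)
      then show "1 * (2 * DIM('a) * (- flux n f (x \<bullet> x) / 4) + 4 * (x \<bullet> x) * (- flux' n f' (x \<bullet> x) / 4)) +
        potential n f (x \<bullet> x) * (M (x \<bullet> x) - potential n f (x \<bullet> x)) = 0"
        unfolding fV[OF s(2), symmetric] by linarith
    qed
  qed
qed

lemma bump_potential_has_integral:
  fixes n :: nat and e r :: real
  assumes n: "n \<ge> 2" and e: "0 < e" "e < 1" and r: "0 \<le> r" "r \<le> 1"
  shows "((\<lambda>t. t * flux n (bump n e) (t\<^sup>2) / 2) has_integral potential n (bump n e) (r\<^sup>2)) {r..1}"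
proof -
  note cb = bump_continuous[OF n e]
  have "((\<lambda>t. t * flux n (bump n e) (t\<^sup>2) / 2) has_integral (- potential n (bump n e) (1\<^sup>2) - - potential n (bump n e) (r\<^sup>2))) {r..1}"
  proof (rule fundamental_theorem_of_calculus[OF r(2)])
    fix t assume t: "t \<in> {r..1}"
    have t2: "t\<^sup>2 \<in> {0..1}" using t r by (auto simp: power_le_one)
    have "(potential n (bump n e) has_real_derivative - flux n (bump n e) (t\<^sup>2) / 4) (at (t\<^sup>2) within (\<lambda>t. t\<^sup>2) ` {r..1})"
      by (rule DERIV_subset[OF potential_derivative[OF cb t2]]) (use r in \<open>auto simp: power_le_one\<close>)
    moreover have "((\<lambda>t. t\<^sup>2) has_real_derivative 2 * t) (at t within {r..1})"
      by (auto intro!: derivative_eq_intros)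
    ultimately have "(potential n (bump n e) \<circ> (\<lambda>t. t\<^sup>2) has_real_derivative - flux n (bump n e) (t\<^sup>2) / 4 * (2 * t)) (at t within {r..1})"
      by (rule DERIV_image_chain)
    from DERIV_minus[OF this]
    show "((\<lambda>t. - potential n (bump n e) (t\<^sup>2)) has_vector_derivative t * flux n (bump n e) (t\<^sup>2) / 2) (at t within {r..1})"
      by (simp add: has_real_derivative_iff_has_vector_derivative[symmetric] o_def mult.commute)
  qed
  then show ?thesis by simp
qed

text \<open>
  Write \<open>G(|x|\<^sup>2)\<close> as the integral of \<open>k(t) = t flux(t\<^sup>2) / 2\<close> over \<open>t\<close> from \<open>|x|\<close> to \<open>1\<close> and exchange the order of integration. For
  fixed \<open>t\<close> the volume of the ball of radius \<open>min r t\<close> is at most \<open>\<omega> r t\<^sup>n\<^sup>-\<^sup>1\<close>, and \<open>t\<^sup>n\<^sup>-\<^sup>1 k(t) \<le> \<gamma> / 2\<close>.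
\<close>
lemma bump_potential_mass:
  fixes e r :: real
  defines "n \<equiv> DIM('a::euclidean_space)"
  assumes n: "n \<ge> 2" and e: "0 < e" "e < 1" and r: "0 < r"
  shows "(LINT x|lebesgue_on (ball (0::'a) 1). potential n (bump n e) (x \<bullet> x) * indicator (cball 0 r) x)
          \<le> bump_mass n / 2 * unit_ball_vol n * r"
proof -
  let ?G = "potential n (bump n e)" and ?\<gamma> = "bump_mass n" and ?\<omega> = "unit_ball_vol (real n)"
  let ?L = "lebesgue_on (ball (0::'a) 1)"
  note cb = bump_continuous[OF n e]
  have \<gamma>: "?\<gamma> > 0" using n by (intro bump_mass_pos) simp
  have \<omega>: "?\<omega> > 0" by (rule unit_ball_vol_pos) simp
  define k where "k t = t * flux n (bump n e) (t\<^sup>2) / 2" for t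
  have ck: "continuous_on {0..1} k"
    unfolding k_def by (intro continuous_intros continuous_on_square_arg flux_continuous cb) simp
  have knn: "k t \<ge> 0" if t: "t \<in> {0..1}" for t
    using flux_bump_ge[OF n e square_mem_unit(1)[OF t]] \<gamma> t by (simp add: k_def)
  define A where "A = ball 0 1 \<inter> cball (0::'a) r"
  define D where "D = {p :: 'a \<times> real. norm (fst p) \<le> snd p}"
  define kk where "kk t = indicator {0..1} t *\<^sub>R k t" for t
  define f where "f x t = ennreal (kk t) * indicator A x * indicator D (x, t)" for x t
  have [measurable]: "kk \<in> borel_measurable lborel"
    unfolding kk_def[abs_def] using borel_measurable_continuous_on_indicator[OF _ ck] by simp
  have [measurable]: "A \<in> sets lborel" unfolding A_def by simp
  have "closed D" unfolding D_def by (intro closed_Collect_le continuous_intros)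
  then have "D \<in> sets borel" by simp
  then have [measurable]: "D \<in> sets (lborel \<Otimes>\<^sub>M lborel)"
    unfolding sets_pair_measure_cong[OF sets_lborel sets_lborel] borel_prod .
  have fm: "case_prod f \<in> borel_measurable (lborel \<Otimes>\<^sub>M lborel)"
    unfolding f_def case_prod_unfold prod.collapse by measurable
  define h where "h x = ?G (x \<bullet> x) * indicator (cball 0 r) x" for x :: 'a
  have hx: "ennreal (h x) * indicator (ball 0 1) x = (\<integral>\<^sup>+ t. f x t \<partial>lborel)" for x
  proof (cases "x \<in> A")
    case True
    then have x: "norm x < 1" "norm x \<le> r" by (auto simp: A_def)
    have "(\<integral>\<^sup>+ t. f x t \<partial>lborel) = (\<integral>\<^sup>+ t. ennreal (k t) * indicator {norm x..1} t \<partial>lborel)"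
    proof (rule nn_integral_cong)
      fix t
      show "f x t = ennreal (k t) * indicator {norm x..1} t"
      proof (cases "norm x \<le> t")
        case le: True
        then have "0 \<le> t" using norm_ge_zero[of x] by linarith
        then show ?thesis using True le by (simp add: f_def kk_def D_def indicator_def)
      next
        case False
        then show ?thesis by (simp add: f_def D_def)
      qed
    qed
    also have "\<dots> = ennreal (?G ((norm x)\<^sup>2))"
    proof (rule nn_integral_has_integral_lebesgue')
      show "0 \<le> k t" if "t \<in> {norm x..1}" for t
        by (rule knn) (use that order.trans[OF norm_ge_zero, of x t] in auto)
      show "(k has_integral ?G ((norm x)\<^sup>2)) {norm x..1}"
        unfolding k_def[abs_def] using x by (intro bump_potential_has_integral n e) auto
    qed
    finally show ?thesis using x by (simp add: h_def dot_square_norm)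
  next
    case False
    then have "ennreal (h x) * indicator (ball 0 1) x = 0" by (auto simp: A_def h_def indicator_def)
    moreover have "f x t = 0" for t using False by (simp add: f_def)
    ultimately show ?thesis by simp
  qed
  have "(\<integral>\<^sup>+ x. ennreal (h x) \<partial>?L) = (\<integral>\<^sup>+ x. ennreal (h x) * indicator (ball 0 1) x \<partial>lborel)"
    by (subst nn_integral_restrict_space) (simp_all add: nn_integral_completion)
  also have "\<dots> = (\<integral>\<^sup>+ x. (\<integral>\<^sup>+ t. f x t \<partial>lborel) \<partial>lborel)" unfolding hx ..
  also have "\<dots> = (\<integral>\<^sup>+ t. (\<integral>\<^sup>+ x. f x t \<partial>lborel) \<partial>lborel)"
    by (rule lborel_pair.Fubini'[OF fm, symmetric])
  also have "\<dots> \<le> (\<integral>\<^sup>+ t. ennreal (?\<gamma> / 2 * ?\<omega> * r) * indicator {0..1} (t::real) \<partial>lborel)"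
  proof (rule nn_integral_mono)
    fix t :: real
    show "(\<integral>\<^sup>+ x. f x t \<partial>lborel) \<le> ennreal (?\<gamma> / 2 * ?\<omega> * r) * indicator {0..1} t"
    proof (cases "t \<in> {0..1}")
      case t: True
      have "(\<integral>\<^sup>+ x. f x t \<partial>lborel) = (\<integral>\<^sup>+ x. ennreal (k t) * indicator (A \<inter> cball 0 t) x \<partial>lborel)"
        by (rule nn_integral_cong) (use t in \<open>auto simp: f_def kk_def D_def indicator_def\<close>)
      also have "\<dots> = ennreal (k t) * emeasure lborel (A \<inter> cball 0 t)"
        by (rule nn_integral_cmult_indicator) (simp add: A_def)
      also have "\<dots> \<le> ennreal (k t) * emeasure lborel (cball (0::'a) (min r t))"
        by (intro mult_left_mono emeasure_mono) (auto simp: A_def)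
      also have "\<dots> = ennreal (k t) * ennreal (?\<omega> * min r t ^ n)"
        using emeasure_cball[of "min r t" "0::'a"] r t by (simp add: n_def)
      also have "\<dots> = ennreal (k t * (?\<omega> * min r t ^ n))"
        using knn[OF t] by (simp add: ennreal_mult')
      also have "\<dots> \<le> ennreal (?\<gamma> / 2 * ?\<omega> * r)"
      proof (rule ennreal_leI)
        have pn: "y ^ n = y * y ^ (n - 1)" for y :: real using n by (cases n) auto
        have "min r t ^ n \<le> r * t ^ (n - 1)"
          unfolding pn using r t by (intro mult_mono power_mono) auto
        then have "k t * (?\<omega> * min r t ^ n) \<le> k t * (?\<omega> * (r * t ^ (n - 1)))"
          using knn[OF t] \<omega> by (intro mult_left_mono) auto
        also have "\<dots> = ?\<omega> * r / 2 * (t ^ n * flux n (bump n e) (t\<^sup>2))"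
          unfolding k_def pn by simp
        also have "\<dots> \<le> ?\<omega> * r / 2 * ?\<gamma>"
          using power_flux_bump(1)[OF n e, of t] t \<omega> r by (intro mult_left_mono) auto
        finally show "k t * (?\<omega> * min r t ^ n) \<le> ?\<gamma> / 2 * ?\<omega> * r" by (simp add: mult_ac)
      qed
      finally show ?thesis using t by simp
    next
      case False
      then have "f x t = 0" for x by (simp add: f_def kk_def)
      then show ?thesis by simp
    qed
  qed
  also have "\<dots> = ennreal (?\<gamma> / 2 * ?\<omega> * r)"
    by (subst nn_integral_cmult_indicator) auto
  finally have bound: "(\<integral>\<^sup>+ x. ennreal (h x) \<partial>?L) \<le> ennreal (?\<gamma> / 2 * ?\<omega> * r)" .
  have "continuous_on (ball (0::'a) 1) (\<lambda>x. ?G (x \<bullet> x))"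
    by (intro continuous_on_radial continuous_on_subset[OF bump_potential_continuous[OF n e]]) auto
  then have "(\<lambda>x. ?G (x \<bullet> x)) \<in> borel_measurable ?L"
    by (rule continuous_measurable_lebesgue_on[OF open_ball])
  moreover have "(indicator (cball 0 r) :: 'a \<Rightarrow> real) \<in> borel_measurable ?L"
    by (intro measurable_restrict_space1 borel_measurable_indicator) simp
  ultimately have hm: "h \<in> borel_measurable ?L" unfolding h_def by (intro borel_measurable_times)
  have "AE x in ?L. 0 \<le> h x"
    by (rule AE_I2) (use bump_potential_nonneg[OF n e] inner_self_ball in \<open>fastforce simp: h_def indicator_def simp del: mem_ball\<close>)
  from integral_eq_nn_integral[OF hm this] have "integral\<^sup>L ?L h = enn2real (\<integral>\<^sup>+ x. ennreal (h x) \<partial>?L)" .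
  also have "\<dots> \<le> ?\<gamma> / 2 * ?\<omega> * r"
    by (rule enn2real_leI[OF _ bound]) (use \<gamma> \<omega> r in simp)
  finally show ?thesis by (simp only: h_def[abs_def])
qed

text \<open>
  With \<open>\<tau> = r\<^sup>4\<close> the cutoff is within \<open>n r\<^sup>2\<close> of \<open>1\<close> as soon as \<open>s > r\<^sup>2\<close>, by Bernoulli's inequality.
\<close>
lemma cutoff_defect:
  fixes s r :: real
  assumes s: "0 \<le> s" and r: "0 < r"
  shows "1 - (s / (s + r ^ 4)) ^ n \<le> (if s \<le> r\<^sup>2 then 1 else 0) + real n * r\<^sup>2"
proof (cases "s \<le> r\<^sup>2")
  case True
  have "0 \<le> (s / (s + r ^ 4)) ^ n" "0 \<le> real n * r\<^sup>2" using s r by auto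
  then have "1 - (s / (s + r ^ 4)) ^ n \<le> 1 + real n * r\<^sup>2" by linarith
  then show ?thesis using True by simp
next
  case False
  have pos: "s + r ^ 4 > 0" using s r by (simp add: add_nonneg_pos)
  define y where "y = r ^ 4 / (s + r ^ 4)"
  have y: "0 \<le> y" "y \<le> 1" using s r pos by (auto simp: y_def)
  have "1 - real n * y \<le> (1 - y) ^ n" using Bernoulli_inequality[of "- y" n] y by simp
  moreover have "1 - y = s / (s + r ^ 4)" using pos by (simp add: y_def field_simps)
  moreover have "y \<le> r\<^sup>2"
  proof -
    have "r ^ 4 = r\<^sup>2 * r\<^sup>2" by (simp add: power_add[symmetric])
    also have "\<dots> \<le> r\<^sup>2 * (s + r ^ 4)" proof (rule mult_left_mono)
      have "0 \<le> r ^ 4" using r by simp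
      then show "r\<^sup>2 \<le> s + r ^ 4" using False by linarith
    qed simp
    finally show ?thesis using pos by (simp add: y_def pos_divide_le_eq)
  qed
  then have "real n * y \<le> real n * r\<^sup>2" by (intro mult_left_mono) auto
  ultimately show ?thesis using False by simp
qed

lemma integrable_bounded_continuous_ball:
  fixes h :: "'a::euclidean_space \<Rightarrow> real"
  assumes "continuous_on (ball 0 1) h" "\<And>x. x \<in> ball 0 1 \<Longrightarrow> \<bar>h x\<bar> \<le> C"
  shows "integrable (lebesgue_on (ball 0 1)) h"
proof -
  interpret finite_measure "lebesgue_on (ball (0::'a) 1)"
    by (rule finite_measure_lebesgue_on_bounded) auto
  show ?thesis
    by (rule integrable_const_bound[where B=C])
       (use assms continuous_measurable_lebesgue_on in auto)
qed

lemma radial_integrable: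
  fixes F :: "real \<Rightarrow> real"
  assumes "continuous_on {0..1} F"
  shows "integrable (lebesgue_on (ball (0::'a::euclidean_space) 1)) (\<lambda>x. F (x \<bullet> x))"
    and "continuous_on (ball (0::'a) 1) (\<lambda>x. F (x \<bullet> x))"
proof -
  show c: "continuous_on (ball (0::'a) 1) (\<lambda>x. F (x \<bullet> x))"
    by (intro continuous_on_radial continuous_on_subset[OF assms]) auto
  obtain B where B: "\<And>s. s \<in> {0..1} \<Longrightarrow> \<bar>F s\<bar> \<le> B" using continuous_unit_interval_bounded[OF assms] by blast
  show "integrable (lebesgue_on (ball (0::'a) 1)) (\<lambda>x. F (x \<bullet> x))"
  proof (rule integrable_bounded_continuous_ball[OF c])
    show "\<bar>F (x \<bullet> x)\<bar> \<le> B" if "x \<in> ball 0 1" for x :: 'a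
      using inner_self_ball[OF that] by (intro B) auto
  qed
qed

lemma indicator_cball_measure:
  fixes r :: real
  assumes r: "0 \<le> r" "r < 1"
  shows "integrable (lebesgue_on (ball (0::'a::euclidean_space) 1)) (indicator (cball 0 r) :: 'a \<Rightarrow> real)"
    "(LINT x|lebesgue_on (ball (0::'a) 1). indicator (cball 0 r) x) = unit_ball_vol (real DIM('a)) * r ^ DIM('a)"
proof -
  let ?L = "lebesgue_on (ball (0::'a) 1)"
  interpret finite_measure ?L by (rule finite_measure_lebesgue_on_bounded) auto
  have sub: "cball (0::'a) r \<subseteq> ball 0 1" using r by auto
  have A: "cball (0::'a) r \<in> sets ?L" using sub by (simp add: sets_restrict_space_iff)
  show "integrable ?L (indicator (cball 0 r) :: 'a \<Rightarrow> real)" 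
    using A by (intro integrable_real_indicator) (auto simp: emeasure_eq_measure)
  have "(LINT x|?L. indicator (cball 0 r) x) = measure ?L (cball 0 r)"
    using A by (simp add: Int_absorb2[OF sub])
  also have "\<dots> = measure lborel (cball (0::'a) r)"
    using sub by (simp add: measure_restrict_space measure_def emeasure_restrict_space)
  also have "\<dots> = unit_ball_vol (real DIM('a)) * r ^ DIM('a)" using content_cball[OF r(1), of "0::'a"] by simp
  finally show "(LINT x|?L. indicator (cball 0 r) x) = unit_ball_vol (real DIM('a)) * r ^ DIM('a)" .
qed

text \<open>
  Integrate the bound of \<open>logistic_profile\<close> with \<open>\<tau> = r\<^sup>4\<close>. Each of its three terms contributes at most a third of \<open>\<eta>\<close> times the
  mass of \<open>V\<close>: by the choice of \<open>\<delta>\<close>, of \<open>r\<close>, and of \<open>e\<close>, in this order. Both \<open>r\<close> and \<open>c\<close> are fixed before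
  \<open>e\<close>, which is possible because the estimates for \<open>G\<close> are uniform in \<open>e\<close>.
\<close>
lemma exists_small_resource_profile:
  fixes \<eta> :: real
  defines "n \<equiv> DIM('a::euclidean_space)"
  assumes n: "n \<ge> 2" and \<eta>: "\<eta> > 0"
  obtains f M where "C1_profile f" "C1_profile M" "\<And>s. s \<in> {0..<1} \<Longrightarrow> M s > 0"
    "\<And>s. s \<in> {0..<1} \<Longrightarrow> potential n f s > 0"
    "\<And>s. s \<in> {0..1} \<Longrightarrow> f s = potential n f s * (M s - potential n f s)" "flux n f 1 \<ge> 0"
    "(LINT x|lebesgue_on (ball (0::'a) 1). M (x \<bullet> x)) \<le> \<eta> * (LINT x|lebesgue_on (ball (0::'a) 1). potential n f (x \<bullet> x))"
proof -
  let ?L = "lebesgue_on (ball (0::'a) 1)"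
  let ?I = "\<lambda>F::real \<Rightarrow> real. LINT x|?L. F (x \<bullet> x)"
  define \<omega> where "\<omega> = unit_ball_vol (real n)"
  define \<gamma> where "\<gamma> = bump_mass n"
  define \<kappa> where "\<kappa> = (LINT x|?L. (1 - x \<bullet> x) / 4)"
  have \<omega>: "\<omega> > 0" unfolding \<omega>_def by (rule unit_ball_vol_pos) simp
  have \<gamma>: "\<gamma> > 0" unfolding \<gamma>_def using n by (intro bump_mass_pos) simp
  have \<kappa>: "\<kappa> > 0"
    unfolding \<kappa>_def
  proof (rule ball_integral_pos)
    show "integrable ?L (\<lambda>x. (1 - x \<bullet> x) / 4)"
      using radial_integrable(1)[of "\<lambda>s. (1 - s) / 4"] by (simp add: continuous_intros)
    show "0 < (1 - x \<bullet> x) / 4" if "x \<in> ball 0 1" for x :: 'a using inner_self_ball[OF that] by simp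
  qed
  \<comment> \<open>The integral of \<open>V\<close> will be at least \<open>c \<gamma> \<kappa> / 2\<close>. The constants make the last two terms at most \<open>\<eta> / 3\<close> times
      this; the summand \<open>1\<close> in the exponent and the minimum with \<open>1\<close> only keep \<open>e\<close> and \<open>r\<close> in range.\<close>
  define \<delta> where "\<delta> = min (1 / 2) (\<eta> / 6)"
  have \<delta>: "0 < \<delta>" "\<delta> \<le> 1 / 2" "2 * \<delta> \<le> \<eta> / 3" using \<eta> by (auto simp: \<delta>_def)
  define r where "r = min 1 (\<eta> * \<kappa> / (6 * (\<omega> * (1 + real n))))"
  have r: "0 < r" "r \<le> 1" "\<omega> * (1 + real n) * r \<le> \<eta> * \<kappa> / 6"
  proof -
    show "0 < r" "r \<le> 1" using \<eta> \<kappa> \<omega> by (auto simp: r_def)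
    have "\<omega> * (1 + real n) * r \<le> \<omega> * (1 + real n) * (\<eta> * \<kappa> / (6 * (\<omega> * (1 + real n))))"
      using \<omega> by (intro mult_left_mono) (auto simp: r_def)
    also have "\<omega> * (1 + real n) > 0" using \<omega> by (simp add: add_pos_nonneg)
    then have "\<omega> * (1 + real n) * (\<eta> * \<kappa> / (6 * (\<omega> * (1 + real n)))) = \<eta> * \<kappa> / 6"
      using nonzero_mult_divide_mult_cancel_left[of "\<omega> * (1 + real n)" "\<eta> * \<kappa>" 6] by (simp only: times_divide_eq_right mult.commute[of 6])
    finally show "\<omega> * (1 + real n) * r \<le> \<eta> * \<kappa> / 6" .
  qed
  define c where "c = 16 * \<delta> * (r ^ 4) ^ n / \<gamma>"
  have c: "c > 0" using \<delta> r \<gamma> by (simp add: c_def)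
  define e where "e = exp (- (24 * \<omega> / (\<eta> * c * \<gamma>\<^sup>2 * \<kappa>) + 1))"
  have pp: "0 < 24 * \<omega> / (\<eta> * c * \<gamma>\<^sup>2 * \<kappa>)" using \<omega> \<eta> c \<gamma> \<kappa> by simp
  have e: "0 < e" "e < 1" using pp by (auto simp: e_def)
  have lne: "- ln e = 24 * \<omega> / (\<eta> * c * \<gamma>\<^sup>2 * \<kappa>) + 1" by (simp add: e_def)
  define G where "G = potential n (bump n e)"
  let ?Gr = "LINT x|?L. G (x \<bullet> x) * indicator (cball 0 r) x"
  have "r ^ 4 > 0" using r by simp
  from logistic_profile[OF n e this \<delta>(1,2)] obtain f M where fM: "C1_profile f" "C1_profile M"
    "\<And>s. s \<in> {0..<1} \<Longrightarrow> M s > 0"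
    "\<And>s. s \<in> {0..1} \<Longrightarrow> f s = potential n f s * (M s - potential n f s)"
    "flux n f 1 \<ge> 0" "\<And>s. s \<in> {0..<1} \<Longrightarrow> potential n f s > 0"
    "\<And>s. s \<in> {0..1} \<Longrightarrow> (1 - \<delta>) * c * G s \<le> potential n f s"
    "\<And>s. s \<in> {0..1} \<Longrightarrow> potential n f s \<le> c * G s"
    "\<And>s. s \<in> {0..<1} \<Longrightarrow> M s \<le> 2 * \<delta> * potential n f s + c * (G s * (1 - (s / (s + r ^ 4)) ^ n)) + bump n e s / G s / (1 - \<delta>)"
    unfolding c_def \<gamma>_def G_def by blast
  define V where "V = potential n f"
  have Gpos: "G s > 0" if "s \<in> {0..<1}" for s unfolding G_def by (rule bump_potential_pos[OF n e that])
  have cG: "continuous_on {0..1} G" unfolding G_def by (rule bump_potential_continuous[OF n e])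
  have cV: "continuous_on {0..1} V" unfolding V_def
    by (rule C1_profile_continuous[OF C1_profile_potential[OF C1_profile_continuous[OF fM(1)]]])
  have cM: "continuous_on {0..1} M" by (rule C1_profile_continuous[OF fM(2)])
  have iG: "integrable ?L (\<lambda>x. G (x \<bullet> x))" and iV: "integrable ?L (\<lambda>x. V (x \<bullet> x))" and iM: "integrable ?L (\<lambda>x. M (x \<bullet> x))"
    by (rule radial_integrable[OF cG] radial_integrable[OF cV] radial_integrable[OF cM])+
  have meas_cball: "(indicator (cball 0 r) :: 'a \<Rightarrow> real) \<in> borel_measurable ?L"
    by (intro measurable_restrict_space1 borel_measurable_indicator) simp
  have iGr: "integrable ?L (\<lambda>x. G (x \<bullet> x) * indicator (cball 0 r) x)"
    by (rule Bochner_Integration.integrable_bound[OF iG borel_measurable_times[OF borel_measurable_integrable[OF iG] meas_cball]])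
       (auto simp: indicator_def)
  define K where "K = 2 * (2 / (e ^ n * \<gamma> * - ln e))"
  have K: "K \<ge> 0" using pp \<gamma> e unfolding K_def lne by simp
  note ie = indicator_cball_measure[of e, where ?'a='a]
  have IG: "\<gamma> * \<kappa> \<le> ?I G"
  proof -
    have "\<gamma> * \<kappa> = (LINT x|?L. \<gamma> * ((1 - x \<bullet> x) / 4))" by (simp add: \<kappa>_def)
    also have "\<dots> \<le> ?I G"
    proof (rule integral_mono[OF _ iG])
      show "integrable ?L (\<lambda>x. \<gamma> * ((1 - x \<bullet> x) / 4))"
        using radial_integrable(1)[of "\<lambda>s. \<gamma> * ((1 - s) / 4)"] by (simp add: continuous_intros)
      fix x :: 'a assume "x \<in> space ?L"
      then have "x \<bullet> x \<in> {0..1}" using inner_self_ball[of x] by auto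
      from bump_potential_ge[OF n e this] show "\<gamma> * ((1 - x \<bullet> x) / 4) \<le> G (x \<bullet> x)" by (simp add: G_def \<gamma>_def)
    qed
    finally show ?thesis .
  qed
  have IV: "c * \<gamma> * \<kappa> / 2 \<le> ?I V"
  proof -
    have "c * \<gamma> * \<kappa> / 2 = (1 / 2) * c * (\<gamma> * \<kappa>)" by simp
    also have "\<dots> \<le> (1 - \<delta>) * c * ?I G"
      using \<delta> c \<gamma> \<kappa> IG by (intro mult_mono) auto
    also have "\<dots> = (LINT x|?L. (1 - \<delta>) * c * G (x \<bullet> x))" by simp
    also have "\<dots> \<le> ?I V"
    proof (rule integral_mono[OF _ iV])
      show "integrable ?L (\<lambda>x. (1 - \<delta>) * c * G (x \<bullet> x))" using iG by simp
      fix x :: 'a assume "x \<in> space ?L"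
      then have "x \<bullet> x \<in> {0..1}" using inner_self_ball[of x] by auto
      then show "(1 - \<delta>) * c * G (x \<bullet> x) \<le> V (x \<bullet> x)" unfolding V_def by (rule fM(7))
    qed
    finally show ?thesis .
  qed
  have IGr: "?Gr \<le> \<gamma> / 2 * \<omega> * r"
    using bump_potential_mass[where ?'a='a, OF _ e r(1)] n by (simp add: G_def \<gamma>_def \<omega>_def n_def)
  have IG1: "?I G \<le> \<gamma> / 2 * \<omega>"
  proof -
    have "?I G = (LINT x|?L. G (x \<bullet> x) * indicator (cball 0 1) x)"
      by (rule Bochner_Integration.integral_cong) auto
    also have "\<dots> \<le> \<gamma> / 2 * \<omega> * 1"
      using bump_potential_mass[where ?'a='a, OF _ e zero_less_one] n by (simp add: G_def \<gamma>_def \<omega>_def n_def)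
    finally show ?thesis by simp
  qed
  have "?I M \<le> (LINT x|?L. 2 * \<delta> * V (x \<bullet> x) +
      c * (G (x \<bullet> x) * indicator (cball 0 r) x + real n * r\<^sup>2 * G (x \<bullet> x)) + K * indicator (cball 0 e) x)"
  proof (rule integral_mono[OF iM])
    show "integrable ?L (\<lambda>x. 2 * \<delta> * V (x \<bullet> x) +
      c * (G (x \<bullet> x) * indicator (cball 0 r) x + real n * r\<^sup>2 * G (x \<bullet> x)) + K * indicator (cball 0 e) x)"
      using iV iG iGr ie(1) e by (intro Bochner_Integration.integrable_add integrable_mult_right) auto
    fix x :: 'a assume "x \<in> space ?L"
    then have s: "x \<bullet> x \<in> {0..<1}" using inner_self_ball[of x] by simp
    have ir: "indicator (cball 0 \<rho>) x = (if x \<bullet> x \<le> \<rho>\<^sup>2 then 1 else (0::real))" if "0 < \<rho>" for \<rho>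
      using that by (simp add: indicator_def dot_square_norm abs_le_square_iff[symmetric])
    have "G (x \<bullet> x) * (1 - (x \<bullet> x / (x \<bullet> x + r ^ 4)) ^ n) \<le> G (x \<bullet> x) * ((if x \<bullet> x \<le> r\<^sup>2 then 1 else 0) + real n * r\<^sup>2)"
      using Gpos[OF s] s r by (intro mult_left_mono cutoff_defect) auto
    also have "\<dots> = G (x \<bullet> x) * indicator (cball 0 r) x + real n * r\<^sup>2 * G (x \<bullet> x)"
      unfolding ir[OF r(1)] by (simp add: algebra_simps)
    finally have 1: "c * (G (x \<bullet> x) * (1 - (x \<bullet> x / (x \<bullet> x + r ^ 4)) ^ n)) \<le>
        c * (G (x \<bullet> x) * indicator (cball 0 r) x + real n * r\<^sup>2 * G (x \<bullet> x))"
      using c by (intro mult_left_mono) auto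
    have "bump n e (x \<bullet> x) / G (x \<bullet> x) / (1 - \<delta>) \<le> K * indicator (cball 0 e) x"
    proof -
      have nn: "0 \<le> bump n e (x \<bullet> x) / G (x \<bullet> x)"
        using bump_nonneg[OF n e] Gpos[OF s] by simp
      have "bump n e (x \<bullet> x) / G (x \<bullet> x) / (1 - \<delta>) \<le> bump n e (x \<bullet> x) / G (x \<bullet> x) / (1 / 2)"
        using nn \<delta> by (intro divide_left_mono) auto
      also have "\<dots> \<le> (if x \<bullet> x \<le> e\<^sup>2 then 2 / (e ^ n * \<gamma> * - ln e) else 0) / (1 / 2)"
        using bump_over_potential[OF n e s] unfolding G_def \<gamma>_def by (intro divide_right_mono) auto
      also have "\<dots> = K * indicator (cball 0 e) x"
        unfolding ir[OF e(1)] by (simp add: K_def)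
      finally show ?thesis .
    qed
    then show "M (x \<bullet> x) \<le> 2 * \<delta> * V (x \<bullet> x) +
      c * (G (x \<bullet> x) * indicator (cball 0 r) x + real n * r\<^sup>2 * G (x \<bullet> x)) + K * indicator (cball 0 e) x"
      using fM(9)[OF s] 1 unfolding V_def by linarith
  qed
  also have "\<dots> = 2 * \<delta> * ?I V +
      c * (?Gr + real n * r\<^sup>2 * ?I G) + K * (\<omega> * e ^ n)"
    using iV iG iGr ie e by (simp add: \<omega>_def n_def)
  also have "\<dots> \<le> \<eta> / 3 * ?I V + \<eta> / 3 * ?I V + \<eta> / 3 * ?I V"
  proof (intro add_mono)
    have V0: "0 \<le> ?I V" using IV c \<gamma> \<kappa> by (meson divide_nonneg_pos less_imp_le mult_pos_pos order.trans zero_less_numeral)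
    show "2 * \<delta> * ?I V \<le> \<eta> / 3 * ?I V"
      using \<delta>(3) V0 by (rule mult_right_mono)
    have "?Gr + real n * r\<^sup>2 * ?I G
        \<le> \<gamma> / 2 * \<omega> * r + real n * r * (\<gamma> / 2 * \<omega>)"
    proof (intro add_mono IGr mult_mono IG1)
      show "r\<^sup>2 \<le> r" using r mult_left_mono[of r 1 r] by (simp add: power2_eq_square)
      have "0 \<le> \<gamma> * \<kappa>" using \<gamma> \<kappa> by simp
      then show "0 \<le> ?I G" using IG by linarith
    qed (use r in auto)
    also have "\<dots> = \<gamma> / 2 * (\<omega> * (1 + real n) * r)" by (simp add: algebra_simps)
    also have "\<dots> \<le> \<gamma> / 2 * (\<eta> * \<kappa> / 6)" using \<gamma> r(3) by (intro mult_left_mono) auto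
    finally have "c * (?Gr + real n * r\<^sup>2 * ?I G)
        \<le> c * (\<gamma> / 2 * (\<eta> * \<kappa> / 6))" using c by (intro mult_left_mono) auto
    also have "\<dots> \<le> \<eta> / 3 * (c * \<gamma> * \<kappa> / 2)" using c \<gamma> \<eta> \<kappa> by (simp add: field_simps)
    also have "\<dots> \<le> \<eta> / 3 * ?I V" using IV \<eta> by (intro mult_left_mono) auto
    finally show "c * (?Gr + real n * r\<^sup>2 * ?I G)
        \<le> \<eta> / 3 * ?I V" .
    have lpos: "- ln e > 0" using e by simp
    have "24 * \<omega> = (24 * \<omega> / (\<eta> * c * \<gamma>\<^sup>2 * \<kappa>)) * (\<eta> * c * \<gamma>\<^sup>2 * \<kappa>)" using \<eta> c \<gamma> \<kappa> by simp
    also have "\<dots> \<le> - ln e * (\<eta> * c * \<gamma>\<^sup>2 * \<kappa>)"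
      using \<eta> c \<gamma> \<kappa> by (intro mult_right_mono) (auto simp: lne)
    finally have l: "24 * \<omega> \<le> - ln e * (\<eta> * c * \<gamma>\<^sup>2 * \<kappa>)" .
    have "K * (\<omega> * e ^ n) = 4 * \<omega> / (\<gamma> * - ln e)" using e by (simp add: K_def)
    also have "\<dots> \<le> \<eta> / 3 * (c * \<gamma> * \<kappa> / 2)"
    proof -
      have "4 * \<omega> \<le> \<eta> / 3 * (c * \<gamma> * \<kappa> / 2) * (\<gamma> * - ln e)"
        using l by (simp add: power2_eq_square algebra_simps)
      moreover have "\<gamma> * - ln e > 0" using \<gamma> lpos by (rule mult_pos_pos)
      ultimately show ?thesis by (simp only: pos_divide_le_eq)
    qed
    also have "\<dots> \<le> \<eta> / 3 * ?I V" using IV \<eta> by (intro mult_left_mono) auto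
    finally show "K * (\<omega> * e ^ n) \<le> \<eta> / 3 * ?I V" .
  qed
  also have "\<dots> = \<eta> * ?I V" by simp
  finally have main: "?I M \<le> \<eta> * ?I V" .
  show ?thesis
    by (rule that[OF fM(1,2,3,6,4,5) main[unfolded V_def]])
qed

lemma Lp_norm_1_eq_integral:
  assumes "\<And>x. x \<in> \<Omega> \<Longrightarrow> f x \<ge> 0" "\<Omega> \<in> sets lebesgue"
  shows "Lp_norm \<Omega> 1 f = (LINT x|lebesgue_on \<Omega>. f x)"
proof -
  have "(LINT x|lebesgue_on \<Omega>. \<bar>f x\<bar> powr 1) = (LINT x|lebesgue_on \<Omega>. f x)"
    by (rule Bochner_Integration.integral_cong) (use assms in auto)
  moreover have "0 \<le> (LINT x|lebesgue_on \<Omega>. f x)"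
    by (rule integral_nonneg_AE, rule AE_I2) (use assms in auto)
  ultimately show ?thesis by (simp add: Lp_norm_def)
qed

theorem theorem1p2:
  fixes \<Omega> :: "(real ^ 'n) set"
  assumes "CARD('n) \<ge> 2"
    and "\<Omega> = ball 0 1"
  shows "Sup {ereal (Lp_norm \<Omega> 1 u / Lp_norm \<Omega> 1 m) | m d u.
           m \<in> Linf_plus \<Omega> \<and> d \<in> {0<..<1 / lambda1 \<Omega> m} \<and> is_logistic_solution \<Omega> d m u} = \<infinity>"
proof (rule ereal_top)
  fix B :: real
  let ?S = "{ereal (Lp_norm \<Omega> 1 u / Lp_norm \<Omega> 1 m) | m d u.
           m \<in> Linf_plus \<Omega> \<and> d \<in> {0<..<1 / lambda1 \<Omega> m} \<and> is_logistic_solution \<Omega> d m u}"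
  define \<eta> where "\<eta> = 1 / (\<bar>B\<bar> + 1)"
  have \<eta>: "\<eta> > 0" by (simp add: \<eta>_def add_nonneg_pos)
  let ?n = "DIM(real ^ 'n)"
  have n: "?n \<ge> 2" using assms(1) by simp
  obtain f M where fM: "C1_profile f" "C1_profile M" "\<And>s. s \<in> {0..<1} \<Longrightarrow> M s > 0"
    "\<And>s. s \<in> {0..<1} \<Longrightarrow> potential ?n f s > 0"
    "\<And>s. s \<in> {0..1} \<Longrightarrow> f s = potential ?n f s * (M s - potential ?n f s)" "flux ?n f 1 \<ge> 0"
    "(LINT x|lebesgue_on (ball (0::real ^ 'n) 1). M (x \<bullet> x)) \<le> \<eta> * (LINT x|lebesgue_on (ball (0::real ^ 'n) 1). potential ?n f (x \<bullet> x))"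
    using exists_small_resource_profile[where ?'a="real ^ 'n", OF n \<eta>] by blast
  define m where "m x = M (x \<bullet> x)" for x :: "real ^ 'n"
  define u where "u x = potential ?n f (x \<bullet> x)" for x :: "real ^ 'n"
  have cM: "continuous_on {0..1} M" by (rule C1_profile_continuous[OF fM(2)])
  have pos: "m x > 0" "u x > 0" if "x \<in> ball 0 1" for x
    using fM(3,4)[OF inner_self_ball[OF that]] by (auto simp: m_def u_def)
  obtain C where C: "\<And>s. s \<in> {0..1} \<Longrightarrow> \<bar>M s\<bar> \<le> C" using continuous_unit_interval_bounded[OF cM] by blast
  have "m \<in> Linf_plus (ball 0 1)"
  proof (rule bounded_positive_in_Linf_plus[OF _ pos(1)])
    show "continuous_on (ball 0 1) m" unfolding m_def by (rule radial_integrable(2)[OF cM])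
    show "m x \<le> C" if "x \<in> ball 0 1" for x
      using C[of "x \<bullet> x"] inner_self_ball[OF that] by (auto simp: m_def)
  qed
  moreover have "0 < lambda1 (ball 0 1) m" "lambda1 (ball 0 1) m < 1"
    unfolding m_def[abs_def]
    using lambda1_radial_less_1[OF n fM(2,3,1,4,5,6)] by auto
  then have "(1::real) \<in> {0<..<1 / lambda1 (ball 0 1) m}" by simp
  moreover have "is_logistic_solution (ball 0 1) 1 m u"
    unfolding m_def[abs_def] u_def[abs_def] by (rule radial_logistic_solution[OF fM(1,4,5)])
  ultimately have mem: "ereal (Lp_norm \<Omega> 1 u / Lp_norm \<Omega> 1 m) \<in> ?S" unfolding assms(2) by blast
  have Lu: "Lp_norm \<Omega> 1 u = (LINT x|lebesgue_on (ball 0 1). u x)" and Lm: "Lp_norm \<Omega> 1 m = (LINT x|lebesgue_on (ball 0 1). m x)"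
    unfolding assms(2) by (intro Lp_norm_1_eq_integral less_imp_le pos; simp)+
  have "integrable (lebesgue_on (ball 0 1)) m" unfolding m_def[abs_def] by (rule radial_integrable(1)[OF cM])
  then have m0: "Lp_norm \<Omega> 1 m > 0" unfolding Lm by (rule ball_integral_pos) (rule pos(1))
  have "Lp_norm \<Omega> 1 m \<le> \<eta> * Lp_norm \<Omega> 1 u" using fM(7) unfolding Lu Lm m_def u_def .
  then have "(\<bar>B\<bar> + 1) * Lp_norm \<Omega> 1 m \<le> Lp_norm \<Omega> 1 u" by (simp add: \<eta>_def field_simps)
  then have "\<bar>B\<bar> + 1 \<le> Lp_norm \<Omega> 1 u / Lp_norm \<Omega> 1 m" using m0 by (simp add: pos_le_divide_eq)
  then have "ereal B \<le> ereal (Lp_norm \<Omega> 1 u / Lp_norm \<Omega> 1 m)" by simp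
  also have "\<dots> \<le> Sup ?S" by (rule Sup_upper[OF mem])
  finally show "ereal B \<le> Sup ?S" .
qed

end
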